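(* Let $(M,[g])$ be a conformally Einstein manifold of dimension $n\ge3$ with Einstein scale $\sigma$. Let $k$ be an integer with $1\le k\le\frac n2$ and let $\ell,p$ be integers with $1\le p\le\ell-1$. Then the operator $L_k^\ell:\mathcal E^k[k+\ell-\frac n2]\to\mathcal E^k[k-\ell-\frac n2]$ satisfies $$\frac1k\Big(k+(\ell-p)-\frac n2\Big)\Big(k-(\ell-p)-\frac n2\Big)L_k^\ell=\sigma^{-p}\,L_k^{\ell-p}\,\widetilde\Box_\sigma^{(p)},$$ where $\widetilde\Box_\sigma^{(p)}:=M^*(\Box_\sigma)^pM:\mathcal E^k[w]\to\mathcal E^k[w-p]$, taken here with $w=k+\ell-\frac n2$.
   Context: Conventions. $M$ is a smooth manifold with a conformal structure of signature $(p,q)$; $\mathcal E[w]$ is the space (bundle) of conformal densities of weight $w$ (induced from the $\mathbb R_+$-bundle of metrics in the class by $x\mapsto x^{-w/2}$); $\boldsymbol g$ is the conformal metric (tautological section of $S^2T^*M\otimes \mathcal E[2]$), used to raise and lower indices. $\mathcal E^k[w]$ denotes smooth $k$-forms of weight $w$. An Einstein scale is a positive $\sigma\in\mathcal E[1]$ such that $g=\sigma^{-2}\boldsymbol g$ is Einstein; everything is computed for this metric, $\nabla$ is its Levi-Civita connection (so $\nabla\sigma=0$). The curvature convention is $[\nabla_a,\nabla_b]v^c=R_{ab}{}^c{}_dv^d$, $R_{abcd}=C_{abcd}+2\boldsymbol g_{c[a}P_{b]d}+2\boldsymbol g_{d[b}P_{a]c}$ with $C$ the Weyl tensor and $P_{ab}$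 the Schouten tensor; $J=P^a{}_a\in\mathcal E[-2]$. On weighted forms $(df)_{a_0\cdots a_k}=(k+1)\nabla_{[a_0}f_{a_1\cdots a_k]}$ and $(\delta f)_{a_2\cdots a_k}=-\nabla^{a_1}f_{a_1\cdots a_k}$. Tractors. The standard tractor bundle is, in the scale $g$, $\mathcal E^A=\mathcal E[1]\oplus\mathcal E_a[1]\oplus\mathcal E[-1]$. Write $V_A=Y_A\alpha+Z_A{}^a\mu_a+X_A\tau$ for $(\alpha,\mu_a,\tau)$; the tractor metric satisfies $Y_AX^A=1$, $Z_{Ab}Z^A{}_c=\boldsymbol g_{bc}$, all other contractions of $X,Y,Z$ being zero. The tractor connection is $\nabla_a(\alpha,\mu_b,\tau)=(\nabla_a\alpha-\mu_a,\ \nabla_a\mu_b+\boldsymbol g_{ab}\tau+P_{ab}\alpha,\ \nabla_a\tau-P_{ab}\mu^b)$. $\mathcal T^k[w]$ denotes sections of $(\Lambda^k$ of the standard tractor bundle$)\otimes\mathcal E[w]$. In the Einstein scale put $\widetilde W_{ABCD}=Z_A{}^aZ_B{}^bZ_C{}^cZ_D{}^dC_{abcd}$; its double tensorial action on a tractor $k$-form is $(\widetilde W\sharp\sharp F)_{A_1\cdots A_k}=\frac{k(k-1)}2\widetilde W_{[A_1A_2}{}^{CD}F_{|CD|A_3\cdots A_k]}$. Define $\Box_\sigma:\mathcal T^k[w]\to\mathcal T^k[w-1]$ by $\Box_\sigma F=\sigma\big(-\nabla^a\nabla_aF-\widetilde W\sharp\sharp F-\frac{2w}{n}(n+w-1)JF\big)$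 ($\nabla$ the coupled tractor/Levi-Civita connection). Define $M:\mathcal E^k[w]\to\mathcal T^k[w-k]$ by $(Mf)_{A_1\cdots A_k}=\frac{n+w-2k}{k}Z_{A_1}{}^{a_1}\cdots Z_{A_k}{}^{a_k}f_{a_1\cdots a_k}+X_{[A_1}Z_{A_2}{}^{a_2}\cdots Z_{A_k]}{}^{a_k}(\delta f)_{a_2\cdots a_k}$. Define $q^k:\mathcal T^k[w']\to\mathcal E^k[w'+k]$ by $(q^kF)_{a_1\cdots a_k}=Z^{A_1}{}_{a_1}\cdots Z^{A_k}{}_{a_k}F_{A_1\cdots A_k}$, and $M^*:\mathcal T^k[w']\to\mathcal E^k[w'+k]$ by $M^*F=-(w'+k)\,q^kF+d\varphi$, where $\varphi_{a_2\cdots a_k}=X^{A_1}Z^{A_2}{}_{a_2}\cdots Z^{A_k}{}_{a_k}F_{A_1\cdots A_k}$. The operator $L_k^\ell$ is $L_k^\ell:=\sigma^{-\ell}q^k(\Box_\sigma)^\ell M:\mathcal E^k[w]\to\mathcal E^k[w-2\ell]$ with $w=k+\ell-\frac n2$, for positive integers $\ell$. *)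

theory Defs
  imports "HOL-Analysis.Analysis" "HOL-Combinatorics.Permutations"
begin

section \<open>Smooth manifolds, conformal classes and weighted forms\<close>

text \<open>
  A manifold is a Hausdorff, second countable type with a smooth atlas; tensor fields are families
  of component functions, one for each chart, that are related by the tensor transformation law.
  A chart is a pair (domain, coordinate map).
\<close>

type_synonym ('m, 'n) chart = "'m set \<times> ('m \<Rightarrow> real ^ 'n)"

definition pd :: "'n::finite \<Rightarrow> (real ^ 'n \<Rightarrow> real) \<Rightarrow> real ^ 'n \<Rightarrow> real" where
  "pd i f x = frechet_derivative f (at x) (axis i 1)"

text \<open>Used for open sets only: all iterated partial derivatives exist and are differentiable.\<close>

definition smooth_on :: "(real ^ 'n::finite) set \<Rightarrow> (real ^ 'n \<Rightarrow> real) \<Rightarrow> bool" where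
  "smooth_on S f \<longleftrightarrow> (\<forall>is. \<forall>x\<in>S. foldr pd is f differentiable (at x))"

definition chart_image :: "('m, 'n) chart \<Rightarrow> (real ^ 'n) set" where
  "chart_image c = snd c ` fst c"

definition chart_inv :: "('m, 'n) chart \<Rightarrow> real ^ 'n \<Rightarrow> 'm" where
  "chart_inv c = inv_into (fst c) (snd c)"

definition is_chart :: "('m::topological_space, 'n::finite) chart \<Rightarrow> bool" where
  "is_chart c \<longleftrightarrow> open (fst c) \<and> open (chart_image c)
     \<and> homeomorphism (fst c) (chart_image c) (snd c) (chart_inv c)"

definition smooth_atlas :: "('m::{t2_space, second_countable_topology}, 'n::finite) chart set \<Rightarrow> bool" where
  "smooth_atlas A \<longleftrightarrow> (\<forall>c\<in>A. is_chart c) \<and> (\<Union>c\<in>A. fst c) = UNIV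
     \<and> (\<forall>c\<in>A. \<forall>d\<in>A. \<forall>i.
          smooth_on (snd c ` (fst c \<inter> fst d)) (\<lambda>x. snd d (chart_inv c x) $ i))"

definition jacobian :: "('m, 'n::finite) chart \<Rightarrow> ('m, 'n) chart \<Rightarrow> real ^ 'n \<Rightarrow> real ^ 'n ^ 'n" where
  "jacobian c d x = (\<chi> i j. pd j (\<lambda>y. snd d (chart_inv c y) $ i) x)"

definition pullback_form :: "real ^ 'n ^ 'n \<Rightarrow> real ^ 'n ^ 'n \<Rightarrow> real ^ 'n::finite ^ 'n" where
  "pullback_form B G = transpose B ** G ** B"

definition has_signature :: "nat \<Rightarrow> nat \<Rightarrow> real ^ 'n::finite ^ 'n \<Rightarrow> bool" where
  "has_signature r s G \<longleftrightarrow> (\<exists>B e. invertible B \<and> (\<forall>i. e i = 1 \<or> e i = -1)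
     \<and> card {i. e i = 1} = r \<and> card {i. e i = -1} = s
     \<and> pullback_form B G = (\<chi> i j. if i = j then e i else 0))"

definition pseudo_riemannian_metric ::
  "('m, 'n::finite) chart set \<Rightarrow> nat \<Rightarrow> nat \<Rightarrow> (('m, 'n) chart \<Rightarrow> real ^ 'n \<Rightarrow> real ^ 'n ^ 'n) \<Rightarrow> bool" where
  "pseudo_riemannian_metric A r s g \<longleftrightarrow>
     (\<forall>c\<in>A. (\<forall>i j. smooth_on (chart_image c) (\<lambda>x. g c x $ i $ j))
        \<and> (\<forall>x\<in>chart_image c. transpose (g c x) = g c x \<and> has_signature r s (g c x)))
     \<and> (\<forall>c\<in>A. \<forall>d\<in>A. \<forall>m\<in>fst c \<inter> fst d.
          g c (snd c m) = pullback_form (jacobian c d (snd c m)) (g d (snd d m)))"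

text \<open>The fibre at a point of the ray bundle of metrics in the conformal class \<open>[g]\<close>.\<close>

definition conf_fibre :: "(real ^ 'n \<Rightarrow> real ^ 'n ^ 'n) \<Rightarrow> real ^ 'n \<Rightarrow> (real ^ 'n::finite ^ 'n) set" where
  "conf_fibre g x = {t\<^sup>2 *\<^sub>R g x | t. t > 0}"

text \<open>
  A section of a bundle of weight \<open>w\<close> is a function of a point \<open>x\<close> and of a point \<open>G\<close> in the fibre
  over \<open>x\<close> of the ray bundle, homogeneous in the sense that replacing \<open>G\<close> by \<open>t\<^sup>2 G\<close> multiplies it
  by \<open>t powr w\<close>. In particular the conformal metric, of weight 2, is \<open>(x, G) \<mapsto> G\<close>. A covariant
  tensor index list is a list over \<open>'n\<close>; only lists whose length is the valence are meaningful.
\<close>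

type_synonym 'n density = "real ^ 'n \<Rightarrow> real ^ 'n ^ 'n \<Rightarrow> real"
type_synonym 'n form = "real ^ 'n \<Rightarrow> real ^ 'n ^ 'n \<Rightarrow> 'n list \<Rightarrow> real"

definition weighted_forms ::
  "('m, 'n::finite) chart set \<Rightarrow> (('m, 'n) chart \<Rightarrow> real ^ 'n \<Rightarrow> real ^ 'n ^ 'n) \<Rightarrow> nat \<Rightarrow> real
     \<Rightarrow> (('m, 'n) chart \<Rightarrow> 'n form) set" where
  "weighted_forms A g k w = {f.
     (\<forall>c\<in>A.
        (\<forall>I. length I = k \<longrightarrow> smooth_on (chart_image c) (\<lambda>x. f c x (g c x) I))
      \<and> (\<forall>x\<in>chart_image c. \<forall>G\<in>conf_fibre (g c) x. \<forall>I. length I = k \<longrightarrow>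
          (\<forall>t>0. f c x (t\<^sup>2 *\<^sub>R G) I = t powr w * f c x G I)
        \<and> (\<forall>\<pi>. \<pi> permutes {..<k} \<longrightarrow>
            f c x G (permute_list \<pi> I) = of_int (sign \<pi>) * f c x G I)))
   \<and> (\<forall>c\<in>A. \<forall>d\<in>A. \<forall>m\<in>fst c \<inter> fst d. \<forall>G\<in>conf_fibre (g d) (snd d m). \<forall>I. length I = k \<longrightarrow>
        f c (snd c m) (pullback_form (jacobian c d (snd c m)) G) I
        = (\<Sum>L | length L = k. (\<Prod>i<k. jacobian c d (snd c m) $ (L ! i) $ (I ! i))
              * f d (snd d m) G L))}"

section \<open>Curvature of a metric in local coordinates\<close>

definition christoffel :: "(real ^ 'n \<Rightarrow> real ^ 'n ^ 'n) \<Rightarrow> real ^ 'n \<Rightarrow> 'n \<Rightarrow> 'n::finite \<Rightarrow> 'n \<Rightarrow> real" where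
  "christoffel g x c a b = (\<Sum>d\<in>UNIV. matrix_inv (g x) $ c $ d / 2 *
     (pd a (\<lambda>y. g y $ d $ b) x + pd b (\<lambda>y. g y $ d $ a) x - pd d (\<lambda>y. g y $ a $ b) x))"

text \<open>\<open>riemann g x a b c d\<close> is \<open>R\<^sub>a\<^sub>b\<^sup>c\<^sub>d\<close>, where \<open>[\<nabla>\<^sub>a, \<nabla>\<^sub>b] v\<^sup>c = R\<^sub>a\<^sub>b\<^sup>c\<^sub>d v\<^sup>d\<close>.\<close>

definition riemann :: "(real ^ 'n \<Rightarrow> real ^ 'n ^ 'n) \<Rightarrow> real ^ 'n \<Rightarrow> 'n \<Rightarrow> 'n \<Rightarrow> 'n \<Rightarrow> 'n::finite \<Rightarrow> real" where
  "riemann g x a b c d =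
     pd a (\<lambda>y. christoffel g y c b d) x - pd b (\<lambda>y. christoffel g y c a d) x
     + (\<Sum>e\<in>UNIV. christoffel g x c a e * christoffel g x e b d
                 - christoffel g x c b e * christoffel g x e a d)"

definition ricci :: "(real ^ 'n \<Rightarrow> real ^ 'n ^ 'n) \<Rightarrow> real ^ 'n \<Rightarrow> 'n \<Rightarrow> 'n::finite \<Rightarrow> real" where
  "ricci g x b d = (\<Sum>a\<in>UNIV. riemann g x a b a d)"

definition scalar_curv :: "(real ^ 'n::finite \<Rightarrow> real ^ 'n ^ 'n) \<Rightarrow> real ^ 'n \<Rightarrow> real" where
  "scalar_curv g x = (\<Sum>a\<in>UNIV. \<Sum>b\<in>UNIV. matrix_inv (g x) $ a $ b * ricci g x a b)"

definition schouten :: "(real ^ 'n \<Rightarrow> real ^ 'n ^ 'n) \<Rightarrow> real ^ 'n \<Rightarrow> 'n \<Rightarrow> 'n::finite \<Rightarrow> real" where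
  "schouten g x a b = 1 / (real CARD('n) - 2) *
     (ricci g x a b - scalar_curv g x / (2 * (real CARD('n) - 1)) * g x $ a $ b)"

text \<open>
  From here on \<open>G\<close> is the value of the conformal metric, so that indices are raised and lowered
  with \<open>G\<close>; thus \<open>J\<close> has weight -2 and \<open>C\<^sub>a\<^sub>b\<^sub>c\<^sub>d\<close> weight 2.
\<close>

definition J_trace :: "(real ^ 'n::finite \<Rightarrow> real ^ 'n ^ 'n) \<Rightarrow> 'n density" where
  "J_trace g x G = (\<Sum>a\<in>UNIV. \<Sum>b\<in>UNIV. matrix_inv G $ a $ b * schouten g x a b)"

definition weyl ::
  "(real ^ 'n \<Rightarrow> real ^ 'n ^ 'n) \<Rightarrow> real ^ 'n \<Rightarrow> real ^ 'n ^ 'n \<Rightarrow> 'n \<Rightarrow> 'n \<Rightarrow> 'n \<Rightarrow> 'n::finite \<Rightarrow> real" where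
  "weyl g x G a b c d = (\<Sum>e\<in>UNIV. G $ c $ e * riemann g x a b e d)
     - (G $ c $ a * schouten g x b d - G $ c $ b * schouten g x a d)
     - (G $ d $ b * schouten g x a c - G $ d $ a * schouten g x b c)"

section \<open>Einstein scales\<close>

text \<open>
  The metric \<open>\<sigma>\<^sup>-\<^sup>2 G\<close> does not depend on the point \<open>G\<close> of the fibre; \<open>scale_metric\<close>
  evaluates it at the representative \<open>g\<close> of the class.
\<close>

definition scale_metric :: "(real ^ 'n \<Rightarrow> real ^ 'n ^ 'n) \<Rightarrow> 'n density \<Rightarrow> real ^ 'n::finite \<Rightarrow> real ^ 'n ^ 'n" where
  "scale_metric g \<sigma> x = \<sigma> x (g x) powi (-2) *\<^sub>R g x"

text \<open>
  Einstein means that the Ricci tensor is pointwise proportional to the metric. The constancy of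
  the factor (automatic on each component for \<open>n \<ge> 3\<close>) is not assumed.
\<close>

definition einstein_scale ::
  "('m, 'n::finite) chart set \<Rightarrow> (('m, 'n) chart \<Rightarrow> real ^ 'n \<Rightarrow> real ^ 'n ^ 'n)
     \<Rightarrow> (('m, 'n) chart \<Rightarrow> 'n density) \<Rightarrow> bool" where
  "einstein_scale A g \<sigma> \<longleftrightarrow>
     (\<lambda>c x G I. \<sigma> c x G) \<in> weighted_forms A g 0 1
   \<and> (\<forall>c\<in>A. \<forall>x\<in>chart_image c. (\<forall>G\<in>conf_fibre (g c) x. \<sigma> c x G > 0)
        \<and> (\<exists>c0. \<forall>a b. ricci (scale_metric (g c) (\<sigma> c)) x a b
                    = c0 * scale_metric (g c) (\<sigma> c) x $ a $ b))"

section \<open>Tractors\<close>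

text \<open>
  Tractor indices in the splitting given by the scale: a standard tractor
  \<open>V\<^sub>A = Y\<^sub>A \<alpha> + Z\<^sub>A\<^sup>a \<mu>\<^sub>a + X\<^sub>A \<tau>\<close> has the components \<open>V TY = \<alpha>\<close>,
  \<open>V (TZ a) = \<mu>\<^sub>a\<close> and \<open>V TX = \<tau>\<close>. When \<open>V\<close> has weight \<open>w\<close>, these
  component functions are homogeneous of degrees \<open>w + 1\<close>, \<open>w + 1\<close> and \<open>w - 1\<close>.
\<close>

datatype 'n tix = TY | TZ 'n | TX

instance tix :: (finite) finite
proof
  have "(UNIV :: 'a tix set) = {TY, TX} \<union> range TZ"
    by (metis UNIV_eq_I Un_iff insert_iff rangeI tix.exhaust)
  then show "finite (UNIV :: 'a tix set)"
    by (metis finite.emptyI finite_Un finite_code finite_imageI finite_insert)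
qed

text \<open>Fields with covariant tensor indices and tractor indices.\<close>

type_synonym 'n coupled = "real ^ 'n \<Rightarrow> real ^ 'n ^ 'n \<Rightarrow> 'n list \<Rightarrow> 'n tix list \<Rightarrow> real"
type_synonym 'n tform = "real ^ 'n \<Rightarrow> real ^ 'n ^ 'n \<Rightarrow> 'n tix list \<Rightarrow> real"

definition X_low :: "'n tix \<Rightarrow> real" where
  "X_low A = (if A = TX then 1 else 0)"

definition Z_low :: "'n tix \<Rightarrow> 'n \<Rightarrow> real" where
  "Z_low A a = (if A = TZ a then 1 else 0)"

text \<open>The inverse \<open>h\<^sup>A\<^sup>B\<close> of the tractor metric.\<close>

fun tractor_inv :: "real ^ 'n ^ 'n \<Rightarrow> 'n::finite tix \<Rightarrow> 'n tix \<Rightarrow> real" where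
  "tractor_inv G TY TX = 1"
| "tractor_inv G TX TY = 1"
| "tractor_inv G (TZ a) (TZ b) = matrix_inv G $ a $ b"
| "tractor_inv G _ _ = 0"

definition X_up :: "real ^ 'n ^ 'n \<Rightarrow> 'n::finite tix \<Rightarrow> real" where
  "X_up G A = (\<Sum>B\<in>UNIV. tractor_inv G A B * X_low B)"

definition Z_up :: "real ^ 'n ^ 'n \<Rightarrow> 'n::finite tix \<Rightarrow> 'n \<Rightarrow> real" where
  "Z_up G A a = (\<Sum>B\<in>UNIV. \<Sum>b\<in>UNIV. tractor_inv G A B * Z_low B b * G $ b $ a)"

text \<open>
  The tractor connection, acting in direction \<open>a\<close> on one tractor slot: \<open>v\<close> gives the components
  of the slot. The coordinate derivative, common to all the slots, is left out here.
\<close>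

fun tractor_conn ::
  "(real ^ 'n \<Rightarrow> real ^ 'n ^ 'n) \<Rightarrow> real ^ 'n \<Rightarrow> real ^ 'n ^ 'n \<Rightarrow> 'n \<Rightarrow> ('n tix \<Rightarrow> real) \<Rightarrow> 'n::finite tix \<Rightarrow> real" where
  "tractor_conn g x G a v TY = - v (TZ a)"
| "tractor_conn g x G a v (TZ b) =
     - (\<Sum>c\<in>UNIV. christoffel g x c a b * v (TZ c)) + G $ a $ b * v TX + schouten g x a b * v TY"
| "tractor_conn g x G a v TX =
     - (\<Sum>b\<in>UNIV. \<Sum>c\<in>UNIV. schouten g x a b * matrix_inv G $ b $ c * v (TZ c))"

text \<open>
  The coupled Levi-Civita-tractor connection; the new index comes first in the list. On the ray
  bundle the Levi-Civita connection of \<open>g = \<sigma>\<^sup>-\<^sup>2 G\<close> has the constant multiples of \<open>g\<close>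
  as its parallel sections, so a weighted field is differentiated at \<open>(x, G)\<close> along the section
  \<open>y \<mapsto> s\<^sup>2 g y\<close> through \<open>(x, G)\<close>, where \<open>s = \<sigma> x G\<close>. This needs no mention of the weight.
\<close>

fun nabla :: "(real ^ 'n \<Rightarrow> real ^ 'n ^ 'n) \<Rightarrow> 'n density \<Rightarrow> 'n coupled \<Rightarrow> 'n::finite coupled" where
  "nabla g \<sigma> F x G [] As = 0"
| "nabla g \<sigma> F x G (a # I) As =
     pd a (\<lambda>y. F y ((\<sigma> x G)\<^sup>2 *\<^sub>R g y) I As) x
     - (\<Sum>i<length I. \<Sum>c\<in>UNIV. christoffel g x c a (I ! i) * F x G (I[i := c]) As)
     + (\<Sum>j<length As. tractor_conn g x G a (\<lambda>B. F x G I (As[j := B])) (As ! j))"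

text \<open>\<open>alt T\<close> is the skew part of \<open>T\<close> (with the factor one over a factorial).\<close>

definition alt :: "('i list \<Rightarrow> real) \<Rightarrow> 'i list \<Rightarrow> real" where
  "alt T I = (\<Sum>\<pi> | \<pi> permutes {..<length I}. of_int (sign \<pi>) * T (permute_list \<pi> I))
               / fact (length I)"

definition nabla_form :: "(real ^ 'n \<Rightarrow> real ^ 'n ^ 'n) \<Rightarrow> 'n density \<Rightarrow> 'n form \<Rightarrow> 'n::finite form" where
  "nabla_form g \<sigma> f x G I = nabla g \<sigma> (\<lambda>y H L As. f y H L) x G I []"

definition ext_d :: "(real ^ 'n \<Rightarrow> real ^ 'n ^ 'n) \<Rightarrow> 'n density \<Rightarrow> 'n form \<Rightarrow> 'n::finite form" where
  "ext_d g \<sigma> f x G I = real (length I) * alt (nabla_form g \<sigma> f x G) I"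

definition codiff :: "(real ^ 'n \<Rightarrow> real ^ 'n ^ 'n) \<Rightarrow> 'n density \<Rightarrow> 'n form \<Rightarrow> 'n::finite form" where
  "codiff g \<sigma> f x G I =
     - (\<Sum>a\<in>UNIV. \<Sum>b\<in>UNIV. matrix_inv G $ a $ b * nabla_form g \<sigma> f x G (a # b # I))"

section \<open>The operators\<close>

definition tractor_laplacian :: "(real ^ 'n \<Rightarrow> real ^ 'n ^ 'n) \<Rightarrow> 'n density \<Rightarrow> 'n tform \<Rightarrow> 'n::finite tform" where
  "tractor_laplacian g \<sigma> F x G As = (\<Sum>a\<in>UNIV. \<Sum>b\<in>UNIV. matrix_inv G $ a $ b *
     nabla g \<sigma> (nabla g \<sigma> (\<lambda>y H I. F y H)) x G [a, b] As)"

definition W_tilde ::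
  "(real ^ 'n \<Rightarrow> real ^ 'n ^ 'n) \<Rightarrow> real ^ 'n \<Rightarrow> real ^ 'n ^ 'n
     \<Rightarrow> 'n tix \<Rightarrow> 'n tix \<Rightarrow> 'n tix \<Rightarrow> 'n::finite tix \<Rightarrow> real" where
  "W_tilde g x G A B C D = (\<Sum>a\<in>UNIV. \<Sum>b\<in>UNIV. \<Sum>c\<in>UNIV. \<Sum>d\<in>UNIV.
     Z_low A a * Z_low B b * Z_low C c * Z_low D d * weyl g x G a b c d)"

definition W_tilde_up ::
  "(real ^ 'n \<Rightarrow> real ^ 'n ^ 'n) \<Rightarrow> real ^ 'n \<Rightarrow> real ^ 'n ^ 'n
     \<Rightarrow> 'n tix \<Rightarrow> 'n tix \<Rightarrow> 'n tix \<Rightarrow> 'n::finite tix \<Rightarrow> real" where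
  "W_tilde_up g x G A B C D = (\<Sum>C'\<in>UNIV. \<Sum>D'\<in>UNIV.
     tractor_inv G C C' * tractor_inv G D D' * W_tilde g x G A B C' D')"

definition W_double_sharp :: "(real ^ 'n \<Rightarrow> real ^ 'n ^ 'n) \<Rightarrow> 'n tform \<Rightarrow> 'n::finite tform" where
  "W_double_sharp g F x G As = real (length As) * (real (length As) - 1) / 2 *
     alt (\<lambda>Bs. \<Sum>C\<in>UNIV. \<Sum>D\<in>UNIV.
       W_tilde_up g x G (Bs ! 0) (Bs ! 1) C D * F x G (C # D # drop 2 Bs)) As"

text \<open>\<open>Box g \<sigma> w\<close> is the operator on tractor forms of weight \<open>w\<close>; it lowers the weight by one.\<close>

definition Box :: "(real ^ 'n \<Rightarrow> real ^ 'n ^ 'n) \<Rightarrow> 'n density \<Rightarrow> real \<Rightarrow> 'n tform \<Rightarrow> 'n::finite tform" where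
  "Box g \<sigma> w F x G As = \<sigma> x G *
     (- tractor_laplacian g \<sigma> F x G As - W_double_sharp g F x G As
      - 2 * w / real CARD('n) * (real CARD('n) + w - 1) * J_trace g x G * F x G As)"

fun Box_pow :: "(real ^ 'n \<Rightarrow> real ^ 'n ^ 'n) \<Rightarrow> 'n density \<Rightarrow> nat \<Rightarrow> real \<Rightarrow> 'n tform \<Rightarrow> 'n::finite tform" where
  "Box_pow g \<sigma> 0 w F = F"
| "Box_pow g \<sigma> (Suc l) w F = Box_pow g \<sigma> l (w - 1) (Box g \<sigma> w F)"

text \<open>\<open>Z\<^bsub>A\<^sub>1\<^esub>\<^sup>a\<^sup>1 \<dots> Z\<^bsub>A\<^sub>m\<^esub>\<^sup>a\<^sup>m f\<^bsub>a\<^sub>1\<dots>a\<^sub>m\<^esub>\<close>, and the contraction of a tractor form with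
  \<open>Z\<^sup>A\<^sub>a\<close> in all its slots.\<close>

definition Z_insert :: "('n list \<Rightarrow> real) \<Rightarrow> 'n::finite tix list \<Rightarrow> real" where
  "Z_insert f As = (\<Sum>I | length I = length As. (\<Prod>i<length As. Z_low (As ! i) (I ! i)) * f I)"

definition Z_contract :: "real ^ 'n ^ 'n \<Rightarrow> ('n tix list \<Rightarrow> real) \<Rightarrow> 'n::finite list \<Rightarrow> real" where
  "Z_contract G F I = (\<Sum>As | length As = length I. (\<Prod>i<length I. Z_up G (As ! i) (I ! i)) * F As)"

definition M_op ::
  "(real ^ 'n \<Rightarrow> real ^ 'n ^ 'n) \<Rightarrow> 'n density \<Rightarrow> nat \<Rightarrow> real \<Rightarrow> 'n form \<Rightarrow> 'n::finite tform" where
  "M_op g \<sigma> k w f x G As =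
     (real CARD('n) + w - 2 * real k) / real k * Z_insert (f x G) As
     + alt (\<lambda>Bs. X_low (hd Bs) * Z_insert (codiff g \<sigma> f x G) (tl Bs)) As"

definition q_op :: "'n tform \<Rightarrow> 'n::finite form" where
  "q_op F x G I = Z_contract G (F x G) I"

definition X_contract :: "'n tform \<Rightarrow> 'n::finite form" where
  "X_contract F x G I = (\<Sum>A\<in>UNIV. X_up G A * Z_contract G (\<lambda>As. F x G (A # As)) I)"

text \<open>The operator \<open>M\<^sup>*\<close> on tractor \<open>k\<close>-forms of weight \<open>w\<close>.\<close>

definition M_star ::
  "(real ^ 'n \<Rightarrow> real ^ 'n ^ 'n) \<Rightarrow> 'n density \<Rightarrow> nat \<Rightarrow> real \<Rightarrow> 'n tform \<Rightarrow> 'n::finite form" where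
  "M_star g \<sigma> k w F x G I =
     - (w + real k) * q_op F x G I + ext_d g \<sigma> (X_contract F) x G I"

text \<open>\<open>M\<close> lowers the weight from \<open>w\<close> to \<open>w - k\<close>, and the power of \<open>Box\<close> lowers it further by \<open>p\<close>.\<close>

definition Box_tilde ::
  "(real ^ 'n \<Rightarrow> real ^ 'n ^ 'n) \<Rightarrow> 'n density \<Rightarrow> nat \<Rightarrow> nat \<Rightarrow> real \<Rightarrow> 'n form \<Rightarrow> 'n::finite form" where
  "Box_tilde g \<sigma> k p w f =
     M_star g \<sigma> k (w - real k - real p) (Box_pow g \<sigma> p (w - real k) (M_op g \<sigma> k w f))"

definition L_weight :: "'n::finite itself \<Rightarrow> nat \<Rightarrow> nat \<Rightarrow> real" where
  "L_weight _ k l = real k + real l - real CARD('n) / 2"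

definition L_op ::
  "(real ^ 'n \<Rightarrow> real ^ 'n ^ 'n) \<Rightarrow> 'n density \<Rightarrow> nat \<Rightarrow> nat \<Rightarrow> 'n form \<Rightarrow> 'n::finite form" where
  "L_op g \<sigma> k l f x G I = (let w = L_weight TYPE('n) k l in
     \<sigma> x G powi (- int l) *
       q_op (Box_pow g \<sigma> l (w - real k) (M_op g \<sigma> k w f)) x G I)"

end

theory Submission
  imports Defs
begin

text \<open>
  A weighted field is differentiated along the parallel sections \<open>y \<mapsto> s\<^sup>2 g y\<close> of the ray bundle, on
  which the Einstein scale has the constant value \<open>s\<close>. Restricted to such a section weights disappear,
  and near a point all the operators become operators on ordinary tensor fields of the Einstein metric
  \<open>h = s\<^sup>2 g\<close>. By the theorem of Schur (\<open>schur\<close>) its Schouten tensor is \<open>(kap / 2) h\<close> with \<open>kap\<close>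
  constant on a ball.

  There the tractor connection is the Levi-Civita connection plus an algebraic term \<open>theta\<close>, and \<open>theta\<close>
  is parallel. The tractor Laplacian can therefore be computed on components (\<open>tLap_Z\<close>, \<open>tLap_A\<close>). The
  forms that occur have no component in the direction \<open>X \<and> Y\<close>, and consist of a \<open>k\<close>-form \<open>\<phi>\<close> and two
  \<open>(k-1)\<close>-forms \<open>b\<close>, \<open>c\<close>, namely their coefficients in the frame \<open>Z\<close>, \<open>X\<close> and the parallel tractor
  \<open>Y - (kap / 2) X\<close>. While \<open>b\<close> and \<open>c\<close> are coclosed the Weitzenboeck formula (\<open>weitzenboeck\<close>) turns
  \<open>Box\<close>, acting in weight \<open>m - n/2\<close>, into \<open>s\<close> times
    \<open>\<phi>' = (d \<delta> + \<delta> d) \<phi> - kap cc(m) \<phi> - 2 d b\<close>,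
    \<open>b' = \<delta> d b - kap (cc(m) - 2 h0) b - 2 kap \<delta> \<phi>\<close>,
    \<open>c' = \<delta> d c + ev(m) c - 2 \<delta> \<phi> + (h0 + 1) b\<close>,
  with \<open>h0 = n - 2k + 1\<close> (\<open>represents_box\<close>). The starting state \<open>M f\<close> is \<open>1/k\<close> times \<open>(tt(m) f, \<delta> f, 0)\<close>,
  and \<open>M\<^sup>*\<close> maps a state to \<open>- yy(m) \<phi> + d c\<close>.

  What remains is algebra with \<open>d\<close> and \<open>\<delta>\<close> (\<open>factorisation\<close>). Two relations carry it. After \<open>p\<close> steps,
  at level \<open>m = l - p\<close>, every state that started from some \<open>M f\<close> satisfies
    \<open>2 m (\<delta> \<phi> - tt(m) b) = (\<delta> d + ev(m)) c\<close>  (\<open>inv_step\<close>).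
  It says precisely that \<open>M M\<^sup>*\<close> of the state differs from a constant multiple of the state, in \<open>\<phi>\<close> and \<open>b\<close>,
  by a multiple of \<open>(2 m d c, (\<delta> d + gv(m)) c)\<close>. Pairs \<open>(2 m d e, (\<delta> d + gv(m)) e)\<close> are mapped by the
  step at level \<open>m\<close> to pairs of the same kind at level \<open>m - 1\<close>, and at level 0 their first entry vanishes
  (\<open>run_proportional\<close>). So the remaining \<open>m\<close> steps and the projection to \<open>\<phi>\<close> do not see the difference,
  and the constant is the factor \<open>- yy(m) tt(m)\<close> of the theorem.
\<close>

abbreviation index_sum :: "('i \<Rightarrow> 'a::comm_monoid_add) \<Rightarrow> 'a"  (binder "\<Oplus>" 10) where
  "index_sum f \<equiv> sum f UNIV"

section \<open>Partial derivatives and smooth functions\<close>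

lemma pd_eqI: "(f has_derivative f') (at x) \<Longrightarrow> pd i f x = f' (axis i 1)"
  unfolding pd_def using frechet_derivative_at by metis

lemma pd_cong:
  assumes "open S" "x \<in> S" "\<And>y. y \<in> S \<Longrightarrow> f y = g y"
  shows "pd i f x = pd i g x"
proof -
  have "(f has_derivative D) (at x) \<longleftrightarrow> (g has_derivative D) (at x)" for D
    using assms has_derivative_transform_within_open[of f D x UNIV S g]
      has_derivative_transform_within_open[of g D x UNIV S f] by auto
  then show ?thesis by (simp add: pd_def frechet_derivative_def)
qed

lemma pd_const [simp]: "pd i (\<lambda>x. c) x = 0"
  by (simp add: pd_def)

lemma pd_add:
  assumes "f differentiable (at x)" "g differentiable (at x)"
  shows "pd i (\<lambda>y. f y + g y) x = pd i f x + pd i g x"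
  using assms by (auto simp: differentiable_def pd_eqI intro!: pd_eqI[THEN trans] has_derivative_add)

lemma pd_mult:
  assumes "f differentiable (at x)" "g differentiable (at x)"
  shows "pd i (\<lambda>y. f y * g y) x = pd i f x * g x + f x * pd i g x"
proof -
  obtain f' g' where d: "(f has_derivative f') (at x)" "(g has_derivative g') (at x)"
    using assms by (auto simp: differentiable_def)
  show ?thesis
    using pd_eqI[OF has_derivative_mult[OF d]] pd_eqI[OF d(1)] pd_eqI[OF d(2)] by (simp add: algebra_simps)
qed

lemma pd_cmult:
  assumes "f differentiable (at x)"
  shows "pd i (\<lambda>y. c * f y) x = c * pd i f x"
  using pd_mult[OF differentiable_const assms] by simp

lemma pd_minus:
  assumes "f differentiable (at x)"
  shows "pd i (\<lambda>y. - f y) x = - pd i f x"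
  using pd_cmult[OF assms, of i "-1"] by simp

lemma pd_diff:
  assumes "f differentiable (at x)" "g differentiable (at x)"
  shows "pd i (\<lambda>y. f y - g y) x = pd i f x - pd i g x"
  using pd_add[OF assms(1) differentiable_minus[OF assms(2)]] pd_minus[OF assms(2)] by simp

lemma pd_sum:
  assumes "\<And>k. k \<in> K \<Longrightarrow> (f k) differentiable (at x)"
  shows "pd i (\<lambda>y. \<Sum>k\<in>K. f k y) x = (\<Sum>k\<in>K. pd i (f k) x)"
proof (cases "finite K")
  case True
  then show ?thesis using assms
  proof (induction K rule: finite_induct)
    case (insert k K)
    have "(\<lambda>y. \<Sum>k\<in>K. f k y) differentiable (at x)"
      using insert by (intro differentiable_sum) auto
    with insert show ?case by (simp add: pd_add)
  qed simp
qed simp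

lemma differentiable_cong_open:
  assumes "open S" "x \<in> S" "\<And>y. y \<in> S \<Longrightarrow> f y = g y" "f differentiable (at x)"
  shows "g differentiable (at x)"
  using assms has_derivative_transform_within_open[of f _ x UNIV S g] by (auto simp: differentiable_def)

text \<open>
  Smoothness is a coinductive property: a family of functions closed under partial derivatives,
  all of whose members are differentiable, consists of smooth functions.
\<close>

lemma smooth_on_coinduct:
  assumes S: "open S" and f: "f \<in> Fam"
    and diff: "\<And>f x. f \<in> Fam \<Longrightarrow> x \<in> S \<Longrightarrow> f differentiable (at x)"
    and step: "\<And>f i. f \<in> Fam \<Longrightarrow> \<exists>g\<in>Fam. \<forall>x\<in>S. pd i f x = g x"
  shows "smooth_on S f"
proof -
  have *: "\<exists>g\<in>Fam. \<forall>x\<in>S. foldr pd is f x = g x" for "is"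
  proof (induction "is")
    case (Cons i "is")
    then obtain g where g: "g \<in> Fam" "\<forall>x\<in>S. foldr pd is f x = g x" by blast
    obtain h where h: "h \<in> Fam" "\<forall>x\<in>S. pd i g x = h x" using step[OF g(1)] by blast
    have "foldr pd (i # is) f x = h x" if x: "x \<in> S" for x
      using pd_cong[OF S x, of "foldr pd is f" g i] g(2) h(2) x by simp
    with h(1) show ?case by blast
  qed (use f in auto)
  show ?thesis
    unfolding smooth_on_def
  proof (intro allI ballI)
    fix "is" x assume x: "x \<in> S"
    from *[of "is"] obtain g where g: "g \<in> Fam" "\<forall>x\<in>S. foldr pd is f x = g x" by blast
    show "foldr pd is f differentiable (at x)"
      by (rule differentiable_cong_open[OF S x _ diff[OF g(1) x]]) (use g in auto)
  qed
qed

lemma smooth_on_differentiable: "smooth_on S f \<Longrightarrow> x \<in> S \<Longrightarrow> f differentiable (at x)"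
  unfolding smooth_on_def by (drule spec[of _ "[]"]) simp

lemma smooth_on_pd:
  assumes "smooth_on S f"
  shows "smooth_on S (pd i f)"
  unfolding smooth_on_def
proof (intro allI ballI)
  fix "is" x assume "x \<in> S"
  with assms have "foldr pd (is @ [i]) f differentiable (at x)"
    unfolding smooth_on_def by blast
  then show "foldr pd is (pd i f) differentiable (at x)" by simp
qed

lemma smooth_on_subset: "smooth_on S f \<Longrightarrow> T \<subseteq> S \<Longrightarrow> smooth_on T f"
  unfolding smooth_on_def by auto

lemma smooth_on_cong:
  assumes "open S" "\<And>x. x \<in> S \<Longrightarrow> f x = g x" "smooth_on S f"
  shows "smooth_on S g"
proof (rule smooth_on_coinduct[of _ _ "{g. \<exists>f. smooth_on S f \<and> (\<forall>x\<in>S. f x = g x)}"])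
  fix g x assume "g \<in> {g. \<exists>f. smooth_on S f \<and> (\<forall>x\<in>S. f x = g x)}" "x \<in> S"
  then show "g differentiable (at x)"
    using differentiable_cong_open[OF assms(1)] smooth_on_differentiable by blast
next
  fix g i assume "g \<in> {g. \<exists>f. smooth_on S f \<and> (\<forall>x\<in>S. f x = g x)}"
  then obtain f where f: "smooth_on S f" "\<forall>x\<in>S. f x = g x" by auto
  have "\<forall>x\<in>S. pd i g x = pd i f x"
    using pd_cong[OF assms(1)] f(2) by metis
  then show "\<exists>h\<in>{g. \<exists>f. smooth_on S f \<and> (\<forall>x\<in>S. f x = g x)}. \<forall>x\<in>S. pd i g x = h x"
    using smooth_on_pd[OF f(1)] by blast
qed (use assms in auto)

lemma smooth_on_const: "smooth_on (S :: (real ^ 'n::finite) set) (\<lambda>x. c)"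
proof -
  have "\<exists>c'. foldr pd is (\<lambda>x. c) = (\<lambda>x. c')" for "is" :: "'n list"
  proof (induction "is")
    case (Cons i "is")
    then obtain c' where "foldr pd is (\<lambda>x. c) = (\<lambda>x. c')" by blast
    then show ?case by (intro exI[of _ 0] ext) simp
  qed auto
  then show ?thesis unfolding smooth_on_def by (metis differentiable_const)
qed

text \<open>
  The functions built from smooth ones by the operations below. The family is closed under partial
  derivatives, so that coinduction gives all the closure properties of smoothness at once.
\<close>

inductive_set smooth_closure :: "(real ^ 'n::finite) set \<Rightarrow> (real ^ 'n \<Rightarrow> real) set" for S where
  base: "smooth_on S f \<Longrightarrow> f \<in> smooth_closure S"
| add: "f \<in> smooth_closure S \<Longrightarrow> g \<in> smooth_closure S \<Longrightarrow> (\<lambda>x. f x + g x) \<in> smooth_closure S"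
| mult: "f \<in> smooth_closure S \<Longrightarrow> g \<in> smooth_closure S \<Longrightarrow> (\<lambda>x. f x * g x) \<in> smooth_closure S"
| inv: "smooth_on S f \<Longrightarrow> (\<And>x. x \<in> S \<Longrightarrow> f x \<noteq> 0) \<Longrightarrow> (\<lambda>x. inverse (f x)) \<in> smooth_closure S"
| powr: "smooth_on S f \<Longrightarrow> (\<And>x. x \<in> S \<Longrightarrow> f x > 0) \<Longrightarrow> (\<lambda>x. f x powr r) \<in> smooth_closure S"

lemma smooth_closure_differentiable:
  assumes "f \<in> smooth_closure S" "x \<in> S"
  shows "f differentiable (at x)"
  using assms
proof (induction rule: smooth_closure.induct)
  case (base f)
  then show ?case by (rule smooth_on_differentiable)
next
  case (inv f)
  then show ?case
    by (intro differentiable_inverse smooth_on_differentiable) auto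
next
  case (powr f r)
  then obtain D where "(f has_derivative D) (at x)"
    using smooth_on_differentiable differentiable_def by blast
  moreover have "f x > 0" using powr by auto
  ultimately show ?case
    unfolding differentiable_def
    by (blast intro: has_derivative_powr[OF _ has_derivative_const])
qed auto

lemma smooth_closure_pd:
  assumes "open S" "f \<in> smooth_closure S"
  shows "\<exists>g\<in>smooth_closure S. \<forall>x\<in>S. pd i f x = g x"
  using assms(2)
proof (induction rule: smooth_closure.induct)
  case (base f)
  then show ?case using smooth_on_pd smooth_closure.base by blast
next
  case (add f g)
  then obtain f' g' where "f' \<in> smooth_closure S" "\<forall>x\<in>S. pd i f x = f' x"
    "g' \<in> smooth_closure S" "\<forall>x\<in>S. pd i g x = g' x" by blast
  then show ?case
    using add.hyps by (intro bexI[of _ "\<lambda>x. f' x + g' x"])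
      (auto intro: smooth_closure.add simp: pd_add smooth_closure_differentiable)
next
  case (mult f g)
  then obtain f' g' where "f' \<in> smooth_closure S" "\<forall>x\<in>S. pd i f x = f' x"
    "g' \<in> smooth_closure S" "\<forall>x\<in>S. pd i g x = g' x" by blast
  then show ?case
    using mult.hyps by (intro bexI[of _ "\<lambda>x. f' x * g x + f x * g' x"])
      (auto intro!: smooth_closure.add smooth_closure.mult simp: pd_mult smooth_closure_differentiable)
next
  case (inv f)
  have 1: "(\<lambda>x. (inverse (f x) * inverse (f x)) * (-1 * pd i f x)) \<in> smooth_closure S"
    using inv by (intro smooth_closure.mult smooth_closure.inv smooth_closure.base smooth_on_const smooth_on_pd) auto
  have 2: "pd i (\<lambda>x. inverse (f x)) x = (inverse (f x) * inverse (f x)) * (-1 * pd i f x)" if x: "x \<in> S" for x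
  proof -
    obtain D where D: "(f has_derivative D) (at x)"
      using smooth_on_differentiable[OF inv(1) x] differentiable_def by blast
    show ?thesis
      using pd_eqI[OF Deriv.has_derivative_inverse[OF inv(2)[OF x] D]] pd_eqI[OF D] by simp
  qed
  show ?case by (intro bexI[OF _ 1] ballI 2)
next
  case (powr f r)
  have 1: "(\<lambda>x. f x powr (r - 1) * (r * pd i f x)) \<in> smooth_closure S"
    using powr by (intro smooth_closure.mult smooth_closure.powr smooth_closure.base smooth_on_const smooth_on_pd) auto
  have 2: "pd i (\<lambda>x. f x powr r) x = f x powr (r - 1) * (r * pd i f x)" if x: "x \<in> S" for x
  proof -
    obtain D where D: "(f has_derivative D) (at x)"
      using smooth_on_differentiable[OF powr(1) x] differentiable_def by blast
    have pos: "f x > 0" using powr x by auto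
    show ?thesis
      using pd_eqI[OF has_derivative_powr[OF D has_derivative_const pos], of i r] pd_eqI[OF D] pos
      by (simp add: powr_diff field_simps)
  qed
  show ?case by (intro bexI[OF _ 1] ballI 2)
qed

lemma smooth_closure_smooth: "open S \<Longrightarrow> f \<in> smooth_closure S \<Longrightarrow> smooth_on S f"
  using smooth_on_coinduct[of S f "smooth_closure S"] smooth_closure_differentiable smooth_closure_pd
  by blast

lemma smooth_on_add: "open S \<Longrightarrow> smooth_on S f \<Longrightarrow> smooth_on S g \<Longrightarrow> smooth_on S (\<lambda>x. f x + g x)"
  by (rule smooth_closure_smooth) (auto intro: smooth_closure.add smooth_closure.base)

lemma smooth_on_mult: "open S \<Longrightarrow> smooth_on S f \<Longrightarrow> smooth_on S g \<Longrightarrow> smooth_on S (\<lambda>x. f x * g x)"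
  by (rule smooth_closure_smooth) (auto intro: smooth_closure.mult smooth_closure.base)

lemma smooth_on_minus: "open S \<Longrightarrow> smooth_on S f \<Longrightarrow> smooth_on S (\<lambda>x. - f x)"
  using smooth_on_mult[of S "\<lambda>x. -1" f] smooth_on_const[of S "-1"] by simp

lemma smooth_on_diff: "open S \<Longrightarrow> smooth_on S f \<Longrightarrow> smooth_on S g \<Longrightarrow> smooth_on S (\<lambda>x. f x - g x)"
  using smooth_on_add[of S f "\<lambda>x. - g x"] smooth_on_minus[of S g] by simp

lemma smooth_on_sum:
  "open S \<Longrightarrow> (\<And>k. k \<in> K \<Longrightarrow> smooth_on S (f k)) \<Longrightarrow> smooth_on S (\<lambda>x. \<Sum>k\<in>K. f k x)"
  by (induction K rule: infinite_finite_induct) (auto intro: smooth_on_add smooth_on_const)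

lemma smooth_on_prod:
  "open S \<Longrightarrow> (\<And>k. k \<in> K \<Longrightarrow> smooth_on S (f k)) \<Longrightarrow> smooth_on S (\<lambda>x. \<Prod>k\<in>K. f k x)"
  by (induction K rule: infinite_finite_induct) (auto intro: smooth_on_mult smooth_on_const)

lemma smooth_on_inverse:
  "open S \<Longrightarrow> smooth_on S f \<Longrightarrow> (\<And>x. x \<in> S \<Longrightarrow> f x \<noteq> 0) \<Longrightarrow> smooth_on S (\<lambda>x. inverse (f x))"
  by (rule smooth_closure_smooth) (auto intro: smooth_closure.inv)

lemma smooth_on_powr:
  "open S \<Longrightarrow> smooth_on S f \<Longrightarrow> (\<And>x. x \<in> S \<Longrightarrow> f x > 0) \<Longrightarrow> smooth_on S (\<lambda>x. f x powr r)"
  by (rule smooth_closure_smooth) (auto intro: smooth_closure.powr)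

text \<open>
  The symmetric second difference divided by \<open>s\<^sup>2\<close> has each of the two mixed second derivatives as
  its limit, by the mean value theorem in the first direction and differentiability of the
  first derivative at the centre. Hence they agree.
\<close>

lemma second_difference_limit:
  fixes f :: "real ^ 'n::finite \<Rightarrow> real"
  assumes S: "open S" "x \<in> S" and f: "\<And>y. y \<in> S \<Longrightarrow> f differentiable (at y)"
    and p: "pd i f differentiable (at x)"
  shows "((\<lambda>s. (f (x + s *\<^sub>R axis i 1 + s *\<^sub>R axis j 1) - f (x + s *\<^sub>R axis i 1)
           - f (x + s *\<^sub>R axis j 1) + f x) / s\<^sup>2) \<longlongrightarrow> pd j (pd i f) x) (at_right 0)"
proof (rule tendstoI)
  fix e :: real assume e: "e > 0"
  let ?ei = "axis i 1 :: real ^ 'n" and ?ej = "axis j 1 :: real ^ 'n"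
  obtain L where L: "(pd i f has_derivative L) (at x)" using p differentiable_def by blast
  have pdL: "pd j (pd i f) x = L ?ej" by (rule pd_eqI[OF L])
  have "linear L" using L has_derivative_linear by blast
  from L obtain d1 where d1: "d1 > 0" "\<And>v. norm v < d1 \<Longrightarrow> \<bar>pd i f (x + v) - pd i f x - L v\<bar> \<le> e / 8 * norm v"
    unfolding has_derivative_at_alt using e
    by (metis add_diff_cancel_left' real_norm_def zero_less_divide_iff zero_less_numeral)
  obtain d2 where d2: "d2 > 0" "ball x d2 \<subseteq> S" using S openE by blast
  define d where "d = min d1 d2 / 3"
  have d: "d > 0" using d1 d2 by (simp add: d_def)
  have "dist ((f (x + s *\<^sub>R ?ei + s *\<^sub>R ?ej) - f (x + s *\<^sub>R ?ei) - f (x + s *\<^sub>R ?ej) + f x) / s\<^sup>2)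
      (pd j (pd i f) x) < e" if s: "0 < s" "s < d" for s
  proof -
    have nv: "norm (u *\<^sub>R ?ei + t *\<^sub>R ?ej) \<le> 2 * s" if "0 \<le> u" "u \<le> s" "0 \<le> t" "t \<le> s" for u t
    proof -
      have "norm (u *\<^sub>R ?ei + t *\<^sub>R ?ej) \<le> norm (u *\<^sub>R ?ei) + norm (t *\<^sub>R ?ej)" by (rule norm_triangle_ineq)
      also have "\<dots> \<le> 2 * s" using that by (simp add: norm_axis_1)
      finally show ?thesis .
    qed
    have inS: "x + (u *\<^sub>R ?ei + t *\<^sub>R ?ej) \<in> S" if "0 \<le> u" "u \<le> s" "0 \<le> t" "t \<le> s" for u t
    proof -
      have "norm (u *\<^sub>R ?ei + t *\<^sub>R ?ej) < d2" using nv[OF that] s d2 by (simp add: d_def)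
      then have "dist x (x + (u *\<^sub>R ?ei + t *\<^sub>R ?ej)) < d2" by (simp only: dist_norm norm_minus_commute[of x] add_diff_cancel_left')
      then show ?thesis using d2(2) by auto
    qed
    define g where "g u = f (x + (u *\<^sub>R ?ei + s *\<^sub>R ?ej)) - f (x + (u *\<^sub>R ?ei + 0 *\<^sub>R ?ej))" for u
    have der: "((\<lambda>u. f (x + (u *\<^sub>R ?ei + t *\<^sub>R ?ej))) has_real_derivative pd i f (x + (u *\<^sub>R ?ei + t *\<^sub>R ?ej))) (at u)"
      if ut: "0 \<le> u" "u \<le> s" "0 \<le> t" "t \<le> s" for u t
    proof -
      obtain D where D: "(f has_derivative D) (at (x + (u *\<^sub>R ?ei + t *\<^sub>R ?ej)))"
        using f[OF inS[OF ut]] differentiable_def by blast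
      have "((\<lambda>u. f (x + (u *\<^sub>R ?ei + t *\<^sub>R ?ej))) has_derivative (\<lambda>v. D (v *\<^sub>R ?ei))) (at u)"
        by (rule has_derivative_compose[where g = f and f = "\<lambda>u. x + (u *\<^sub>R ?ei + t *\<^sub>R ?ej)", OF _ D])
          (auto intro!: derivative_eq_intros)
      moreover have "D (v *\<^sub>R ?ei) = pd i f (x + (u *\<^sub>R ?ei + t *\<^sub>R ?ej)) * v" for v
        using linear_cmul[OF has_derivative_linear[OF D], of v ?ei] pd_eqI[OF D] by simp
      ultimately show ?thesis unfolding has_field_derivative_def by simp
    qed
    have "\<exists>u>0. u < s \<and> g s - g 0 = (s - 0) * (pd i f (x + (u *\<^sub>R ?ei + s *\<^sub>R ?ej)) - pd i f (x + (u *\<^sub>R ?ei + 0 *\<^sub>R ?ej)))"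
      by (rule MVT2) (use s in \<open>auto simp: g_def intro!: DERIV_diff der[of _ s] der[of _ 0, simplified]\<close>)
    then obtain u where u: "0 < u" "u < s"
      "g s - g 0 = s * (pd i f (x + (u *\<^sub>R ?ei + s *\<^sub>R ?ej)) - pd i f (x + (u *\<^sub>R ?ei + 0 *\<^sub>R ?ej)))" by auto
    let ?v = "u *\<^sub>R ?ei + s *\<^sub>R ?ej" and ?w = "u *\<^sub>R ?ei + 0 *\<^sub>R ?ej"
    have n: "norm ?v \<le> 2 * s" "norm ?w \<le> 2 * s" using u s by (intro nv; simp)+
    have lt: "norm ?v < d1" "norm ?w < d1" using n s d1 d2 by (auto simp: d_def)
    have "L ?v - L ?w = s * L ?ej"
      using \<open>linear L\<close> by (simp add: linear_add linear_cmul)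
    moreover have "\<bar>pd i f (x + ?v) - pd i f x - L ?v\<bar> \<le> e / 4 * s"
      using order_trans[OF d1(2)[OF lt(1)] mult_left_mono[OF n(1), of "e/8"]] e by simp
    moreover have "\<bar>pd i f (x + ?w) - pd i f x - L ?w\<bar> \<le> e / 4 * s"
      using order_trans[OF d1(2)[OF lt(2)] mult_left_mono[OF n(2), of "e/8"]] e by simp
    ultimately have "\<bar>(pd i f (x + ?v) - pd i f (x + ?w)) - s * L ?ej\<bar> \<le> e / 2 * s"
      using abs_triangle_ineq4[of "pd i f (x + ?v) - pd i f x - L ?v" "pd i f (x + ?w) - pd i f x - L ?w"]
      by (simp add: algebra_simps)
    also have "\<dots> < e * s" using e s by simp
    finally have *: "\<bar>(pd i f (x + ?v) - pd i f (x + ?w)) / s - L ?ej\<bar> < e"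
      using s by (simp add: field_simps abs_less_iff)
    have "f (x + s *\<^sub>R ?ei + s *\<^sub>R ?ej) - f (x + s *\<^sub>R ?ei) - f (x + s *\<^sub>R ?ej) + f x = g s - g 0"
      by (simp add: g_def add.assoc)
    then have "(f (x + s *\<^sub>R ?ei + s *\<^sub>R ?ej) - f (x + s *\<^sub>R ?ei) - f (x + s *\<^sub>R ?ej) + f x) / s\<^sup>2
        = (pd i f (x + ?v) - pd i f (x + ?w)) / s"
      using u(3) s by (simp add: power2_eq_square)
    then show ?thesis using * pdL by (simp add: dist_real_def)
  qed
  then show "\<forall>\<^sub>F s in at_right 0. dist ((f (x + s *\<^sub>R ?ei + s *\<^sub>R ?ej) - f (x + s *\<^sub>R ?ei) - f (x + s *\<^sub>R ?ej) + f x) / s\<^sup>2)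
      (pd j (pd i f) x) < e"
    unfolding eventually_at_right_field using d by auto
qed

lemma pd_commute:
  fixes f :: "real ^ 'n::finite \<Rightarrow> real"
  assumes S: "open S" "x \<in> S" and f: "smooth_on S f"
  shows "pd i (pd j f) x = pd j (pd i f) x"
proof -
  have d: "\<And>y. y \<in> S \<Longrightarrow> f differentiable (at y)" "pd i f differentiable (at x)" "pd j f differentiable (at x)"
    using f S by (auto intro: smooth_on_differentiable smooth_on_pd)
  have "((\<lambda>s. (f (x + s *\<^sub>R axis i 1 + s *\<^sub>R axis j 1) - f (x + s *\<^sub>R axis i 1)
           - f (x + s *\<^sub>R axis j 1) + f x) / s\<^sup>2) \<longlongrightarrow> pd i (pd j f) x) (at_right 0)"
    using second_difference_limit[OF S d(1) d(3), of i] by (simp add: algebra_simps)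
  then show ?thesis
    using second_difference_limit[OF S d(1) d(2), of j] tendsto_unique[OF trivial_limit_at_right_real]
    by blast
qed

section \<open>Alternating functions of index lists\<close>

text \<open>
  Stated by exchanges of two slots, which behave well under list updates; the sign of an arbitrary
  permutation is recovered in \<open>alternating_permute\<close>.
\<close>

definition alternating :: "nat \<Rightarrow> ('i list \<Rightarrow> real) \<Rightarrow> bool" where
  "alternating k F \<longleftrightarrow> (\<forall>I i j. length I = k \<longrightarrow> i < k \<longrightarrow> j < k \<longrightarrow> i \<noteq> j \<longrightarrow>
     F (I[i := I ! j, j := I ! i]) = - F I)"

lemma alternatingD:
  "alternating k F \<Longrightarrow> length I = k \<Longrightarrow> i < k \<Longrightarrow> j < k \<Longrightarrow> i \<noteq> j \<Longrightarrow> F (I[i := I ! j, j := I ! i]) = - F I"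
  by (auto simp: alternating_def)

lemma alternating_swap:
  assumes "alternating k F" "length I = k" "i < k" "j < k" "i \<noteq> j"
  shows "F (I[i := B, j := C]) = - F (I[i := C, j := B])"
  using alternatingD[OF assms(1), of "I[i := C, j := B]" i j] assms(2-)
  by (simp add: list_update_swap)

lemma alternating_repeat:
  assumes "alternating k F" "length I = k" "i < k" "j < k" "i \<noteq> j" "I ! i = I ! j"
  shows "F I = 0"
  using alternatingD[OF assms(1-5)] assms(6) by (metis list_update_id equal_neg_zero)

lemma alternating_cons_swap:
  assumes "alternating (Suc k) F" "length I = k" "j < k"
  shows "F (a # I[j := b]) = - F (b # I[j := a])"
  using alternating_swap[OF assms(1), of "a # I" 0 "Suc j" a b] assms by simp

lemma permute_list_transpose:
  assumes "i < length I" "j < length I"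
  shows "permute_list (Transposition.transpose i j) I = I[i := I ! j, j := I ! i]"
  using assms by (intro nth_equalityI) (auto simp: permute_list_def nth_list_update Transposition.transpose_def)

text \<open>Sign changes under transpositions within a set of slots give the sign under its permutations.\<close>

lemma permute_sign:
  fixes F :: "'i list \<Rightarrow> real"
  assumes swap: "\<And>I i j. length I = k \<Longrightarrow> i \<in> S \<Longrightarrow> j \<in> S \<Longrightarrow> i \<noteq> j \<Longrightarrow> F (I[i := I ! j, j := I ! i]) = - F I"
    and S: "S \<subseteq> {..<k}" and \<pi>: "\<pi> permutes S" and I: "length I = k"
  shows "F (permute_list \<pi> I) = of_int (sign \<pi>) * F I"
proof -
  have "finite S" using S finite_subset by blast
  show ?thesis
    using \<pi> \<open>finite S\<close> I
  proof (induction \<pi> arbitrary: I rule: permutes_induct)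
    case id
    then show ?case by simp
  next
    case (swap a b p)
    have ab: "a < k" "b < k" using swap.hyps S by auto
    have p: "p permutes {..<k}" using \<open>p permutes S\<close> S permutes_subset by blast
    then have "permute_list (Transposition.transpose a b \<circ> p) I = permute_list p (permute_list (Transposition.transpose a b) I)"
      using swap.prems by (intro permute_list_compose) auto
    also have "F \<dots> = of_int (sign p) * F (permute_list (Transposition.transpose a b) I)"
      by (rule swap.IH) (use swap.prems in simp)
    also have "F (permute_list (Transposition.transpose a b) I) = - F I"
      using swap.hyps swap.prems ab by (subst permute_list_transpose) (auto intro: assms(1))
    also have "of_int (sign p) * - F I = of_int (sign (Transposition.transpose a b \<circ> p)) * F I"
      using swap.hyps p permutation_permutes finite_lessThan
      by (subst sign_compose) (auto simp: permutation_swap_id sign_swap_id)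
    finally show ?case .
  qed
qed

lemma alternating_permute:
  assumes "alternating k F" "\<pi> permutes {..<k}" "length I = k"
  shows "F (permute_list \<pi> I) = of_int (sign \<pi>) * F I"
  by (rule permute_sign[of k "{..<k}"]) (use assms in \<open>auto simp: alternating_def\<close>)

lemma alternatingI_permute:
  assumes "\<And>I \<pi>. length I = k \<Longrightarrow> \<pi> permutes {..<k} \<Longrightarrow> F (permute_list \<pi> I) = of_int (sign \<pi>) * F I"
  shows "alternating k F"
  unfolding alternating_def
proof (intro allI impI)
  fix I :: "'a list" and i j assume *: "length I = k" "i < k" "j < k" "i \<noteq> j"
  then have "Transposition.transpose i j permutes {..<k}" by (intro permutes_swap_id) auto
  then show "F (I[i := I ! j, j := I ! i]) = - F I"
    using assms[OF *(1), of "Transposition.transpose i j"] * by (simp add: permute_list_transpose sign_swap_id)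
qed

lemma alternating_alt: "alternating k (alt T)"
proof (rule alternatingI_permute)
  fix I :: "'a list" and \<tau> assume I: "length I = k" and \<tau>: "\<tau> permutes {..<k}"
  have perm: "permutation p" if "p permutes {..<k}" for p
    using that permutation_permutes finite_lessThan by blast
  have "(\<Sum>\<pi> | \<pi> permutes {..<k}. of_int (sign \<tau>) * (of_int (sign \<pi>) * T (permute_list \<pi> I)))
      = (\<Sum>\<pi> | \<pi> permutes {..<k}. of_int (sign \<tau>) * (of_int (sign (\<tau> \<circ> \<pi>)) * T (permute_list (\<tau> \<circ> \<pi>) I)))"
    by (rule setum_permutations_compose_left[OF \<tau>])
  also have "\<dots> = (\<Sum>\<pi> | \<pi> permutes {..<k}. of_int (sign \<pi>) * T (permute_list \<pi> (permute_list \<tau> I)))"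
  proof (rule sum.cong[OF refl], clarify)
    fix \<pi> assume \<pi>: "\<pi> permutes {..<k}"
    have "permute_list (\<tau> \<circ> \<pi>) I = permute_list \<pi> (permute_list \<tau> I)"
      using \<pi> I by (intro permute_list_compose) auto
    moreover have "real_of_int (sign \<tau>) * real_of_int (sign \<tau>) = 1"
      by (simp flip: of_int_mult add: sign_idempotent)
    ultimately show "of_int (sign \<tau>) * (of_int (sign (\<tau> \<circ> \<pi>)) * T (permute_list (\<tau> \<circ> \<pi>) I))
        = of_int (sign \<pi>) * T (permute_list \<pi> (permute_list \<tau> I))"
      by (simp add: sign_compose[OF perm[OF \<tau>] perm[OF \<pi>]] flip: mult.assoc)
  qed
  finally show "alt T (permute_list \<tau> I) = of_int (sign \<tau>) * alt T I"
    using I by (simp add: alt_def sum_distrib_left)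
qed

text \<open>
  Averages over all permutations of a function of the images of the first one or two slots. Composing
  with a permutation that moves these slots to prescribed positions does not change the sum; adding
  over all positions turns it into a plain sum over slots.
\<close>

lemma sum_permutes_one:
  fixes g :: "nat \<Rightarrow> real"
  assumes "k \<ge> 1"
  shows "real k * (\<Sum>\<pi> | \<pi> permutes {..<k}. g (\<pi> 0)) = fact k * (\<Sum>a<k. g a)"
proof -
  let ?P = "{\<pi>. \<pi> permutes {..<k}}"
  have *: "(\<Sum>\<pi>\<in>?P. g (\<pi> a)) = (\<Sum>\<pi>\<in>?P. g (\<pi> 0))" if "a < k" for a
  proof -
    have "Transposition.transpose 0 a permutes {..<k}" using that by (intro permutes_swap_id) auto
    from sum_permutations_compose_right[OF this, of "\<lambda>\<pi>. g (\<pi> 0)"] show ?thesis by simp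
  qed
  have "real k * (\<Sum>\<pi>\<in>?P. g (\<pi> 0)) = (\<Sum>a<k. \<Sum>\<pi>\<in>?P. g (\<pi> 0))" by simp
  also have "\<dots> = (\<Sum>a<k. \<Sum>\<pi>\<in>?P. g (\<pi> a))"
    by (intro sum.cong refl *[symmetric]) auto
  also have "\<dots> = (\<Sum>\<pi>\<in>?P. \<Sum>a<k. g (\<pi> a))" by (rule sum.swap)
  also have "\<dots> = (\<Sum>\<pi>\<in>?P. \<Sum>a<k. g a)"
    by (intro sum.cong refl sum.permute[symmetric, unfolded comp_def]) auto
  also have "\<dots> = fact k * (\<Sum>a<k. g a)" by (simp add: card_permutations)
  finally show ?thesis .
qed

lemma sum_permutes_two:
  fixes g :: "nat \<Rightarrow> nat \<Rightarrow> real"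
  assumes "k \<ge> 2"
  shows "real k * (real k - 1) * (\<Sum>\<pi> | \<pi> permutes {..<k}. g (\<pi> 0) (\<pi> 1))
    = fact k * (\<Sum>a<k. \<Sum>b\<in>{..<k} - {a}. g a b)"
proof -
  let ?P = "{\<pi>. \<pi> permutes {..<k}}"
  have *: "(\<Sum>\<pi>\<in>?P. g (\<pi> a) (\<pi> b)) = (\<Sum>\<pi>\<in>?P. g (\<pi> 0) (\<pi> 1))" if ab: "a < k" "b \<in> {..<k} - {a}" for a b
  proof -
    define c where "c = Transposition.transpose 0 a b"
    have c: "c \<noteq> 0" "c < k" using ab by (auto simp: c_def Transposition.transpose_def)
    have p: "(Transposition.transpose 0 a \<circ> Transposition.transpose 1 c) permutes {..<k}"
      using ab c assms by (intro permutes_compose permutes_swap_id) auto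
    have "(Transposition.transpose 0 a \<circ> Transposition.transpose 1 c) 0 = a" "(Transposition.transpose 0 a \<circ> Transposition.transpose 1 c) 1 = b"
      using c by (auto simp: Transposition.transpose_def c_def split: if_splits)
    with sum_permutations_compose_right[OF p, of "\<lambda>\<pi>. g (\<pi> 0) (\<pi> 1)"] show ?thesis by simp
  qed
  have "real k * (real k - 1) * (\<Sum>\<pi>\<in>?P. g (\<pi> 0) (\<pi> 1))
      = (\<Sum>a<k. \<Sum>b\<in>{..<k} - {a}. \<Sum>\<pi>\<in>?P. g (\<pi> 0) (\<pi> 1))"
    using assms by (simp add: of_nat_diff)
  also have "\<dots> = (\<Sum>a<k. \<Sum>b\<in>{..<k} - {a}. \<Sum>\<pi>\<in>?P. g (\<pi> a) (\<pi> b))"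
    by (intro sum.cong refl *[symmetric]) auto
  also have "\<dots> = (\<Sum>\<pi>\<in>?P. \<Sum>a<k. \<Sum>b\<in>{..<k} - {a}. g (\<pi> a) (\<pi> b))"
    by (subst sum.swap[of _ _ ?P], intro sum.cong refl sum.swap)
  also have "\<dots> = (\<Sum>\<pi>\<in>?P. \<Sum>a<k. \<Sum>b\<in>{..<k} - {a}. g a b)"
  proof (rule sum.cong[OF refl], clarify)
    fix \<pi> assume \<pi>: "\<pi> permutes {..<k}"
    have "(\<Sum>b\<in>{..<k} - {a}. g (\<pi> a) (\<pi> b)) = (\<Sum>b\<in>{..<k} - {\<pi> a}. g (\<pi> a) b)" if "a < k" for a
    proof (rule sum.reindex_bij_betw)
      show "bij_betw \<pi> ({..<k} - {a}) ({..<k} - {\<pi> a})"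
        using that permutes_in_image[OF \<pi>, of a]
        by (intro bij_betw_DiffI[OF permutes_imp_bij[OF \<pi>]]) auto
    qed
    then have "(\<Sum>a<k. \<Sum>b\<in>{..<k} - {a}. g (\<pi> a) (\<pi> b)) = (\<Sum>a<k. \<Sum>b\<in>{..<k} - {\<pi> a}. g (\<pi> a) b)"
      by simp
    also have "\<dots> = (\<Sum>a<k. \<Sum>b\<in>{..<k} - {a}. g a b)"
      using sum.permute[OF \<pi>, of "\<lambda>a. \<Sum>b\<in>{..<k} - {a}. g a b"] by (simp add: comp_def)
    finally show "(\<Sum>a<k. \<Sum>b\<in>{..<k} - {a}. g (\<pi> a) (\<pi> b)) = (\<Sum>a<k. \<Sum>b\<in>{..<k} - {a}. g a b)" .
  qed
  also have "\<dots> = fact k * (\<Sum>a<k. \<Sum>b\<in>{..<k} - {a}. g a b)" by (simp add: card_permutations)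
  finally show ?thesis .
qed

text \<open>
  The skew part of a function that is already alternating in all slots but the first: only the
  exchanges of the first slot with another one matter.
\<close>

lemma alt_tail_alternating:
  assumes T: "\<And>a. alternating m (\<lambda>K. T (a # K))" and K: "length K = m"
  shows "real (Suc m) * alt T (a # K) = T (a # K) - (\<Sum>j<m. T (K ! j # K[j := a]))"
proof -
  let ?k = "Suc m" and ?I = "a # K"
  define H where "H j = (case j of 0 \<Rightarrow> T ?I | Suc i \<Rightarrow> - T (K ! i # K[i := a]))" for j
  have fix0: "T (permute_list \<rho> L) = of_int (sign \<rho>) * T L" if "\<rho> permutes {1..<?k}" "length L = ?k" for \<rho> L
  proof (rule permute_sign[OF _ _ that])
    fix I :: "'a list" and i j assume *: "length I = ?k" "i \<in> {1..<?k}" "j \<in> {1..<?k}" "i \<noteq> j"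
    obtain b J where I: "I = b # J" using *(1) by (cases I) auto
    obtain i' j' where ij: "i = Suc i'" "j = Suc j'" using * by (cases i; cases j) auto
    show "T (I[i := I ! j, j := I ! i]) = - T I"
      using alternatingD[OF T, of J i' j' b] * by (simp add: I ij)
  qed auto
  have "of_int (sign \<pi>) * T (permute_list \<pi> ?I) = H (\<pi> 0)" if \<pi>: "\<pi> permutes {..<?k}" for \<pi>
  proof -
    define j where "j = \<pi> 0"
    have j: "j < ?k" using permutes_in_image[OF \<pi>, of 0] by (simp add: j_def)
    \<comment> \<open>\<open>\<rho>\<close> moves only slots behind the first one, where \<open>T\<close> is alternating.\<close>
    define \<tau> where "\<tau> = Transposition.transpose 0 j"
    define \<rho> where "\<rho> = \<tau> \<circ> \<pi>"
    have \<tau>: "\<tau> permutes {..<?k}" using j by (auto simp: \<tau>_def intro: permutes_swap_id)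
    have \<rho>: "\<rho> permutes {..<?k}" unfolding \<rho>_def by (rule permutes_compose[OF \<pi> \<tau>])
    have "\<rho> 0 = 0" by (simp add: \<rho>_def \<tau>_def j_def)
    have \<rho>1: "\<rho> permutes {1..<?k}"
      by (rule permutes_superset[OF \<rho>]) (use \<open>\<rho> 0 = 0\<close> in \<open>auto simp: not_le Suc_le_eq\<close>)
    have \<pi>_eq: "\<pi> = \<tau> \<circ> \<rho>" by (simp add: \<rho>_def \<tau>_def o_assoc)
    have "permutation \<tau>" "permutation \<rho>" using \<tau> \<rho> permutation_permutes finite_lessThan by blast+
    then have s: "sign \<pi> = sign \<tau> * sign \<rho>" unfolding \<pi>_eq by (rule sign_compose)
    have "permute_list \<pi> ?I = permute_list \<rho> (permute_list \<tau> ?I)"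
      unfolding \<pi>_eq using \<rho> K by (intro permute_list_compose) auto
    then have "T (permute_list \<pi> ?I) = of_int (sign \<rho>) * T (permute_list \<tau> ?I)"
      using fix0[OF \<rho>1, of "permute_list \<tau> ?I"] K by simp
    moreover have "real_of_int (sign \<rho>) * real_of_int (sign \<rho>) = 1"
      by (simp flip: of_int_mult add: sign_idempotent)
    ultimately have "of_int (sign \<pi>) * T (permute_list \<pi> ?I) = of_int (sign \<tau>) * T (permute_list \<tau> ?I)"
      by (simp add: s algebra_simps)
    also have "\<dots> = H j"
    proof (cases j)
      case 0
      then show ?thesis by (simp add: \<tau>_def H_def)
    next
      case (Suc i)
      have "permute_list \<tau> ?I = K ! i # K[i := a]"
        unfolding \<tau>_def using j K Suc by (subst permute_list_transpose) auto
      then show ?thesis using Suc by (simp add: \<tau>_def H_def sign_swap_id)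
    qed
    finally show ?thesis by (simp add: j_def)
  qed
  then have "(\<Sum>\<pi> | \<pi> permutes {..<?k}. of_int (sign \<pi>) * T (permute_list \<pi> ?I)) = (\<Sum>\<pi> | \<pi> permutes {..<?k}. H (\<pi> 0))"
    by simp
  then have "real ?k * alt T ?I = (real ?k * (\<Sum>\<pi> | \<pi> permutes {..<?k}. H (\<pi> 0))) / fact ?k"
    using K by (simp only: alt_def list.size add_Suc_right add_0_right times_divide_eq_right)
  also have "\<dots> = (\<Sum>j<?k. H j)"
    by (subst sum_permutes_one) (simp_all only: nonzero_mult_div_cancel_left fact_nonzero, simp)
  also have "\<dots> = T ?I - (\<Sum>j<m. T (K ! j # K[j := a]))"
    by (simp only: sum.lessThan_Suc_shift) (simp add: H_def sum_negf)
  finally show ?thesis .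
qed

section \<open>Endomorphisms acting as derivations on index lists\<close>

text \<open>
  The derivation extension of the matrix \<open>M\<close>: the algebraic part of a connection, and the action of
  its curvature, on tensors of any valence.
\<close>

definition act :: "('i \<Rightarrow> 'i \<Rightarrow> real) \<Rightarrow> ('i::finite list \<Rightarrow> real) \<Rightarrow> 'i list \<Rightarrow> real" where
  "act M F I = (\<Sum>j<length I. \<Oplus>B. M (I ! j) B * F (I[j := B]))"

lemma act_Nil [simp]: "act M F [] = 0"
  by (simp add: act_def)

lemma act_Cons: "act M F (a # I) = (\<Oplus>B. M a B * F (B # I)) + act M (\<lambda>J. F (a # J)) I"
  unfolding act_def list.size add_Suc_right add_0_right sum.lessThan_Suc_shift by simp

lemma act_cong: "(\<And>J. length J = length I \<Longrightarrow> F J = G J) \<Longrightarrow> act M F I = act M G I"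
  by (simp add: act_def)

lemma act_add: "act M (\<lambda>J. F J + G J) I = act M F I + act M G I"
  by (simp add: act_def algebra_simps sum.distrib)

lemma act_cmult: "act M (\<lambda>J. c * F J) I = c * act M F I"
  by (simp add: act_def sum_distrib_left mult.left_commute)

lemma act_sum: "act M (\<lambda>J. \<Sum>k\<in>K. F k J) I = (\<Sum>k\<in>K. act M (F k) I)"
proof -
  have "act M (\<lambda>J. \<Sum>k\<in>K. F k J) I = (\<Sum>j<length I. \<Oplus>B. \<Sum>k\<in>K. M (I ! j) B * F k (I[j := B]))"
    by (simp add: act_def sum_distrib_left)
  also have "\<dots> = (\<Sum>j<length I. \<Sum>k\<in>K. \<Oplus>B. M (I ! j) B * F k (I[j := B]))"
    by (intro sum.cong refl sum.swap)
  also have "\<dots> = (\<Sum>k\<in>K. act M (F k) I)" unfolding act_def by (rule sum.swap)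
  finally show ?thesis .
qed

lemma act_mat_add: "act (\<lambda>i c. M i c + N i c) F I = act M F I + act N F I"
  by (simp add: act_def algebra_simps sum.distrib)

lemma act_mat_minus: "act (\<lambda>i c. - M i c) F I = - act M F I"
  by (simp add: act_def sum_negf)

lemma act_mat_diff: "act (\<lambda>i c. M i c - N i c) F I = act M F I - act N F I"
  by (simp add: act_def algebra_simps sum_subtractf)

lemma act_mat_cmult: "act (\<lambda>i c. r * M i c) F I = r * act M F I"
  by (simp add: act_def sum_distrib_left mult.assoc)

lemma act_mat_sum: "act (\<lambda>i c. \<Sum>k\<in>K. M k i c) F I = (\<Sum>k\<in>K. act (M k) F I)"
proof -
  have "act (\<lambda>i c. \<Sum>k\<in>K. M k i c) F I = (\<Sum>j<length I. \<Oplus>B. \<Sum>k\<in>K. M k (I ! j) B * F (I[j := B]))"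
    by (simp add: act_def sum_distrib_right)
  also have "\<dots> = (\<Sum>j<length I. \<Sum>k\<in>K. \<Oplus>B. M k (I ! j) B * F (I[j := B]))"
    by (intro sum.cong refl sum.swap)
  also have "\<dots> = (\<Sum>k\<in>K. act (M k) F I)" unfolding act_def by (rule sum.swap)
  finally show ?thesis .
qed

text \<open>
  The two derivations hit the same slot, where the matrices multiply, or two different slots.
\<close>

lemma act_act:
  "act M (act N F) I = act (\<lambda>i c. \<Oplus>e. M i e * N e c) F I
    + (\<Sum>j<length I. \<Sum>l\<in>{..<length I} - {j}. \<Oplus>B C. M (I ! j) B * N (I ! l) C * F (I[j := B, l := C]))"
proof -
  have *: "(\<Oplus>B. M (I ! j) B * act N F (I[j := B]))
      = (\<Oplus>c. (\<Oplus>e. M (I ! j) e * N e c) * F (I[j := c]))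
        + (\<Sum>l\<in>{..<length I} - {j}. \<Oplus>B C. M (I ! j) B * N (I ! l) C * F (I[j := B, l := C]))"
    if j: "j < length I" for j
  proof -
    have "act N F (I[j := B]) = (\<Oplus>C. N B C * F (I[j := C]))
        + (\<Sum>l\<in>{..<length I} - {j}. \<Oplus>C. N (I ! l) C * F (I[j := B, l := C]))" for B
      unfolding act_def using j by (subst sum.remove[of _ j]) auto
    then have "(\<Oplus>B. M (I ! j) B * act N F (I[j := B]))
        = (\<Oplus>B C. M (I ! j) B * N B C * F (I[j := C]))
        + (\<Oplus>B. \<Sum>l\<in>{..<length I} - {j}. \<Oplus>C. M (I ! j) B * N (I ! l) C * F (I[j := B, l := C]))"
      by (simp add: distrib_left sum.distrib sum_distrib_left mult.assoc)
    also have "(\<Oplus>B C. M (I ! j) B * N B C * F (I[j := C]))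
        = (\<Oplus>c. (\<Oplus>e. M (I ! j) e * N e c) * F (I[j := c]))"
      by (subst sum.swap) (simp add: sum_distrib_right)
    also have "(\<Oplus>B. \<Sum>l\<in>{..<length I} - {j}. \<Oplus>C. M (I ! j) B * N (I ! l) C * F (I[j := B, l := C]))
        = (\<Sum>l\<in>{..<length I} - {j}. \<Oplus>B C. M (I ! j) B * N (I ! l) C * F (I[j := B, l := C]))"
      by (rule sum.swap)
    finally show ?thesis .
  qed
  show ?thesis
    unfolding act_def[of M "act N F"] act_def[of "\<lambda>i c. \<Oplus>e. M i e * N e c"]
    by (simp add: * sum.distrib)
qed

lemma sum_off_diagonal_swap:
  "(\<Sum>j<m. \<Sum>l\<in>{..<m::nat} - {j}. g j l) = (\<Sum>j<m. \<Sum>l\<in>{..<m} - {j}. g l j)"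
proof -
  have "(\<Sum>j<m. \<Sum>l\<in>{..<m} - {j}. g j l) = (\<Sum>(j,l)\<in>Sigma {..<m} (\<lambda>j. {..<m} - {j}). g j l)"
    by (simp add: sum.Sigma)
  also have "\<dots> = (\<Sum>(j,l)\<in>Sigma {..<m} (\<lambda>j. {..<m} - {j}). g l j)"
    by (rule sum.reindex_bij_witness[of _ prod.swap prod.swap]) auto
  also have "\<dots> = (\<Sum>j<m. \<Sum>l\<in>{..<m} - {j}. g l j)"
    by (simp add: sum.Sigma)
  finally show ?thesis .
qed

lemma sum_off_diagonal_skew:
  fixes g :: "nat \<Rightarrow> nat \<Rightarrow> real"
  assumes "\<And>j l. j < m \<Longrightarrow> l < m \<Longrightarrow> j \<noteq> l \<Longrightarrow> g j l = - g l j"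
  shows "(\<Sum>j<m. \<Sum>l\<in>{..<m} - {j}. g j l) = 0"
proof -
  have "(\<Sum>j<m. \<Sum>l\<in>{..<m} - {j}. g j l) = (\<Sum>j<m. \<Sum>l\<in>{..<m} - {j}. - g l j)"
    by (intro sum.cong refl assms) auto
  also have "\<dots> = - (\<Sum>j<m. \<Sum>l\<in>{..<m} - {j}. g l j)" by (simp add: sum_negf)
  also have "\<dots> = - (\<Sum>j<m. \<Sum>l\<in>{..<m} - {j}. g j l)" by (simp only: sum_off_diagonal_swap[of g])
  finally show ?thesis by simp
qed

text \<open>Actions on different slots commute, so that only the matrix commutator survives.\<close>

lemma act_commutator:
  "act M (act N F) I - act N (act M F) I
    = act (\<lambda>i c. (\<Oplus>e. M i e * N e c) - (\<Oplus>e. N i e * M e c)) F I"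
proof -
  have *: "(\<Oplus>B C. M (I ! l) B * N (I ! j) C * F (I[l := B, j := C]))
      = (\<Oplus>B C. N (I ! j) B * M (I ! l) C * F (I[j := B, l := C]))" if "j \<noteq> l" for j l
    by (subst sum.swap) (simp add: list_update_swap[OF that] mult.commute mult.left_commute)
  have "(\<Sum>j<length I. \<Sum>l\<in>{..<length I} - {j}. \<Oplus>B C. M (I ! l) B * N (I ! j) C * F (I[l := B, j := C]))
      = (\<Sum>j<length I. \<Sum>l\<in>{..<length I} - {j}. \<Oplus>B C. N (I ! j) B * M (I ! l) C * F (I[j := B, l := C]))"
    by (intro sum.cong refl *) auto
  then show ?thesis
    unfolding act_act act_mat_diff
    by (subst (1) sum_off_diagonal_swap) simp
qed

lemma act_alternating:
  assumes F: "alternating k F"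
  shows "alternating k (act M F)"
  unfolding alternating_def
proof (intro allI impI)
  fix I :: "'a list" and i j assume *: "length I = k" "i < k" "j < k" "i \<noteq> j"
  let ?I = "I[i := I ! j, j := I ! i]" and ?\<tau> = "Transposition.transpose i j"
  have "F (?I[l := B]) = - F (I[?\<tau> l := B])" if "l < k" for l B
  proof -
    have "?\<tau> l < k" using * that by (simp add: Transposition.transpose_def)
    moreover have "?I[l := B] = (I[?\<tau> l := B])[i := I[?\<tau> l := B] ! j, j := I[?\<tau> l := B] ! i]"
      using * that by (intro nth_equalityI) (auto simp: nth_list_update Transposition.transpose_def)
    ultimately show ?thesis using alternatingD[OF F, of "I[?\<tau> l := B]" i j] * by simp
  qed
  moreover have "?I ! l = I ! ?\<tau> l" if "l < k" for l
    using * that by (auto simp: nth_list_update Transposition.transpose_def)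
  ultimately have "act M F ?I = (\<Sum>l<k. - (\<Oplus>B. M (I ! ?\<tau> l) B * F (I[?\<tau> l := B])))"
    using * by (simp add: act_def sum_negf)
  also have "\<dots> = - (\<Sum>l<k. ((\<lambda>l. \<Oplus>B. M (I ! l) B * F (I[l := B])) \<circ> ?\<tau>) l)"
    by (simp add: sum_negf)
  also have "\<dots> = - act M F I"
    unfolding act_def using * by (subst sum.permute[symmetric, of ?\<tau>]) (auto intro: permutes_swap_id)
  finally show "act M F ?I = - act M F I" .
qed

lemma alternating_add: "alternating k F \<Longrightarrow> alternating k G \<Longrightarrow> alternating k (\<lambda>I. F I + G I)"
  by (simp add: alternating_def)

lemma alternating_cmult: "alternating k F \<Longrightarrow> alternating k (\<lambda>I. c * F I)"
  by (simp add: alternating_def)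

lemma alternating_sum: "(\<And>a. a \<in> K \<Longrightarrow> alternating k (F a)) \<Longrightarrow> alternating k (\<lambda>I. \<Sum>a\<in>K. F a I)"
  by (simp add: alternating_def sum_negf)

lemma alternating_tail: "alternating (Suc k) F \<Longrightarrow> alternating k (\<lambda>I. F (a # I))"
  unfolding alternating_def
proof (intro allI impI)
  fix I :: "'a list" and i j
  assume "\<forall>I i j. length I = Suc k \<longrightarrow> i < Suc k \<longrightarrow> j < Suc k \<longrightarrow> i \<noteq> j \<longrightarrow> F (I[i := I ! j, j := I ! i]) = - F I"
    and *: "length I = k" "i < k" "j < k" "i \<noteq> j"
  from this(1)[rule_format, of "a # I" "Suc i" "Suc j"] * show "F (a # I[i := I ! j, j := I ! i]) = - F (a # I)"
    by simp
qed

lemma alternating_map: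
  "alternating k F \<Longrightarrow> alternating k (\<lambda>I. F (map h I))"
  using alternatingD[of k F "map h _"] by (auto simp: alternating_def map_update)

section \<open>Levi-Civita calculus on covariant tensor fields\<close>

text \<open>
  A coordinate patch with a metric \<open>h\<close>, its inverse \<open>hi\<close>, and the coefficients \<open>\<Gamma> x c a b\<close> of its
  Levi-Civita connection. A covariant tensor field is a function of a point and of a list of indices.
\<close>

lemma sum_delta_mult [simp]:
  "(\<Oplus>e. (if (a::'a::finite) = e then 1 else 0) * v e) = (v a :: real)"
  "(\<Oplus>e. (if e = (a::'a::finite) then 1 else 0) * v e) = (v a :: real)"
  "(\<Oplus>e. v e * (if (a::'a::finite) = e then 1 else 0)) = (v a :: real)"
  "(\<Oplus>e. v e * (if e = (a::'a::finite) then 1 else 0)) = (v a :: real)"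
proof -
  have "(\<Oplus>e. (if a = e then 1 else 0) * v e) = (\<Oplus>e. if a = e then v e else 0)"
    by (intro sum.cong) auto
  then show 1: "(\<Oplus>e. (if a = e then 1 else 0) * v e) = v a" by simp
  then show "(\<Oplus>e. (if e = a then 1 else 0) * v e) = v a" by (simp only: eq_commute[of _ a])
  then show "(\<Oplus>e. v e * (if e = a then 1 else 0)) = v a" by (simp only: mult.commute)
  from 1 show "(\<Oplus>e. v e * (if a = e then 1 else 0)) = v a" by (simp only: mult.commute)
qed

locale levi_civita =
  fixes U :: "(real ^ 'n::finite) set"
    and h hi :: "real ^ 'n \<Rightarrow> 'n \<Rightarrow> 'n \<Rightarrow> real"
    and \<Gamma> :: "real ^ 'n \<Rightarrow> 'n \<Rightarrow> 'n \<Rightarrow> 'n \<Rightarrow> real"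
  assumes open_U: "open U"
    and smooth_h: "smooth_on U (\<lambda>x. h x a b)"
    and smooth_hi: "smooth_on U (\<lambda>x. hi x a b)"
    and smooth_\<Gamma>: "smooth_on U (\<lambda>x. \<Gamma> x c a b)"
    and h_sym: "x \<in> U \<Longrightarrow> h x a b = h x b a"
    and hi_sym: "x \<in> U \<Longrightarrow> hi x a b = hi x b a"
    and h_hi: "x \<in> U \<Longrightarrow> (\<Oplus>b. h x a b * hi x b c) = (if a = c then 1 else 0)"
    and \<Gamma>_sym: "x \<in> U \<Longrightarrow> \<Gamma> x c a b = \<Gamma> x c b a"
    and pd_h: "x \<in> U \<Longrightarrow> pd e (\<lambda>y. h y a b) x = (\<Oplus>d. \<Gamma> x d e a * h x d b) + (\<Oplus>d. \<Gamma> x d e b * h x a d)"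
begin

lemmas smooth_diff = smooth_on_differentiable

lemma hi_h: "x \<in> U \<Longrightarrow> (\<Oplus>b. hi x a b * h x b c) = (if a = c then 1 else 0)"
  using h_hi[of x c a] by (simp add: h_sym[of x c] hi_sym[of x _ a] mult.commute eq_commute)

lemma raise_lower:
  assumes "x \<in> U"
  shows "(\<Oplus>c. hi x a c * (\<Oplus>e. h x c e * v e)) = v a"
proof -
  have "(\<Oplus>c. hi x a c * (\<Oplus>e. h x c e * v e)) = (\<Oplus>e. (\<Oplus>c. hi x a c * h x c e) * v e)"
    unfolding sum_distrib_left sum_distrib_right mult.assoc by (rule sum.swap)
  then show ?thesis using assms by (simp only: hi_h sum_delta_mult)
qed

lemma lower_raise:
  assumes "x \<in> U"
  shows "(\<Oplus>c. h x a c * (\<Oplus>e. hi x c e * v e)) = v a"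
proof -
  have "(\<Oplus>c. h x a c * (\<Oplus>e. hi x c e * v e)) = (\<Oplus>e. (\<Oplus>c. h x a c * hi x c e) * v e)"
    unfolding sum_distrib_left sum_distrib_right mult.assoc by (rule sum.swap)
  then show ?thesis using assms by (simp only: h_hi sum_delta_mult)
qed

lemma pd_hi:
  assumes x: "x \<in> U"
  shows "pd e (\<lambda>y. hi y a b) x = - (\<Oplus>d. \<Gamma> x a e d * hi x d b) - (\<Oplus>d. \<Gamma> x b e d * hi x a d)"
proof -
  have "(\<Oplus>d. pd e (\<lambda>y. h y c d) x * hi x d b + h x c d * pd e (\<lambda>y. hi y d b) x) = 0" for c
  proof -
    have "(\<Oplus>d. pd e (\<lambda>y. h y c d) x * hi x d b + h x c d * pd e (\<lambda>y. hi y d b) x)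
      = pd e (\<lambda>y. \<Oplus>d. h y c d * hi y d b) x"
      using x by (simp add: pd_sum pd_mult smooth_diff[OF smooth_h] smooth_diff[OF smooth_hi])
    also have "\<dots> = pd e (\<lambda>y. if c = b then 1 else 0) x"
      by (rule pd_cong[OF open_U x]) (rule h_hi)
    finally show ?thesis by simp
  qed
  then have *: "(\<Oplus>d. h x c d * pd e (\<lambda>y. hi y d b) x) = - (\<Oplus>d. pd e (\<lambda>y. h y c d) x * hi x d b)" for c
    by (simp add: sum.distrib add_eq_0_iff)
  have "pd e (\<lambda>y. hi y a b) x = (\<Oplus>c. hi x a c * (\<Oplus>d. h x c d * pd e (\<lambda>y. hi y d b) x))"
    by (simp add: raise_lower[OF x])
  also have "\<dots> = - (\<Oplus>c. hi x a c * (\<Oplus>d. pd e (\<lambda>y. h y c d) x * hi x d b))"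
    by (simp add: * sum_negf)
  also have "(\<Oplus>c. hi x a c * (\<Oplus>d. pd e (\<lambda>y. h y c d) x * hi x d b))
      = (\<Oplus>d. \<Gamma> x a e d * hi x d b) + (\<Oplus>d. \<Gamma> x b e d * hi x a d)"
  proof -
    have "(\<Oplus>d. pd e (\<lambda>y. h y c d) x * hi x d b) = \<Gamma> x b e c
        + (\<Oplus>f. h x c f * (\<Oplus>d. \<Gamma> x f e d * hi x d b))" for c
    proof -
      have "(\<Oplus>d. pd e (\<lambda>y. h y c d) x * hi x d b)
          = (\<Oplus>d f. \<Gamma> x f e c * (h x f d * hi x d b)) + (\<Oplus>d f. h x c f * (\<Gamma> x f e d * hi x d b))"
        unfolding pd_h[OF x] distrib_right sum.distrib sum_distrib_right by (simp add: mult.assoc mult.left_commute)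
      also have "(\<Oplus>d f. \<Gamma> x f e c * (h x f d * hi x d b)) = (\<Oplus>f. \<Gamma> x f e c * (\<Oplus>d. h x f d * hi x d b))"
        by (subst sum.swap) (simp add: sum_distrib_left)
      also have "\<dots> = \<Gamma> x b e c" by (simp only: h_hi[OF x] sum_delta_mult)
      also have "(\<Oplus>d f. h x c f * (\<Gamma> x f e d * hi x d b)) = (\<Oplus>f. h x c f * (\<Oplus>d. \<Gamma> x f e d * hi x d b))"
        by (subst sum.swap) (simp add: sum_distrib_left)
      finally show ?thesis .
    qed
    then show ?thesis
      by (simp add: distrib_left sum.distrib raise_lower[OF x] mult.commute)
  qed
  finally show ?thesis by simp
qed

definition smooth_field :: "nat \<Rightarrow> (real ^ 'n \<Rightarrow> 'i list \<Rightarrow> real) \<Rightarrow> bool" where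
  "smooth_field k f \<longleftrightarrow> (\<forall>I. length I = k \<longrightarrow> smooth_on U (\<lambda>x. f x I))"

lemma smooth_fieldD: "smooth_field k f \<Longrightarrow> length I = k \<Longrightarrow> smooth_on U (\<lambda>x. f x I)"
  by (simp add: smooth_field_def)

lemma smooth_field_differentiable:
  "smooth_field k f \<Longrightarrow> length I = k \<Longrightarrow> x \<in> U \<Longrightarrow> (\<lambda>x. f x I) differentiable (at x)"
  by (rule smooth_diff[OF smooth_fieldD])

lemma smooth_act:
  assumes "\<And>i c. smooth_on U (\<lambda>x. M x i c)" "smooth_field (length I) f"
  shows "smooth_on U (\<lambda>x. act (M x) (f x) I)"
  unfolding act_def using assms
  by (intro smooth_on_sum smooth_on_mult open_U) (auto simp: smooth_field_def)

lemma pd_act: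
  assumes "\<And>i c. smooth_on U (\<lambda>x. M x i c)" "smooth_field (length I) f" "x \<in> U"
  shows "pd a (\<lambda>y. act (M y) (f y) I) x
    = act (\<lambda>i c. pd a (\<lambda>y. M y i c) x) (f x) I + act (M x) (\<lambda>J. pd a (\<lambda>y. f y J) x) I"
proof -
  have "(\<lambda>y. M y i c) differentiable (at x)" for i c using assms by (auto intro: smooth_diff)
  moreover have "(\<lambda>y. f y (I[j := B])) differentiable (at x)" for j B
    using assms by (intro smooth_field_differentiable) auto
  ultimately show ?thesis
    unfolding act_def by (simp add: pd_sum pd_mult differentiable_sum sum.distrib)
qed

text \<open>
  The covariant derivative, with the new index as first entry; the empty list is no index list of a
  derivative, and the value there is arbitrary.
\<close>

definition D :: "(real ^ 'n \<Rightarrow> 'n list \<Rightarrow> real) \<Rightarrow> real ^ 'n \<Rightarrow> 'n list \<Rightarrow> real" where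
  "D f x J = (case J of [] \<Rightarrow> 0 | a # I \<Rightarrow> pd a (\<lambda>y. f y I) x + act (\<lambda>i c. - \<Gamma> x c a i) (f x) I)"

lemma D_Nil [simp]: "D f x [] = 0"
  by (simp add: D_def)

lemma D_Cons: "D f x (a # I) = pd a (\<lambda>y. f y I) x + act (\<lambda>i c. - \<Gamma> x c a i) (f x) I"
  by (simp add: D_def)

lemma smooth_minus_\<Gamma>: "smooth_on U (\<lambda>x. - \<Gamma> x c a i)"
  by (intro smooth_on_minus open_U smooth_\<Gamma>)

lemma smooth_field_D: "smooth_field k f \<Longrightarrow> smooth_field (Suc k) (D f)"
  unfolding smooth_field_def[of "Suc k"]
proof (intro allI impI)
  fix J :: "'n list" assume f: "smooth_field k f" and "length J = Suc k"
  then obtain a I where J: "J = a # I" "length I = k" by (cases J) auto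
  show "smooth_on U (\<lambda>x. D f x J)"
    unfolding J D_Cons using f J
    by (intro smooth_on_add open_U smooth_on_pd smooth_fieldD[OF f] smooth_act smooth_minus_\<Gamma>) auto
qed

lemma D_cong:
  assumes "\<And>y J. y \<in> U \<Longrightarrow> length J = length I \<Longrightarrow> f y J = g y J" "x \<in> U"
  shows "D f x (a # I) = D g x (a # I)"
  unfolding D_Cons using assms by (intro arg_cong2[of _ _ _ _ "(+)"] pd_cong[OF open_U] act_cong) auto

lemma D_add:
  assumes "smooth_field k f" "smooth_field k g" "x \<in> U" "length I = k"
  shows "D (\<lambda>y J. f y J + g y J) x (a # I) = D f x (a # I) + D g x (a # I)"
  using assms by (simp add: D_Cons pd_add smooth_field_differentiable act_add)

lemma D_cmult:
  assumes "smooth_field k f" "x \<in> U" "length I = k"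
  shows "D (\<lambda>y J. c * f y J) x (a # I) = c * D f x (a # I)"
  using assms by (simp add: D_Cons pd_cmult smooth_field_differentiable act_cmult algebra_simps)

lemma D_sum:
  assumes "\<And>j. j \<in> K \<Longrightarrow> smooth_field k (f j)" "x \<in> U" "length I = k"
  shows "D (\<lambda>y J. \<Sum>j\<in>K. f j y J) x (a # I) = (\<Sum>j\<in>K. D (f j) x (a # I))"
  using assms(2,3)
  by (simp add: D_Cons pd_sum smooth_field_differentiable[OF assms(1)] act_sum sum.distrib)

lemma smooth_field_add: "smooth_field k f \<Longrightarrow> smooth_field k g \<Longrightarrow> smooth_field k (\<lambda>y J. f y J + g y J)"
  by (simp add: smooth_field_def smooth_on_add open_U)

lemma smooth_field_cmult: "smooth_field k f \<Longrightarrow> smooth_field k (\<lambda>y J. c * f y J)"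
  by (simp add: smooth_field_def smooth_on_mult smooth_on_const open_U)

lemma smooth_field_sum: "(\<And>j. j \<in> K \<Longrightarrow> smooth_field k (f j)) \<Longrightarrow> smooth_field k (\<lambda>y J. \<Sum>j\<in>K. f j y J)"
  by (simp add: smooth_field_def smooth_on_sum open_U)

subsection \<open>Curvature\<close>

definition Riem :: "real ^ 'n \<Rightarrow> 'n \<Rightarrow> 'n \<Rightarrow> 'n \<Rightarrow> 'n \<Rightarrow> real" where
  "Riem x a b c d = pd a (\<lambda>y. \<Gamma> y c b d) x - pd b (\<lambda>y. \<Gamma> y c a d) x
     + (\<Oplus>e. \<Gamma> x c a e * \<Gamma> x e b d - \<Gamma> x c b e * \<Gamma> x e a d)"

lemma Riem_skew: "Riem x b a c d = - Riem x a b c d"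
  by (simp add: Riem_def sum_subtractf)

text \<open>
  Second partial derivatives commute, the Christoffel symbols in the two derivative slots are symmetric,
  and the connection matrices leave their commutator.
\<close>

lemma ricci_identity:
  assumes f: "smooth_field k f" and x: "x \<in> U" and I: "length I = k"
  shows "D (D f) x (a # b # I) - D (D f) x (b # a # I) = - act (\<lambda>i c. Riem x a b c i) (f x) I"
proof -
  let ?N = "\<lambda>a y i c. - \<Gamma> y c a i"
  let ?S = "\<lambda>a b. (\<Oplus>c. - \<Gamma> x c a b * D f x (c # I))"
  have *: "D (D f) x (a # b # I) = pd a (pd b (\<lambda>y. f y I)) x + act (\<lambda>i c. pd a (\<lambda>y. ?N b y i c) x) (f x) I
      + act (?N b x) (\<lambda>J. pd a (\<lambda>y. f y J) x) I + ?S a b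
      + act (?N a x) (\<lambda>J. pd b (\<lambda>y. f y J) x) I + act (?N a x) (act (?N b x) (f x)) I" for a b
  proof -
    have "pd a (\<lambda>y. D f y (b # I)) x = pd a (\<lambda>y. pd b (\<lambda>y. f y I) y) x + pd a (\<lambda>y. act (?N b y) (f y) I) x"
      unfolding D_Cons using f x I smooth_fieldD[OF f I]
      by (intro pd_add smooth_diff[OF smooth_on_pd] smooth_diff[OF smooth_act] smooth_minus_\<Gamma> smooth_fieldD[OF f I]) auto
    also have "pd a (\<lambda>y. act (?N b y) (f y) I) x = act (\<lambda>i c. pd a (\<lambda>y. ?N b y i c) x) (f x) I
        + act (?N b x) (\<lambda>J. pd a (\<lambda>y. f y J) x) I"
      by (rule pd_act) (use f x I smooth_minus_\<Gamma> in auto)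
    finally show ?thesis
      by (simp add: D_Cons[of "D f"] act_Cons) (simp add: D_Cons act_add)
  qed
  have S: "?S a b = ?S b a" by (simp add: \<Gamma>_sym[OF x, of _ a b])
  have P: "pd a (pd b (\<lambda>y. f y I)) x = pd b (pd a (\<lambda>y. f y I)) x"
    by (rule pd_commute[OF open_U x smooth_fieldD[OF f I]])
  have mat: "(\<lambda>i c. pd a (\<lambda>y. ?N b y i c) x - pd b (\<lambda>y. ?N a y i c) x
      + ((\<Oplus>e. ?N a x i e * ?N b x e c) - (\<Oplus>e. ?N b x i e * ?N a x e c))) = (\<lambda>i c. - Riem x a b c i)"
    using x by (simp add: Riem_def pd_minus smooth_diff[OF smooth_\<Gamma>] sum_subtractf mult.commute)
  have "D (D f) x (a # b # I) - D (D f) x (b # a # I)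
      = act (\<lambda>i c. pd a (\<lambda>y. ?N b y i c) x - pd b (\<lambda>y. ?N a y i c) x
      + ((\<Oplus>e. ?N a x i e * ?N b x e c) - (\<Oplus>e. ?N b x i e * ?N a x e c))) (f x) I"
    unfolding *[of a b] *[of b a] act_mat_add act_mat_diff[of "\<lambda>i c. pd a (\<lambda>y. ?N b y i c) x"] 
    using act_commutator[of "?N a x" "?N b x" "f x" I] S P by simp
  then show ?thesis unfolding mat by (simp add: act_mat_minus)
qed

definition Rl :: "real ^ 'n \<Rightarrow> 'n \<Rightarrow> 'n \<Rightarrow> 'n \<Rightarrow> 'n \<Rightarrow> real" where
  "Rl x a b c d = (\<Oplus>e. h x c e * Riem x a b e d)"

lemma Riem_Rl: "x \<in> U \<Longrightarrow> Riem x a b c d = (\<Oplus>e. hi x c e * Rl x a b e d)"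
  unfolding Rl_def by (simp add: raise_lower)

lemma Rl_skew12: "Rl x b a c d = - Rl x a b c d"
  by (simp add: Rl_def Riem_skew[of x b a] sum_negf)

lemma D_metric:
  assumes x: "x \<in> U"
  shows "D (\<lambda>y J. h y (J ! 0) (J ! 1)) x [a, b, c] = 0"
  by (simp add: D_Cons act_Cons pd_h[OF x] sum_negf)

lemma smooth_field_metric: "smooth_field 2 (\<lambda>y J. h y (J ! 0) (J ! 1))"
  by (simp add: smooth_field_def smooth_h)

text \<open>
  The commutator of covariant derivatives annihilates the parallel metric.
\<close>

lemma Rl_skew34:
  assumes x: "x \<in> U"
  shows "Rl x a b d c = - Rl x a b c d"
proof -
  have "D (D (\<lambda>y J. h y (J ! 0) (J ! 1))) x (a # [b, c, d]) = 0" for a b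
  proof -
    have "D (D (\<lambda>y J. h y (J ! 0) (J ! 1))) x (a # [b, c, d]) = D (\<lambda>y J. 0) x (a # [b, c, d])"
    proof (rule D_cong[OF _ x])
      fix y and J :: "'n list" assume "y \<in> U" "length J = length [b, c, d]"
      then show "D (\<lambda>y J. h y (J ! 0) (J ! 1)) y J = 0"
        using D_metric by (auto simp: length_Suc_conv)
    qed
    then show ?thesis by (simp add: D_Cons act_def)
  qed
  then have "act (\<lambda>i c. Riem x a b c i) (\<lambda>J. h x (J ! 0) (J ! 1)) [c, d] = 0"
    using ricci_identity[OF smooth_field_metric x, of "[c, d]" a b] by simp
  then show ?thesis by (simp add: act_Cons Rl_def h_sym[OF x, of _ d] mult.commute)
qed

lemma bianchi1_Riem:
  assumes x: "x \<in> U"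
  shows "Riem x a b c d + Riem x b d c a + Riem x d a c b = 0"
proof -
  have "pd e (\<lambda>y. \<Gamma> y c p q) x = pd e (\<lambda>y. \<Gamma> y c q p) x" for e p q
    by (rule pd_cong[OF open_U x]) (rule \<Gamma>_sym)
  then show ?thesis
    using \<Gamma>_sym[OF x, of _ a b] \<Gamma>_sym[OF x, of _ b d] \<Gamma>_sym[OF x, of _ a d]
    by (simp add: Riem_def sum_subtractf)
qed

lemma bianchi1:
  assumes x: "x \<in> U"
  shows "Rl x a b c d + Rl x b c a d + Rl x c a b d = 0"
proof -
  have *: "Rl x a b c d + Rl x b d c a + Rl x d a c b = 0" for a b c d
    using bianchi1_Riem[OF x, of a b _ d]
    by (simp add: Rl_def flip: sum.distrib distrib_left)
  have s: "Rl x p q r s = - Rl x q p r s" "Rl x p q r s = - Rl x p q s r" for p q r s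
    using Rl_skew12[of x p q r s] Rl_skew34[OF x, of p q s r] by simp_all
  show ?thesis
    using *[of a b d c] *[of b c a d] s by (smt (verit, ccfv_threshold))
qed

lemma Rl_pair:
  assumes x: "x \<in> U"
  shows "Rl x a b c d = Rl x c d a b"
  using bianchi1[OF x, of a b c d] bianchi1[OF x, of b c d a] bianchi1[OF x, of c d a b] bianchi1[OF x, of d a b c]
    Rl_skew12[of x] Rl_skew34[OF x]
  by (smt (verit))

end

lemma sum4_swap:
  "(\<Sum>b\<in>B. \<Sum>d\<in>D. \<Sum>a\<in>A. \<Sum>c\<in>C. T a b c d) = (\<Sum>a\<in>A. \<Sum>c\<in>C. \<Sum>b\<in>B. \<Sum>d\<in>D. T a b c d)"
proof -
  have "(\<Sum>b\<in>B. \<Sum>d\<in>D. \<Sum>a\<in>A. \<Sum>c\<in>C. T a b c d) = (\<Sum>b\<in>B. \<Sum>a\<in>A. \<Sum>d\<in>D. \<Sum>c\<in>C. T a b c d)"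
    by (intro sum.cong refl sum.swap)
  also have "\<dots> = (\<Sum>a\<in>A. \<Sum>b\<in>B. \<Sum>d\<in>D. \<Sum>c\<in>C. T a b c d)" by (rule sum.swap)
  also have "\<dots> = (\<Sum>a\<in>A. \<Sum>b\<in>B. \<Sum>c\<in>C. \<Sum>d\<in>D. T a b c d)" by (intro sum.cong refl sum.swap)
  also have "\<dots> = (\<Sum>a\<in>A. \<Sum>c\<in>C. \<Sum>b\<in>B. \<Sum>d\<in>D. T a b c d)" by (intro sum.cong refl sum.swap)
  finally show ?thesis .
qed

lemma contract_swap:
  fixes u v :: "'a \<Rightarrow> 'a \<Rightarrow> real"
  shows "(\<Sum>b\<in>B. \<Sum>d\<in>D. u b d * (\<Sum>a\<in>A. \<Sum>c\<in>C. v a c * T a b c d))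
    = (\<Sum>a\<in>A. \<Sum>c\<in>C. v a c * (\<Sum>b\<in>B. \<Sum>d\<in>D. u b d * T a b c d))"
  unfolding sum_distrib_left by (subst sum4_swap) (simp add: mult.left_commute)

lemma contract_sum:
  fixes u :: "'a \<Rightarrow> 'b \<Rightarrow> real"
  shows "(\<Sum>a\<in>A. \<Sum>b\<in>B. u a b * (\<Sum>j\<in>J. T j a b)) = (\<Sum>j\<in>J. \<Sum>a\<in>A. \<Sum>b\<in>B. u a b * T j a b)"
proof -
  have "(\<Sum>a\<in>A. \<Sum>b\<in>B. u a b * (\<Sum>j\<in>J. T j a b)) = (\<Sum>a\<in>A. \<Sum>j\<in>J. \<Sum>b\<in>B. u a b * T j a b)"
    unfolding sum_distrib_left by (intro sum.cong refl sum.swap)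
  also have "\<dots> = (\<Sum>j\<in>J. \<Sum>a\<in>A. \<Sum>b\<in>B. u a b * T j a b)" by (rule sum.swap)
  finally show ?thesis .
qed

definition swp :: "nat \<Rightarrow> nat \<Rightarrow> 'i list \<Rightarrow> 'i list" where
  "swp i j J = J[i := J ! j, j := J ! i]"

lemma length_swp [simp]: "length (swp i j J) = length J"
  by (simp add: swp_def)

lemma act_swp:
  assumes "i < length I" "j < length I"
  shows "act M (\<lambda>J. F (swp i j J)) I = act M F (swp i j I)"
proof -
  let ?\<tau> = "Transposition.transpose i j" and ?k = "length I"
  have "swp i j (I[?\<tau> l := B]) = (swp i j I)[l := B]" if "l < ?k" for l B
    unfolding swp_def using assms that by (intro nth_equalityI) (auto simp: nth_list_update Transposition.transpose_def)
  moreover have "I ! ?\<tau> l = swp i j I ! l" if "l < ?k" for l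
    unfolding swp_def using assms that by (auto simp: nth_list_update Transposition.transpose_def)
  moreover have "(\<Sum>l<?k. \<Oplus>B. M (I ! l) B * F (swp i j (I[l := B])))
      = (\<Sum>l<?k. ((\<lambda>l. \<Oplus>B. M (I ! l) B * F (swp i j (I[l := B]))) \<circ> ?\<tau>) l)"
    using assms by (intro sum.permute permutes_swap_id) auto
  ultimately show ?thesis by (simp add: act_def)
qed

context levi_civita
begin

lemma D_swp:
  assumes "i < length I" "j < length I"
  shows "D (\<lambda>y J. T y (swp i j J)) x (a # I) = D T x (a # swp i j I)"
  using assms by (simp add: D_Cons act_swp)

text \<open>The metric is parallel, so contraction with it commutes with the covariant derivative.\<close>

lemma D_contract:
  assumes T: "smooth_field (Suc (Suc k)) T" and x: "x \<in> U" and K: "length K = k"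
  shows "D (\<lambda>y K. \<Oplus>a b. hi y a b * T y (a # b # K)) x (c # K)
    = (\<Oplus>a b. hi x a b * D T x (c # a # b # K))"
proof -
  let ?N = "\<lambda>i e. - \<Gamma> x e c i"
  have dT: "(\<lambda>y. T y (a # b # K)) differentiable (at x)" for a b
    using smooth_field_differentiable[OF T _ x] K by simp
  have dh: "(\<lambda>y. hi y a b) differentiable (at x)" for a b
    by (rule smooth_diff[OF smooth_hi x])
  have 1: "pd c (\<lambda>y. \<Oplus>a b. hi y a b * T y (a # b # K)) x
      = (\<Oplus>a b. pd c (\<lambda>y. hi y a b) x * T x (a # b # K)) 
      + (\<Oplus>a b. hi x a b * pd c (\<lambda>y. T y (a # b # K)) x)"
    using dT dh by (simp add: pd_sum pd_mult sum.distrib differentiable_sum)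
  have 2: "(\<Oplus>a b. pd c (\<lambda>y. hi y a b) x * T x (a # b # K))
      = (\<Oplus>a b. hi x a b * (\<Oplus>d. ?N a d * T x (d # b # K)))
      + (\<Oplus>a b. hi x a b * (\<Oplus>d. ?N b d * T x (a # d # K)))" (is "_ = ?A + ?B")
  proof -
    have "?A = (\<Oplus>d b a. ?N a d * hi x a b * T x (d # b # K))"
    proof -
      have "?A = (\<Oplus>a b d. ?N a d * hi x a b * T x (d # b # K))"
        by (simp add: sum_distrib_left mult_ac)
      also have "\<dots> = (\<Oplus>b a d. ?N a d * hi x a b * T x (d # b # K))" by (rule sum.swap)
      also have "\<dots> = (\<Oplus>b d a. ?N a d * hi x a b * T x (d # b # K))"
        by (intro sum.cong refl sum.swap)
      also have "\<dots> = (\<Oplus>d b a. ?N a d * hi x a b * T x (d # b # K))" by (rule sum.swap)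
      finally show ?thesis .
    qed
    moreover have "?B = (\<Oplus>a d b. ?N b d * hi x a b * T x (a # d # K))"
    proof -
      have "?B = (\<Oplus>a b d. ?N b d * hi x a b * T x (a # d # K))"
        by (simp add: sum_distrib_left mult_ac)
      also have "\<dots> = (\<Oplus>a d b. ?N b d * hi x a b * T x (a # d # K))"
        by (intro sum.cong refl sum.swap)
      finally show ?thesis .
    qed
    ultimately show ?thesis
      by (simp add: pd_hi[OF x] left_diff_distrib sum_subtractf sum_negf sum_distrib_right)
  qed
  show ?thesis
    unfolding D_Cons act_Cons act_sum act_cmult 1 2
    by (simp add: distrib_left sum.distrib)
qed

subsection \<open>The second Bianchi identity and the theorem of Schur\<close>

lemma smooth_Riem: "smooth_on U (\<lambda>x. Riem x a b c d)"
  unfolding Riem_def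
  by (intro smooth_on_add smooth_on_diff smooth_on_sum smooth_on_mult open_U smooth_on_pd smooth_\<Gamma>)

lemma smooth_Rl: "smooth_on U (\<lambda>x. Rl x a b c d)"
  unfolding Rl_def by (intro smooth_on_sum smooth_on_mult open_U smooth_h smooth_Riem)

text \<open>
  The Jacobi identity for covariant derivatives, applied to the covector field whose only component
  is the constant 1 in the place \<open>c\<close>.
\<close>

lemma bianchi2_mixed:
  fixes c d
  assumes x: "x \<in> U"
  defines "E \<equiv> \<lambda>e a b d. pd e (\<lambda>y. Riem y a b c d) x
      - (\<Oplus>f. \<Gamma> x f e a * Riem x f b c d) - (\<Oplus>f. \<Gamma> x f e b * Riem x a f c d)
      - (\<Oplus>f. \<Gamma> x f e d * Riem x a b c f) + (\<Oplus>f. \<Gamma> x c e f * Riem x a b f d)"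
  shows "E e a b d + E a b e d + E b e a d = 0"
proof -
  define v where "v = (\<lambda>(y::real^'n) J. if J ! 0 = c then 1 else 0 :: real)"
  have v: "smooth_field 1 v" by (simp add: smooth_field_def v_def smooth_on_const)
  have DDv: "smooth_field 3 (D (D v))" using smooth_field_D[OF smooth_field_D[OF v]] by (simp add: numeral_eq_Suc)
  define Q where "Q = (\<lambda>y J. D (D v) y J + -1 * D (D v) y (swp 0 1 J))"
  have Dv: "D v x [p, q] = - \<Gamma> x c p q" for p q
    by (simp add: D_Cons v_def act_Cons sum_negf)
  have DQ: "D Q x [e, a, b, d] = D (D (D v)) x [e, a, b, d] - D (D (D v)) x [e, b, a, d]" for e a b
  proof -
    have sw: "smooth_field 3 (\<lambda>y J. D (D v) y (swp 0 1 J))"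
      using DDv by (simp add: smooth_field_def)
    have l: "length [a, b, d] = 3" by simp
    have "D Q x (e # [a, b, d]) = D (D (D v)) x (e # [a, b, d]) + -1 * D (\<lambda>y J. D (D v) y (swp 0 1 J)) x (e # [a, b, d])"
      unfolding Q_def D_add[OF DDv smooth_field_cmult[OF sw] x l] D_cmult[OF sw x l] by (rule refl)
    then show ?thesis
      by (subst (asm) D_swp) (simp_all add: swp_def)
  qed
  have QR: "D Q x [e, a, b, d] = D (\<lambda>y J. - Riem y (J ! 0) (J ! 1) c (J ! 2)) x [e, a, b, d]" for e a b
  proof (rule D_cong[OF _ x])
    fix y and J :: "'n list" assume y: "y \<in> U" and "length J = length [a, b, d]"
    then obtain a' b' d' where J: "J = [a', b', d']" by (auto simp: length_Suc_conv)
    show "Q y J = - Riem y (J ! 0) (J ! 1) c (J ! 2)"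
      using ricci_identity[OF v y, of "[d']" a' b'] by (simp add: J Q_def swp_def act_Cons v_def)
  qed
  have QE: "D Q x [e, a, b, d] = - E e a b d + (\<Oplus>f. \<Gamma> x c e f * Riem x a b f d)" for e a b
    unfolding QR by (simp add: D_Cons act_Cons E_def pd_minus smooth_diff[OF smooth_Riem x] sum_negf)
  have ricci: "D (D (D v)) x [a, b, e, d] - D (D (D v)) x [b, a, e, d]
      = (\<Oplus>f. \<Gamma> x c f d * Riem x a b f e) + (\<Oplus>f. \<Gamma> x c e f * Riem x a b f d)" for e a b
  proof -
    have "smooth_field 2 (D v)" using smooth_field_D[OF v] by (simp add: numeral_eq_Suc)
    from ricci_identity[OF this x, of "[e, d]" a b] show ?thesis
      by (simp add: act_Cons Dv sum_negf mult.commute)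
  qed
  have "E e a b d + E a b e d + E b e a d
      = - (\<Oplus>f. \<Gamma> x c f d * Riem x a b f e) - (\<Oplus>f. \<Gamma> x c f d * Riem x b e f a)
        - (\<Oplus>f. \<Gamma> x c f d * Riem x e a f b)"
    using DQ[of e a b] DQ[of a b e] DQ[of b e a] QE[of e a b] QE[of a b e] QE[of b e a]
      ricci[of a b e] ricci[of b e a] ricci[of e a b] by linarith
  also have "\<dots> = - (\<Oplus>f. \<Gamma> x c f d * (Riem x a b f e + Riem x b e f a + Riem x e a f b))"
    by (simp add: distrib_left sum.distrib)
  finally show ?thesis by (simp add: bianchi1_Riem[OF x])
qed

lemma D_Rl:
  assumes x: "x \<in> U"
  shows "D (\<lambda>y J. Rl y (J ! 0) (J ! 1) (J ! 2) (J ! 3)) x [e, a, b, c, d]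
    = (\<Oplus>p. h x c p * (pd e (\<lambda>y. Riem y a b p d) x
      - (\<Oplus>f. \<Gamma> x f e a * Riem x f b p d) - (\<Oplus>f. \<Gamma> x f e b * Riem x a f p d)
      - (\<Oplus>f. \<Gamma> x f e d * Riem x a b p f) + (\<Oplus>f. \<Gamma> x p e f * Riem x a b f d)))"
proof -
  have swap: "(\<Oplus>f. G f * (\<Oplus>p. h x c p * R f p)) = (\<Oplus>p. h x c p * (\<Oplus>f. G f * R f p))" for G R
    unfolding sum_distrib_left by (subst sum.swap) (simp add: mult.left_commute)
  have dp: "pd e (\<lambda>y. Rl y a b c d) x
      = (\<Oplus>p. pd e (\<lambda>y. h y c p) x * Riem x a b p d) + (\<Oplus>p. h x c p * pd e (\<lambda>y. Riem y a b p d) x)"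
    unfolding Rl_def
    by (simp add: pd_sum pd_mult smooth_diff[OF smooth_h x] smooth_diff[OF smooth_Riem x] sum.distrib)
  have "(\<Oplus>p. pd e (\<lambda>y. h y c p) x * Riem x a b p d)
      = (\<Oplus>p f. \<Gamma> x f e c * (h x f p * Riem x a b p d))
      + (\<Oplus>p f. h x c f * (\<Gamma> x f e p * Riem x a b p d))"
    unfolding pd_h[OF x] distrib_right sum.distrib sum_distrib_right by (simp add: mult.assoc mult.left_commute)
  also have "(\<Oplus>p f. \<Gamma> x f e c * (h x f p * Riem x a b p d)) = (\<Oplus>f. \<Gamma> x f e c * Rl x a b f d)"
    unfolding Rl_def sum_distrib_left by (rule sum.swap)
  also have "(\<Oplus>p f. h x c f * (\<Gamma> x f e p * Riem x a b p d))
      = (\<Oplus>p. h x c p * (\<Oplus>f. \<Gamma> x p e f * Riem x a b f d))"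
    unfolding sum_distrib_left by (rule sum.swap)
  finally have dh: "(\<Oplus>p. pd e (\<lambda>y. h y c p) x * Riem x a b p d)
    = (\<Oplus>f. \<Gamma> x f e c * Rl x a b f d) + (\<Oplus>p. h x c p * (\<Oplus>f. \<Gamma> x p e f * Riem x a b f d))" .
  have "D (\<lambda>y J. Rl y (J ! 0) (J ! 1) (J ! 2) (J ! 3)) x [e, a, b, c, d]
    = pd e (\<lambda>y. Rl y a b c d) x - (\<Oplus>f. \<Gamma> x f e a * Rl x f b c d) - (\<Oplus>f. \<Gamma> x f e b * Rl x a f c d)
      - (\<Oplus>f. \<Gamma> x f e c * Rl x a b f d) - (\<Oplus>f. \<Gamma> x f e d * Rl x a b c f)"
    by (simp add: D_Cons act_Cons sum_negf)
  also have "\<dots> = (\<Oplus>p. h x c p * pd e (\<lambda>y. Riem y a b p d) x)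
     + (\<Oplus>p. h x c p * (\<Oplus>f. \<Gamma> x p e f * Riem x a b f d))
     - (\<Oplus>f. \<Gamma> x f e a * (\<Oplus>p. h x c p * Riem x f b p d))
     - (\<Oplus>f. \<Gamma> x f e b * (\<Oplus>p. h x c p * Riem x a f p d))
     - (\<Oplus>f. \<Gamma> x f e d * (\<Oplus>p. h x c p * Riem x a b p f))"
    unfolding dp dh by (simp add: Rl_def)
  finally show ?thesis
    unfolding swap by (simp add: right_diff_distrib distrib_left sum.distrib sum_subtractf)
qed

lemma bianchi2:
  assumes x: "x \<in> U"
  defines "S \<equiv> \<lambda>y J. Rl y (J ! 0) (J ! 1) (J ! 2) (J ! 3)"
  shows "D S x [e, a, b, c, d] + D S x [a, b, e, c, d] + D S x [b, e, a, c, d] = 0"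
  unfolding S_def D_Rl[OF x] sum.distrib[symmetric] distrib_left[symmetric]
  using bianchi2_mixed[OF x] by simp

lemma contract_Rl13: "x \<in> U \<Longrightarrow> (\<Oplus>a c. hi x a c * Rl x a b c d) = (\<Oplus>a. Riem x a b a d)"
  by (simp add: Riem_Rl)

text \<open>
  The second Bianchi identity, contracted twice: the three terms give \<open>n\<close>, \<open>-1\<close> and \<open>-1\<close> times the
  derivative of the Einstein factor.
\<close>

lemma schur:
  assumes n: "CARD('n) \<ge> 3"
    and \<rho>: "smooth_on U \<rho>"
    and ric: "\<And>y b d. y \<in> U \<Longrightarrow> (\<Oplus>a. Riem y a b a d) = \<rho> y * h y b d"
    and x: "x \<in> U"
  shows "pd e \<rho> x = 0"
proof -
  let ?S = "\<lambda>y J. Rl y (J ! 0) (J ! 1) (J ! 2) (J ! 3)"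
  have Dric: "D (\<lambda>y J. r * (\<rho> y * h y (J ! 0) (J ! 1))) x [p, b, d] = r * pd p \<rho> x * h x b d" for r p b d
  proof -
    have "(\<lambda>y. \<rho> y * h y b d) differentiable (at x)"
      by (intro differentiable_mult smooth_diff[OF \<rho> x] smooth_diff[OF smooth_h x])
    then have "pd p (\<lambda>y. r * (\<rho> y * h y b d)) x = r * pd p \<rho> x * h x b d
        + r * \<rho> x * ((\<Oplus>f. \<Gamma> x f p b * h x f d) + (\<Oplus>f. \<Gamma> x f p d * h x b f))"
      by (simp add: pd_cmult pd_mult smooth_diff[OF \<rho> x] smooth_diff[OF smooth_h x] pd_h[OF x] distrib_left mult.assoc)
    moreover have "(\<Oplus>f. - \<Gamma> x f p b * (r * (\<rho> x * h x f d))) = - (r * \<rho> x * (\<Oplus>f. \<Gamma> x f p b * h x f d))"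
      "(\<Oplus>f. - \<Gamma> x f p d * (r * (\<rho> x * h x b f))) = - (r * \<rho> x * (\<Oplus>f. \<Gamma> x f p d * h x b f))"
      unfolding sum_distrib_left sum_negf[symmetric] by (intro sum.cong refl, simp)+
    ultimately show ?thesis by (simp add: D_Cons act_Cons distrib_left)
  qed
  have c1: "(\<Oplus>a c. hi x a c * D ?S x [e, a, b, c, d]) = pd e \<rho> x * h x b d" for e b d
  proof -
    let ?T = "\<lambda>y J. Rl y (J ! 0) (J ! 2) (J ! 1) (J ! 3)"
    have "D ?T x (e # a # c # [b, d]) = D ?S x [e, a, b, c, d]" for a c
      by (simp add: D_Cons act_Cons)
    then have "(\<Oplus>a c. hi x a c * D ?S x [e, a, b, c, d])
        = D (\<lambda>y K. \<Oplus>a c. hi y a c * ?T y (a # c # K)) x (e # [b, d])"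
      by (subst D_contract[where k = 2]) (auto simp: x smooth_field_def smooth_Rl)
    also have "\<dots> = D (\<lambda>y J. 1 * (\<rho> y * h y (J ! 0) (J ! 1))) x (e # [b, d])"
      by (rule D_cong[OF _ x]) (auto simp: length_Suc_conv contract_Rl13 ric)
    finally show ?thesis by (simp only: Dric)
  qed
  have c2: "(\<Oplus>b d. hi x b d * D ?S x [a, b, e, c, d]) = - pd a \<rho> x * h x e c" for a e c
  proof -
    let ?T = "\<lambda>y J. Rl y (J ! 0) (J ! 2) (J ! 3) (J ! 1)"
    have "D ?T x (a # b # d # [e, c]) = D ?S x [a, b, e, c, d]" for b d
      by (simp add: D_Cons act_Cons)
    then have "(\<Oplus>b d. hi x b d * D ?S x [a, b, e, c, d])
        = D (\<lambda>y K. \<Oplus>b d. hi y b d * ?T y (b # d # K)) x (a # [e, c])"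
      by (subst D_contract[where k = 2]) (auto simp: x smooth_field_def smooth_Rl)
    also have "\<dots> = D (\<lambda>y J. - 1 * (\<rho> y * h y (J ! 0) (J ! 1))) x (a # [e, c])"
    proof (rule D_cong[OF _ x])
      fix y and J :: "'n list" assume y: "y \<in> U" and "length J = length [e, c]"
      then obtain e' c' where J: "J = [e', c']" by (auto simp: length_Suc_conv)
      have "(\<Oplus>b d. hi y b d * Rl y b e' c' d) = - (\<Oplus>b d. hi y b d * Rl y b e' d c')"
        by (simp add: Rl_skew34[OF y, of _ e' c'] sum_negf)
      then show "(\<Oplus>b d. hi y b d * ?T y (b # d # J)) = - 1 * (\<rho> y * h y (J ! 0) (J ! 1))"
        using y by (simp add: J contract_Rl13 ric)
    qed
    finally show ?thesis by (simp only: Dric)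
  qed
  have c3: "(\<Oplus>a c. hi x a c * D ?S x [b, e, a, c, d]) = - pd b \<rho> x * h x e d" for b e d
  proof -
    let ?T = "\<lambda>y J. Rl y (J ! 2) (J ! 0) (J ! 1) (J ! 3)"
    have "D ?T x (b # a # c # [e, d]) = D ?S x [b, e, a, c, d]" for a c
      by (simp add: D_Cons act_Cons)
    then have "(\<Oplus>a c. hi x a c * D ?S x [b, e, a, c, d])
        = D (\<lambda>y K. \<Oplus>a c. hi y a c * ?T y (a # c # K)) x (b # [e, d])"
      by (subst D_contract[where k = 2]) (auto simp: x smooth_field_def smooth_Rl)
    also have "\<dots> = D (\<lambda>y J. - 1 * (\<rho> y * h y (J ! 0) (J ! 1))) x (b # [e, d])"
    proof (rule D_cong[OF _ x])
      fix y and J :: "'n list" assume y: "y \<in> U" and "length J = length [e, d]"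
      then obtain e' d' where J: "J = [e', d']" by (auto simp: length_Suc_conv)
      have "(\<Oplus>a c. hi y a c * Rl y e' a c d') = - (\<Oplus>a c. hi y a c * Rl y a e' c d')"
        by (simp add: Rl_skew12[of y e'] sum_negf)
      then show "(\<Oplus>a c. hi y a c * ?T y (a # c # J)) = - 1 * (\<rho> y * h y (J ! 0) (J ! 1))"
        using y by (simp add: J contract_Rl13 ric)
    qed
    finally show ?thesis by (simp only: Dric)
  qed
  have trace: "(\<Oplus>b d. hi x b d * (r * h x b d)) = r * real CARD('n)" for r
  proof -
    have "(\<Oplus>b d. hi x b d * (r * h x b d)) = (\<Oplus>b. r * (\<Oplus>d. hi x b d * h x d b))"
      by (simp add: sum_distrib_left h_sym[OF x, of _ ] mult.left_commute)
    then show ?thesis by (simp add: hi_h[OF x])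
  qed
  have contr: "(\<Oplus>a c. hi x a c * (- pd a \<rho> x * h x e c)) = - pd e \<rho> x" for e
  proof -
    have "(\<Oplus>a c. hi x a c * (- pd a \<rho> x * h x e c))
        = (\<Oplus>a. (\<Oplus>c. hi x a c * h x c e) * - pd a \<rho> x)"
      unfolding sum_distrib_right by (simp add: h_sym[OF x, of e] mult_ac)
    then show ?thesis by (simp only: hi_h[OF x] sum_delta_mult)
  qed
  have "0 = (\<Oplus>b d. hi x b d * (\<Oplus>a c. hi x a c *
      (D ?S x [e, a, b, c, d] + D ?S x [a, b, e, c, d] + D ?S x [b, e, a, c, d])))"
    unfolding bianchi2[OF x] by simp
  also have "\<dots> = (\<Oplus>b d. hi x b d * (\<Oplus>a c. hi x a c * D ?S x [e, a, b, c, d]))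
     + (\<Oplus>b d. hi x b d * (\<Oplus>a c. hi x a c * D ?S x [a, b, e, c, d]))
     + (\<Oplus>b d. hi x b d * (\<Oplus>a c. hi x a c * D ?S x [b, e, a, c, d]))"
    by (simp only: distrib_left sum.distrib)
  also have "(\<Oplus>b d. hi x b d * (\<Oplus>a c. hi x a c * D ?S x [a, b, e, c, d]))
     = (\<Oplus>a c. hi x a c * (\<Oplus>b d. hi x b d * D ?S x [a, b, e, c, d]))"
    by (rule contract_swap)
  also have "(\<Oplus>b d. hi x b d * (\<Oplus>a c. hi x a c * D ?S x [e, a, b, c, d]))
      = pd e \<rho> x * real CARD('n)"
    unfolding c1 by (rule trace)
  also have "(\<Oplus>a c. hi x a c * (\<Oplus>b d. hi x b d * D ?S x [a, b, e, c, d])) = - pd e \<rho> x"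
    unfolding c2 by (rule contr)
  also have "(\<Oplus>b d. hi x b d * (\<Oplus>a c. hi x a c * D ?S x [b, e, a, c, d])) = - pd e \<rho> x"
    unfolding c3 by (rule contr)
  finally have "pd e \<rho> x * (real CARD('n) - 2) = 0" by (simp add: algebra_simps)
  then show ?thesis using n by auto
qed

end

lemma alternating_cong:
  "(\<And>I. length I = k \<Longrightarrow> F I = G I) \<Longrightarrow> alternating k F \<longleftrightarrow> alternating k G"
  by (simp add: alternating_def)

lemma act_replace:
  assumes "j < length K"
  shows "act M F (K[j := a]) = (\<Oplus>c. M a c * F (K[j := c]))
    + (\<Sum>i\<in>{..<length K} - {j}. \<Oplus>c. M (K ! i) c * F (K[j := a, i := c]))"
  unfolding act_def using assms by (subst sum.remove[of _ j]) auto

lemma swp_Suc [simp]: "swp (Suc i) (Suc j) (a # I) = a # swp i j I"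
  by (simp add: swp_def)

context levi_civita
begin

section \<open>Exterior derivative and codifferential\<close>

definition form :: "nat \<Rightarrow> (real ^ 'n \<Rightarrow> 'n list \<Rightarrow> real) \<Rightarrow> bool" where
  "form k f \<longleftrightarrow> smooth_field k f \<and> (\<forall>x\<in>U. alternating k (f x))"

text \<open>
  A covariant derivative is not skew in its new index, so skewness is followed slot by slot.
\<close>

definition skew_slots :: "nat \<Rightarrow> nat \<Rightarrow> nat \<Rightarrow> (real ^ 'n \<Rightarrow> 'n list \<Rightarrow> real) \<Rightarrow> bool" where
  "skew_slots i j k T \<longleftrightarrow> (\<forall>x\<in>U. \<forall>I. length I = k \<longrightarrow> T x (swp i j I) = - T x I)"

lemma skew_slotsD: "skew_slots i j k T \<Longrightarrow> x \<in> U \<Longrightarrow> length I = k \<Longrightarrow> T x (swp i j I) = - T x I"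
  by (simp add: skew_slots_def)

lemma formD: "form k f \<Longrightarrow> smooth_field k f" "form k f \<Longrightarrow> x \<in> U \<Longrightarrow> alternating k (f x)"
  by (auto simp: form_def)

lemma form_skew_slots: "form k f \<Longrightarrow> i < k \<Longrightarrow> j < k \<Longrightarrow> i \<noteq> j \<Longrightarrow> skew_slots i j k f"
  by (simp add: form_def skew_slots_def swp_def alternating_def)

lemma skew_slots_D:
  assumes T: "smooth_field k T" "skew_slots i j k T" and ij: "i < k" "j < k"
  shows "skew_slots (Suc i) (Suc j) (Suc k) (D T)"
  unfolding skew_slots_def
proof (intro ballI allI impI)
  fix x and J :: "'n list" assume x: "x \<in> U" and "length J = Suc k"
  then obtain a I where J: "J = a # I" "length I = k" by (cases J) auto
  have "D T x (a # swp i j I) = D (\<lambda>y J. T y (swp i j J)) x (a # I)"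
    using ij J by (simp add: D_swp)
  also have "\<dots> = D (\<lambda>y J. -1 * T y J) x (a # I)"
    by (rule D_cong[OF _ x]) (use T(2) J in \<open>auto simp: skew_slots_def\<close>)
  also have "\<dots> = - D T x (a # I)" unfolding D_cmult[OF T(1) x J(2)] by simp
  finally show "D T x (swp (Suc i) (Suc j) J) = - D T x J" by (simp add: J)
qed

lemma D_alternating_tail:
  assumes f: "form k f" and x: "x \<in> U"
  shows "alternating k (\<lambda>I. D f x (a # I))"
  unfolding alternating_def
proof (intro allI impI)
  fix I :: "'n list" and i j assume *: "length I = k" "i < k" "j < k" "i \<noteq> j"
  have "skew_slots (Suc i) (Suc j) (Suc k) (D f)"
    using f * by (intro skew_slots_D form_skew_slots formD) auto
  from skew_slotsD[OF this x, of "a # I"] * have "D f x (swp (Suc i) (Suc j) (a # I)) = - D f x (a # I)" by simp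
  then show "D f x (a # I[i := I ! j, j := I ! i]) = - D f x (a # I)" by (simp add: swp_def)
qed

lemma DD_alternating_tail:
  assumes f: "form k f" and x: "x \<in> U"
  shows "alternating k (\<lambda>I. D (D f) x (a # b # I))"
  unfolding alternating_def
proof (intro allI impI)
  fix I :: "'n list" and i j assume *: "length I = k" "i < k" "j < k" "i \<noteq> j"
  have "skew_slots (Suc (Suc i)) (Suc (Suc j)) (Suc (Suc k)) (D (D f))"
    using f * by (intro skew_slots_D form_skew_slots formD smooth_field_D) auto
  from skew_slotsD[OF this x, of "a # b # I"] *
  have "D (D f) x (swp (Suc (Suc i)) (Suc (Suc j)) (a # b # I)) = - D (D f) x (a # b # I)" by simp
  then show "D (D f) x (a # b # I[i := I ! j, j := I ! i]) = - D (D f) x (a # b # I)" by (simp add: swp_def)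
qed

definition codf :: "(real ^ 'n \<Rightarrow> 'n list \<Rightarrow> real) \<Rightarrow> real ^ 'n \<Rightarrow> 'n list \<Rightarrow> real" where
  "codf f x K = - (\<Oplus>a b. hi x a b * D f x (a # b # K))"

text \<open>
  \<open>(d f)\<^sub>a\<^sub>K\<close> with the skew-symmetrisation written as exchanges of the first slot with another one; on
  forms it is \<open>k + 1\<close> times the skew part (\<open>extd_eq_alt\<close>).
\<close>

definition extd :: "(real ^ 'n \<Rightarrow> 'n list \<Rightarrow> real) \<Rightarrow> real ^ 'n \<Rightarrow> 'n list \<Rightarrow> real" where
  "extd f x J = (case J of [] \<Rightarrow> 0 | a # K \<Rightarrow> D f x (a # K) - (\<Sum>j<length K. D f x (K ! j # K[j := a])))"

lemma extd_Nil [simp]: "extd f x [] = 0"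
  by (simp add: extd_def)

lemma extd_Cons: "extd f x (a # K) = D f x (a # K) - (\<Sum>j<length K. D f x (K ! j # K[j := a]))"
  by (simp add: extd_def)

lemma extd_eq_alt:
  assumes "form k f" "x \<in> U" "length J = Suc k"
  shows "extd f x J = real (Suc k) * alt (D f x) J"
proof -
  obtain a K where "J = a # K" "length K = k" using assms(3) by (cases J) auto
  then show ?thesis
    using alt_tail_alternating[of k "D f x" K a] D_alternating_tail[OF assms(1,2)] by (simp add: extd_Cons)
qed

lemma form_extd: "form k f \<Longrightarrow> form (Suc k) (extd f)"
  unfolding form_def[of "Suc k"]
proof (intro conjI ballI)
  assume f: "form k f"
  show "smooth_field (Suc k) (extd f)"
    unfolding smooth_field_def
  proof (intro allI impI)
    fix J :: "'n list" assume "length J = Suc k"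
    then obtain a K where J: "J = a # K" "length K = k" by (cases J) auto
    show "smooth_on U (\<lambda>x. extd f x J)"
      unfolding J extd_Cons
      by (intro smooth_on_diff smooth_on_sum open_U smooth_fieldD[OF smooth_field_D[OF formD(1)[OF f]]]) (simp_all add: J)
  qed
  fix x assume x: "x \<in> U"
  show "alternating (Suc k) (extd f x)"
    using alternating_cmult[OF alternating_alt, of "Suc k" "real (Suc k)" "D f x"] extd_eq_alt[OF f x]
    by (subst alternating_cong) auto
qed

lemma form_codf: "form (Suc k) f \<Longrightarrow> form k (codf f)"
  unfolding form_def[of k]
proof (intro conjI ballI)
  assume f: "form (Suc k) f"
  show "smooth_field k (codf f)"
    unfolding smooth_field_def codf_def
    by (intro allI impI smooth_on_minus smooth_on_sum smooth_on_mult open_U smooth_hi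
        smooth_fieldD[OF smooth_field_D[OF formD(1)[OF f]]]) simp
  fix x assume x: "x \<in> U"
  show "alternating k (codf f x)"
    unfolding codf_def[abs_def] sum_negf[symmetric] mult_minus_left[symmetric]
    by (intro alternating_sum alternating_cmult alternating_tail D_alternating_tail f x)
qed

lemma codf_as_contraction:
  "codf f = (\<lambda>y K. -1 * (\<Oplus>a b. hi y a b * D f y (a # b # K)))"
  by (simp add: codf_def fun_eq_iff)

lemma smooth_field_contract:
  "smooth_field (Suc (Suc k)) T \<Longrightarrow> smooth_field k (\<lambda>y K. \<Oplus>a b. hi y a b * T y (a # b # K))"
  unfolding smooth_field_def by (intro allI impI smooth_on_sum smooth_on_mult open_U smooth_hi) auto

lemma D_codf:
  assumes f: "smooth_field (Suc k) f" and x: "x \<in> U" and K: "length K = k"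
  shows "D (codf f) x (c # K) = - (\<Oplus>a b. hi x a b * D (D f) x (c # a # b # K))"
  unfolding codf_as_contraction
    D_cmult[OF smooth_field_contract[OF smooth_field_D[OF f]] x K] D_contract[OF smooth_field_D[OF f] x K] by simp

lemma D_extd:
  assumes f: "form k f" and x: "x \<in> U" and K: "length K = k"
  shows "D (extd f) x (a # b # K) = D (D f) x (a # b # K) - (\<Sum>j<k. D (D f) x (a # K ! j # K[j := b]))"
proof -
  let ?s = "\<lambda>j y J. D f y (swp 0 (Suc j) J)"
  have Df: "smooth_field (Suc k) (D f)" using f formD smooth_field_D by blast
  have s: "smooth_field (Suc k) (?s j)" for j
    using Df by (simp add: smooth_field_def)
  have l: "length (b # K) = Suc k" using K by simp
  have "D (extd f) x (a # b # K) = D (\<lambda>y J. D f y J + -1 * (\<Sum>j<k. ?s j y J)) x (a # b # K)"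
  proof (rule D_cong[OF _ x])
    fix y and J :: "'n list" assume "length J = length (b # K)"
    then show "extd f y J = D f y J + -1 * (\<Sum>j<k. ?s j y J)"
      using K by (cases J) (auto simp: extd_Cons swp_def)
  qed
  also have "\<dots> = D (D f) x (a # b # K) + -1 * (\<Sum>j<k. D (?s j) x (a # b # K))"
    unfolding D_add[OF Df smooth_field_cmult[OF smooth_field_sum[OF s]] x l]
      D_cmult[OF smooth_field_sum[OF s] x l] D_sum[OF s x l] by (rule refl)
  also have "(\<Sum>j<k. D (?s j) x (a # b # K)) = (\<Sum>j<k. D (D f) x (a # K ! j # K[j := b]))"
    by (intro sum.cong refl, subst D_swp) (use K in \<open>auto simp: swp_def\<close>)
  finally show ?thesis by simp
qed

text \<open>The Christoffel symbols cancel in the exterior derivative, because they are symmetric.\<close>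

lemma extd_partial:
  assumes f: "form k f" and x: "x \<in> U" and K: "length K = k"
  shows "extd f x (a # K) = pd a (\<lambda>y. f y K) x - (\<Sum>j<k. pd (K ! j) (\<lambda>y. f y (K[j := a])) x)"
proof -
  let ?N = "\<lambda>a i c. - \<Gamma> x c a i"
  have "(\<Sum>j<k. act (?N (K ! j)) (f x) (K[j := a]))
      = (\<Sum>j<k. \<Oplus>c. ?N (K ! j) a c * f x (K[j := c]))
      + (\<Sum>j<k. \<Sum>i\<in>{..<k} - {j}. \<Oplus>c. ?N (K ! j) (K ! i) c * f x (K[j := a, i := c]))"
    using K by (simp add: act_replace sum.distrib)
  also have "(\<Sum>j<k. \<Sum>i\<in>{..<k} - {j}. \<Oplus>c. ?N (K ! j) (K ! i) c * f x (K[j := a, i := c])) = 0"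
  proof (rule sum_off_diagonal_skew)
    fix j i assume ij: "j < k" "i < k" "j \<noteq> i"
    have "?N (K ! j) (K ! i) c * f x (K[j := a, i := c]) = - (?N (K ! i) (K ! j) c * f x (K[i := a, j := c]))" for c
      using alternating_swap[OF formD(2)[OF f x] K ij, of a c] ij
      by (simp add: \<Gamma>_sym[OF x, of c "K ! j"] list_update_swap[of i j])
    then show "(\<Oplus>c. ?N (K ! j) (K ! i) c * f x (K[j := a, i := c]))
        = - (\<Oplus>c. ?N (K ! i) (K ! j) c * f x (K[i := a, j := c]))"
      by (simp add: sum_negf)
  qed
  also have "(\<Sum>j<k. \<Oplus>c. ?N (K ! j) a c * f x (K[j := c])) = act (?N a) (f x) K"
    using K by (simp add: act_def \<Gamma>_sym[OF x, of _ a])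
  finally show ?thesis by (simp add: extd_Cons D_Cons K sum.distrib)
qed

text \<open>
  Without Christoffel symbols this is the symmetry of second partial derivatives: terms cancel in pairs,
  and the terms with both indices exchanged are skew in the pair of slots.
\<close>

lemma extd_extd:
  assumes f: "form k f" and x: "x \<in> U" and L: "length L = Suc (Suc k)"
  shows "extd (extd f) x L = 0"
proof -
  obtain a b K where L: "L = a # b # K" "length K = k"
    using L by (auto simp: length_Suc_conv)
  let ?P = "\<lambda>p q I. pd p (pd q (\<lambda>y. f y I)) x"
  have comm: "?P p q I = ?P q p I" if "length I = k" for p q I
    by (rule pd_commute[OF open_U x smooth_fieldD[OF formD(1)[OF f] that]])
  have pdd: "pd p (\<lambda>y. extd f y (b # I)) x = ?P p b I - (\<Sum>j<k. ?P p (I ! j) (I[j := b]))"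
    if I: "length I = k" for p b I
  proof -
    have diff: "pd q (\<lambda>y. f y I) differentiable (at x)" if "length I = k" for q I
      using that by (intro smooth_diff[OF smooth_on_pd x] smooth_fieldD[OF formD(1)[OF f]])
    have "pd p (\<lambda>y. extd f y (b # I)) x = pd p (\<lambda>y. pd b (\<lambda>y. f y I) y - (\<Sum>j<k. pd (I ! j) (\<lambda>y. f y (I[j := b])) y)) x"
      by (rule pd_cong[OF open_U x]) (simp add: extd_partial[OF f _ I])
    then show ?thesis using I diff by (simp add: pd_diff pd_sum differentiable_sum)
  qed
  have "extd (extd f) x L = pd a (\<lambda>y. extd f y (b # K)) x - pd b (\<lambda>y. extd f y (a # K)) x
      - (\<Sum>j<k. pd (K ! j) (\<lambda>y. extd f y (b # K[j := a])) x)"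
    using L by (simp only: extd_partial[OF form_extd[OF f] x, of "b # K"] L list.size add_Suc_right add_0_right)
      (simp only: sum.lessThan_Suc_shift nth_Cons_0 nth_Cons_Suc list_update_code diff_diff_eq)
  also have "\<dots> = ?P a b K - (\<Sum>j<k. ?P a (K ! j) (K[j := b])) - (?P b a K - (\<Sum>j<k. ?P b (K ! j) (K[j := a])))
      - (\<Sum>j<k. ?P (K ! j) b (K[j := a])) + (\<Sum>j<k. \<Sum>i<k. ?P (K ! j) (K[j := a] ! i) (K[j := a, i := b]))"
    using L by (simp add: pdd sum_subtractf)
  also have "(\<Sum>j<k. \<Sum>i<k. ?P (K ! j) (K[j := a] ! i) (K[j := a, i := b]))
      = (\<Sum>j<k. ?P (K ! j) a (K[j := b])) + (\<Sum>j<k. \<Sum>i\<in>{..<k} - {j}. ?P (K ! j) (K ! i) (K[j := a, i := b]))"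
  proof -
    have "(\<Sum>i<k. ?P (K ! j) (K[j := a] ! i) (K[j := a, i := b]))
        = ?P (K ! j) a (K[j := b]) + (\<Sum>i\<in>{..<k} - {j}. ?P (K ! j) (K ! i) (K[j := a, i := b]))" if "j < k" for j
      using that L by (subst sum.remove[of _ j]) auto
    then show ?thesis by (simp add: sum.distrib)
  qed
  also have "(\<Sum>j<k. \<Sum>i\<in>{..<k} - {j}. ?P (K ! j) (K ! i) (K[j := a, i := b])) = 0"
  proof (rule sum_off_diagonal_skew)
    fix j i assume ij: "j < k" "i < k" "j \<noteq> i"
    have "?P (K ! j) (K ! i) (K[j := a, i := b]) = pd (K ! j) (pd (K ! i) (\<lambda>y. - f y (K[i := a, j := b]))) x"
    proof (rule pd_cong[OF open_U x], rule pd_cong[OF open_U])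
      fix z assume z: "z \<in> U"
      show "f z (K[j := a, i := b]) = - f z (K[i := a, j := b])"
        using alternating_swap[OF formD(2)[OF f z] L(2) ij, of a b] ij by (simp add: list_update_swap[of i j])
    qed
    also have "\<dots> = pd (K ! j) (\<lambda>y. - pd (K ! i) (\<lambda>y. f y (K[i := a, j := b])) y) x"
      using L by (intro pd_cong[OF open_U x] pd_minus smooth_field_differentiable[OF formD(1)[OF f]]) auto
    also have "\<dots> = - ?P (K ! j) (K ! i) (K[i := a, j := b])"
      using L by (intro pd_minus smooth_diff[OF smooth_on_pd x] smooth_fieldD[OF formD(1)[OF f]]) auto
    finally show "?P (K ! j) (K ! i) (K[j := a, i := b]) = - ?P (K ! i) (K ! j) (K[i := a, j := b])"
      using L by (simp add: comm)
  qed
  finally show ?thesis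
    using comm L by simp
qed

definition Lap :: "(real ^ 'n \<Rightarrow> 'n list \<Rightarrow> real) \<Rightarrow> real ^ 'n \<Rightarrow> 'n list \<Rightarrow> real" where
  "Lap f x K = (\<Oplus>a b. hi x a b * D (D f) x (a # b # K))"

text \<open>
  \<open>\<delta> d + d \<delta>\<close> consists of the Laplacian and of commutators of the two derivatives, one for each slot.
\<close>

lemma bochner:
  assumes f: "form k f" and x: "x \<in> U" and K: "length K = k"
  shows "codf (extd f) x K + extd (codf f) x K = - Lap f x K
    - (\<Sum>j<k. \<Oplus>a b. hi x a b * act (\<lambda>i e. Riem x a (K ! j) e i) (f x) (K[j := b]))"
proof -
  let ?C = "\<lambda>T. \<Oplus>a b. hi x a b * T a b :: real"
  have C: "?C (\<lambda>a b. T a b - S a b) = ?C T - ?C S" "?C (\<lambda>a b. - T a b) = - ?C T" for T S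
    by (simp_all add: right_diff_distrib sum_subtractf sum_negf)
  have Csum: "?C (\<lambda>a b. \<Sum>j<k. T j a b) = (\<Sum>j<k. ?C (T j))" for T
    by (rule contract_sum)
  have 1: "codf (extd f) x K = - Lap f x K + (\<Sum>j<k. ?C (\<lambda>a b. D (D f) x (a # K ! j # K[j := b])))"
    unfolding codf_def D_extd[OF f x K] C(1) Csum Lap_def by simp
  have 2: "extd (codf f) x K = - (\<Sum>j<k. ?C (\<lambda>a b. D (D f) x (K ! j # a # K[j := b])))"
  proof (cases K)
    case Nil
    then show ?thesis using K by simp
  next
    case (Cons c K')
    with K obtain k' where k: "k = Suc k'" "length K' = k'" by auto
    have sf: "smooth_field (Suc k') f" using f k formD by blast
    have sw: "D (D f) x (p # a # b # K'[j := c]) = - D (D f) x (p # a # c # K'[j := b])" if "j < k'" for p a b j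
      using alternating_cons_swap[OF DD_alternating_tail[OF f[unfolded k(1)] x, of p a] k(2) that] .
    have "extd (codf f) x K = - ?C (\<lambda>a b. D (D f) x (c # a # b # K'))
        + (\<Sum>j<k'. ?C (\<lambda>a b. D (D f) x (K' ! j # a # b # K'[j := c])))"
      using k by (simp add: Cons extd_Cons D_codf[OF sf x] sum_negf)
    also have "(\<Sum>j<k'. ?C (\<lambda>a b. D (D f) x (K' ! j # a # b # K'[j := c])))
        = - (\<Sum>j<k'. ?C (\<lambda>a b. D (D f) x (K' ! j # a # c # K'[j := b])))"
      by (simp add: sw sum_negf)
    finally show ?thesis
      unfolding k(1) sum.lessThan_Suc_shift by (simp add: Cons)
  qed
  have "?C (\<lambda>a b. D (D f) x (a # K ! j # K[j := b])) - ?C (\<lambda>a b. D (D f) x (K ! j # a # K[j := b]))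
      = - ?C (\<lambda>a b. act (\<lambda>i e. Riem x a (K ! j) e i) (f x) (K[j := b]))" for j
    unfolding C[symmetric] using ricci_identity[OF formD(1)[OF f] x] K by simp
  then have "(\<Sum>j<k. ?C (\<lambda>a b. D (D f) x (a # K ! j # K[j := b]))) - (\<Sum>j<k. ?C (\<lambda>a b. D (D f) x (K ! j # a # K[j := b])))
      = - (\<Sum>j<k. ?C (\<lambda>a b. act (\<lambda>i e. Riem x a (K ! j) e i) (f x) (K[j := b])))"
    by (simp only: sum_subtractf[symmetric] sum_negf[symmetric])
  then show ?thesis unfolding 1 2 by linarith
qed

end

lemma sum3_cycle: "(\<Sum>a\<in>A. \<Sum>b\<in>A. \<Sum>c\<in>A. T a b c) = (\<Sum>a\<in>A. \<Sum>b\<in>A. \<Sum>c\<in>A. T b c a)"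
proof -
  have "(\<Sum>a\<in>A. \<Sum>b\<in>A. \<Sum>c\<in>A. T b c a) = (\<Sum>b\<in>A. \<Sum>a\<in>A. \<Sum>c\<in>A. T b c a)" by (rule sum.swap)
  also have "\<dots> = (\<Sum>b\<in>A. \<Sum>c\<in>A. \<Sum>a\<in>A. T b c a)" by (intro sum.cong refl sum.swap)
  finally show ?thesis by simp
qed

section \<open>Differential forms on an Einstein metric\<close>

text \<open>
  Einstein metrics, normalised so that \<open>kap\<close> is the curvature of the model of constant curvature with
  the same Ricci tensor; the Schouten tensor is \<open>kap / 2\<close> times the metric.
\<close>

locale einstein_patch = levi_civita U h hi \<Gamma> for U :: "(real ^ 'n::finite) set" and h hi \<Gamma> +
  fixes kap :: real
  assumes ric: "x \<in> U \<Longrightarrow> (\<Oplus>a. Riem x a b a d) = (real CARD('n) - 1) * kap * h x b d"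
begin

definition weyl_low :: "real ^ 'n \<Rightarrow> 'n \<Rightarrow> 'n \<Rightarrow> 'n \<Rightarrow> 'n \<Rightarrow> real" where
  "weyl_low x a b c d = Rl x a b c d - kap * (h x c a * h x b d - h x c b * h x a d)"

definition weyl_up :: "real ^ 'n \<Rightarrow> 'n \<Rightarrow> 'n \<Rightarrow> 'n \<Rightarrow> 'n \<Rightarrow> real" where
  "weyl_up x c d b e = (\<Oplus>a p. hi x b a * hi x e p * weyl_low x c d a p)"

text \<open>
  The double action of the Weyl tensor, as half a sum over ordered pairs of distinct slots.
\<close>

definition weyl_action :: "(real ^ 'n \<Rightarrow> 'n list \<Rightarrow> real) \<Rightarrow> real ^ 'n \<Rightarrow> 'n list \<Rightarrow> real" where
  "weyl_action f x K = (\<Sum>j<length K. \<Sum>i\<in>{..<length K} - {j}. \<Oplus>b e. 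
     weyl_up x (K ! j) (K ! i) b e * f x (K[j := b, i := e])) / 2"

lemma ric_contract:
  assumes x: "x \<in> U"
  shows "(\<Oplus>a b. hi x a b * Riem x a c e b)
    = - ((real CARD('n) - 1) * kap * (if e = c then 1 else 0))"
proof -
  have "(\<Oplus>a b. hi x a b * Riem x a c e b)
      = (\<Oplus>a b p. hi x e p * (hi x a b * Rl x a c p b))"
    by (simp add: Riem_Rl[OF x] sum_distrib_left mult.left_commute)
  also have "\<dots> = (\<Oplus>a p b. hi x e p * (hi x a b * Rl x a c p b))"
    by (intro sum.cong refl sum.swap)
  also have "\<dots> = (\<Oplus>p a b. hi x e p * (hi x a b * Rl x a c p b))"
    by (rule sum.swap)
  also have "\<dots> = (\<Oplus>p. - (hi x e p * (\<Oplus>a b. hi x a b * Rl x a c b p)))"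
    unfolding sum_distrib_left sum_negf[symmetric]
    by (intro sum.cong refl) (subst Rl_skew34[OF x], simp)
  also have "\<dots> = - ((real CARD('n) - 1) * kap * (\<Oplus>p. hi x e p * h x p c))"
    unfolding contract_Rl13[OF x] ric[OF x]
    by (simp add: sum_negf sum_distrib_left h_sym[OF x, of c] mult_ac)
  finally show ?thesis by (simp add: hi_h[OF x])
qed

text \<open>
  Against a skew \<open>g\<close>, the curvature contracted in its first and third place is half of the curvature
  contracted in a pair, by the first Bianchi identity and the pair symmetry.
\<close>

lemma Riem_contract_skew:
  assumes x: "x \<in> U" and g: "\<And>b e. g b e = - g e b"
  shows "(\<Oplus>a b. hi x a b * (\<Oplus>e. Riem x a c e d * g b e))
    = kap * g c d + (\<Oplus>b e. weyl_up x c d b e * g b e) / 2"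
proof -
  define Q where "Q R = (\<Oplus>a b. hi x a b * (\<Oplus>p e. hi x p e * (R a p * g b e)))" for R
  have Q_diff: "Q (\<lambda>a p. R a p - S a p) = Q R - Q S" for R S
    by (simp add: Q_def left_diff_distrib right_diff_distrib sum_subtractf)
  have Q_cmult: "Q (\<lambda>a p. r * R a p) = r * Q R" for r R
    by (simp add: Q_def sum_distrib_left mult_ac)
  have Q_skew: "Q (\<lambda>a p. R p a) = - Q R" for R
  proof -
    have "Q (\<lambda>a p. R p a) = (\<Oplus>p e. hi x p e * (\<Oplus>a b. hi x a b * (R p a * g b e)))"
      unfolding Q_def by (rule contract_swap)
    also have "\<dots> = - Q R"
      unfolding Q_def sum_negf[symmetric] mult_minus_right[symmetric]
      by (simp only: mult_minus_right[symmetric] g[symmetric])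
    finally show ?thesis .
  qed
  have Q_delta: "Q (\<lambda>a p. h x a c * h x d p) = g c d" for c d
  proof -
    have 1: "(\<Oplus>p e. hi x p e * (h x d p * v e)) = v d" for v d
    proof -
      have "(\<Oplus>p e. hi x p e * (h x d p * v e)) = (\<Oplus>p. h x d p * (\<Oplus>e. hi x p e * v e))"
        by (simp add: sum_distrib_left mult_ac)
      then show ?thesis by (simp add: lower_raise[OF x])
    qed
    have "Q (\<lambda>a p. h x a c * h x d p) = (\<Oplus>a b. hi x a b * (h x c a * (\<Oplus>p e. hi x p e * (h x d p * g b e))))"
      unfolding Q_def sum_distrib_left by (simp add: h_sym[OF x, of c] mult_ac)
    also have "\<dots> = g c d" by (simp only: 1)
    finally show ?thesis .
  qed
  have "(\<Oplus>a b. hi x a b * (\<Oplus>e. Riem x a c e d * g b e)) = Q (\<lambda>a p. Rl x a c p d)"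
  proof -
    have "(\<Oplus>e. Riem x a c e d * g b e) = (\<Oplus>p e. hi x p e * (Rl x a c p d * g b e))" for a b
      by (subst sum.swap) (simp add: Riem_Rl[OF x] sum_distrib_right sum_distrib_left hi_sym[OF x, of _ p for p] mult_ac)
    then show ?thesis by (simp add: Q_def)
  qed
  moreover have "2 * Q (\<lambda>a p. Rl x a c p d) = Q (\<lambda>a p. Rl x c d a p)"
  proof -
    have "Rl x a c p d - Rl x p c a d = Rl x c d a p" for a p
      using bianchi1[OF x, of a c p d] Rl_pair[OF x, of c d a p] Rl_skew12[of x p c a d] Rl_skew12[of x a p c d]
      by simp
    then have "Q (\<lambda>a p. Rl x c d a p) = Q (\<lambda>a p. Rl x a c p d - Rl x p c a d)" by simp
    also have "\<dots> = Q (\<lambda>a p. Rl x a c p d) - Q (\<lambda>a p. Rl x p c a d)" by (rule Q_diff)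
    also have "Q (\<lambda>a p. Rl x p c a d) = - Q (\<lambda>a p. Rl x a c p d)" by (rule Q_skew)
    finally show ?thesis by simp
  qed
  moreover have "(\<Oplus>b e. weyl_up x c d b e * g b e) = Q (\<lambda>a p. weyl_low x c d a p)"
  proof -
    have "Q (\<lambda>a p. weyl_low x c d a p) = (\<Oplus>a b p e. hi x b a * hi x e p * weyl_low x c d a p * g b e)"
      by (simp add: Q_def sum_distrib_left mult_ac hi_sym[OF x, of _ a for a])
    also have "\<dots> = (\<Oplus>a b e p. hi x b a * hi x e p * weyl_low x c d a p * g b e)"
      by (intro sum.cong refl sum.swap)
    also have "\<dots> = (\<Oplus>b a e p. hi x b a * hi x e p * weyl_low x c d a p * g b e)"
      by (rule sum.swap)
    also have "\<dots> = (\<Oplus>b e a p. hi x b a * hi x e p * weyl_low x c d a p * g b e)"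
      by (intro sum.cong refl sum.swap)
    finally show ?thesis by (simp add: weyl_up_def sum_distrib_right)
  qed
  moreover have "Q (\<lambda>a p. weyl_low x c d a p) = Q (\<lambda>a p. Rl x c d a p) - kap * (g c d - g d c)"
  proof -
    have "Q (\<lambda>a p. weyl_low x c d a p) = Q (\<lambda>a p. Rl x c d a p) - Q (\<lambda>a p. kap * (h x a c * h x d p - h x a d * h x c p))"
      unfolding weyl_low_def by (rule Q_diff)
    then show ?thesis unfolding Q_cmult Q_diff Q_delta .
  qed
  moreover have "g d c = - g c d" by (rule g)
  ultimately show ?thesis by (simp add: algebra_simps)
qed

text \<open>
  In the curvature terms of \<open>bochner\<close>, a single slot sees the Ricci tensor, and a pair of slots the Weyl
  tensor and the part of constant curvature: \<open>k (n - 1) - k (k - 1) = k (n - k)\<close>.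
\<close>

theorem weitzenboeck:
  assumes f: "form k f" and x: "x \<in> U" and K: "length K = k"
  shows "codf (extd f) x K + extd (codf f) x K
    = - Lap f x K - weyl_action f x K + kap * real k * (real CARD('n) - real k) * f x K"
proof -
  let ?W = "\<lambda>j i. \<Oplus>b e. weyl_up x (K ! j) (K ! i) b e * f x (K[j := b, i := e])"
  have "(\<Oplus>a b. hi x a b * act (\<lambda>i e. Riem x a (K ! j) e i) (f x) (K[j := b]))
      = - ((real CARD('n) - 1) * kap * f x K) + (\<Sum>i\<in>{..<k} - {j}. kap * f x K + ?W j i / 2)" if j: "j < k" for j
  proof -
    have "(\<Oplus>a b. hi x a b * act (\<lambda>i e. Riem x a (K ! j) e i) (f x) (K[j := b]))
      = (\<Oplus>a b e. hi x a b * Riem x a (K ! j) e b * f x (K[j := e]))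
      + (\<Oplus>a b. \<Sum>i\<in>{..<k} - {j}. hi x a b * (\<Oplus>e. Riem x a (K ! j) e (K ! i) * f x (K[j := b, i := e])))"
      using j K by (simp add: act_replace distrib_left sum.distrib sum_distrib_left mult.assoc)
    also have "(\<Oplus>a b e. hi x a b * Riem x a (K ! j) e b * f x (K[j := e]))
        = (\<Oplus>e. (\<Oplus>a b. hi x a b * Riem x a (K ! j) e b) * f x (K[j := e]))"
      unfolding sum_distrib_right by (subst sum3_cycle) simp
    also have "\<dots> = - ((real CARD('n) - 1) * kap * f x K)"
      by (simp add: ric_contract[OF x] sum_negf mult.assoc flip: sum_distrib_left)
    also have "(\<Oplus>a b. \<Sum>i\<in>{..<k} - {j}. hi x a b * (\<Oplus>e. Riem x a (K ! j) e (K ! i) * f x (K[j := b, i := e])))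
        = (\<Sum>i\<in>{..<k} - {j}. \<Oplus>a b. hi x a b * (\<Oplus>e. Riem x a (K ! j) e (K ! i) * f x (K[j := b, i := e])))"
      (is "?L = ?R")
    proof -
      have "?L = (\<Oplus>a. \<Sum>i\<in>{..<k} - {j}. \<Oplus>b. hi x a b * (\<Oplus>e. Riem x a (K ! j) e (K ! i) * f x (K[j := b, i := e])))"
        by (intro sum.cong refl sum.swap)
      also have "\<dots> = ?R" by (rule sum.swap)
      finally show ?thesis .
    qed
    also have "\<dots> = (\<Sum>i\<in>{..<k} - {j}. kap * f x K + ?W j i / 2)"
    proof (intro sum.cong refl)
      fix i assume i: "i \<in> {..<k} - {j}"
      have "f x (K[j := b, i := e]) = - f x (K[j := e, i := b])" for b e
        using alternating_swap[OF formD(2)[OF f x] K j, of i b e] i by simp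
      from Riem_contract_skew[OF x this, of "K ! j" "K ! i"] show
        "(\<Oplus>a b. hi x a b * (\<Oplus>e. Riem x a (K ! j) e (K ! i) * f x (K[j := b, i := e])))
          = kap * f x K + ?W j i / 2"
        using i by simp
    qed
    finally show ?thesis .
  qed
  then have "(\<Sum>j<k. \<Oplus>a b. hi x a b * act (\<lambda>i e. Riem x a (K ! j) e i) (f x) (K[j := b]))
      = (\<Sum>j<k. - ((real CARD('n) - 1) * kap * f x K) + (\<Sum>i\<in>{..<k} - {j}. kap * f x K + ?W j i / 2))"
    by simp
  also have "\<dots> = - (real k * ((real CARD('n) - 1) * kap * f x K)) + real k * ((real k - 1) * (kap * f x K)) + weyl_action f x K"
  proof -
    have "(\<Sum>j<k. \<Sum>i\<in>{..<k} - {j}. kap * f x K) = real k * ((real k - 1) * (kap * f x K))"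
      by (cases k) auto
    then show ?thesis by (simp add: weyl_action_def K sum.distrib sum_subtractf sum_divide_distrib)
  qed
  finally show ?thesis unfolding bochner[OF f x K] by (simp add: algebra_simps)
qed

lemma contract_skew: 
  assumes x: "x \<in> U" and g: "\<And>b e. g b e = - g e b"
  shows "(\<Oplus>a b. hi x a b * g a b) = 0"
proof -
  have "(\<Oplus>a b. hi x a b * g a b) = (\<Oplus>b a. hi x a b * g a b)" by (rule sum.swap)
  also have "\<dots> = (\<Oplus>b a. - (hi x b a * g b a))"
  proof (intro sum.cong refl)
    fix b a show "hi x a b * g a b = - (hi x b a * g b a)"
      using hi_sym[OF x, of a b] g[of a b] by simp
  qed
  finally show ?thesis by (simp add: sum_negf)
qed

text \<open>
  Exchanging the two derivatives changes the sign, so twice \<open>\<delta> \<delta> f\<close> is a curvature term. In it the Ricci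
  tensor meets a skew pair, and the Riemann tensor three skew indices, where the first Bianchi identity
  applies.
\<close>

lemma codf_codf:
  assumes f: "form (Suc (Suc k)) f" and x: "x \<in> U" and K: "length K = k"
  shows "codf (codf f) x K = 0"
proof -
  let ?C = "\<lambda>T. \<Oplus>a b. hi x a b * T a b :: real"
  have alt: "alternating (Suc (Suc k)) (f x)" by (rule formD(2)[OF f x])
  have C_add: "?C (\<lambda>a b. T a b + S a b) = ?C T + ?C S" for T S
    by (simp add: distrib_left sum.distrib)
  have C_neg: "?C (\<lambda>a b. - T a b) = - ?C T" for T
    by (simp add: sum_negf)
  let ?DD = "\<lambda>J. D (D f) x J"
  have S: "codf (codf f) x K = ?C (\<lambda>a b. ?C (\<lambda>c d. ?DD (a # c # d # b # K)))"
    using D_codf[OF formD(1)[OF f] x, of "_ # K"] K by (simp add: codf_def[of "codf f"] sum_negf)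
  have "?C (\<lambda>a b. ?C (\<lambda>c d. ?DD (a # c # d # b # K))) = ?C (\<lambda>c d. ?C (\<lambda>a b. ?DD (a # c # d # b # K)))"
    by (rule contract_swap)
  also have "\<dots> = ?C (\<lambda>a b. ?C (\<lambda>c d. - ?DD (c # a # d # b # K)))"
  proof -
    have *: "?DD (c # a # b # d # K) = - ?DD (c # a # d # b # K)" for a b c d
      using alternatingD[OF DD_alternating_tail[OF f x, of c a], of "b # d # K" 0 1] K by simp
    show ?thesis unfolding sum_distrib_left by (intro sum.cong refl) (subst *, rule refl)
  qed
  finally have eq: "?C (\<lambda>a b. ?C (\<lambda>c d. ?DD (a # c # d # b # K))) = ?C (\<lambda>a b. ?C (\<lambda>c d. - ?DD (c # a # d # b # K)))" .
  have "2 * codf (codf f) x K = ?C (\<lambda>a b. ?C (\<lambda>c d. ?DD (a # c # d # b # K)))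
      + ?C (\<lambda>a b. ?C (\<lambda>c d. - ?DD (c # a # d # b # K)))"
    by (simp only: S eq[symmetric] mult_2)
  also have "\<dots> = ?C (\<lambda>a b. ?C (\<lambda>c d. ?DD (a # c # d # b # K) + - ?DD (c # a # d # b # K)))"
    by (simp only: C_add)
  also have "\<dots> = - ?C (\<lambda>a b. ?C (\<lambda>c d. act (\<lambda>i e. Riem x a c e i) (f x) (d # b # K)))"
    using ricci_identity[OF formD(1)[OF f] x, of "_ # _ # K"] K by (simp add: sum_negf)
  also have "?C (\<lambda>a b. ?C (\<lambda>c d. act (\<lambda>i e. Riem x a c e i) (f x) (d # b # K)))
      = ?C (\<lambda>a b. ?C (\<lambda>c d. \<Oplus>e. Riem x a c e d * f x (e # b # K)))
      + ?C (\<lambda>a b. ?C (\<lambda>c d. \<Oplus>e. Riem x a c e b * f x (d # e # K)))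
      + ?C (\<lambda>a b. ?C (\<lambda>c d. act (\<lambda>i e. Riem x a c e i) (\<lambda>J. f x (d # b # J)) K))"
    by (simp add: act_Cons C_add add.assoc)
  also have "?C (\<lambda>a b. ?C (\<lambda>c d. \<Oplus>e. Riem x a c e d * f x (e # b # K))) = 0"
  proof -
    have "?C (\<lambda>c d. \<Oplus>e. Riem x a c e d * f x (e # b # K)) = (real CARD('n) - 1) * kap * f x (a # b # K)" for a b
    proof -
      have "?C (\<lambda>c d. \<Oplus>e. Riem x a c e d * f x (e # b # K))
          = (\<Oplus>e. - ?C (\<lambda>c d. Riem x c a e d) * f x (e # b # K))"
        unfolding sum_distrib_left sum_distrib_right sum_negf[symmetric]
        by (subst sum3_cycle) (simp add: Riem_skew[of x a] mult.assoc)
      also have "\<dots> = (\<Oplus>e. ((real CARD('n) - 1) * kap) * ((if e = a then 1 else 0) * f x (e # b # K)))"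
        unfolding ric_contract[OF x] by (simp add: mult.assoc)
      finally show ?thesis by (simp flip: sum_distrib_left)
    qed
    then have "?C (\<lambda>a b. ?C (\<lambda>c d. \<Oplus>e. Riem x a c e d * f x (e # b # K)))
        = ?C (\<lambda>a b. (real CARD('n) - 1) * kap * f x (a # b # K))" by simp
    also have "\<dots> = 0"
    proof (rule contract_skew[OF x])
      fix b e
      show "(real CARD('n) - 1) * kap * f x (b # e # K) = - ((real CARD('n) - 1) * kap * f x (e # b # K))"
        using alternatingD[OF alt, of "e # b # K" 0 1] K by simp
    qed
    finally show ?thesis .
  qed
  also have "?C (\<lambda>a b. ?C (\<lambda>c d. \<Oplus>e. Riem x a c e b * f x (d # e # K))) = 0"
  proof -
    have *: "?C (\<lambda>a b. \<Oplus>e. Riem x a c e b * f x (d # e # K)) = - ((real CARD('n) - 1) * kap * f x (d # c # K))" for c d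
    proof -
      have "?C (\<lambda>a b. \<Oplus>e. Riem x a c e b * f x (d # e # K))
          = (\<Oplus>e. ?C (\<lambda>a b. Riem x a c e b) * f x (d # e # K))"
        unfolding sum_distrib_left sum_distrib_right
        by (subst sum3_cycle) (simp add: mult.assoc)
      also have "\<dots> = (\<Oplus>e. (- ((real CARD('n) - 1) * kap)) * ((if e = c then 1 else 0) * f x (d # e # K)))"
        unfolding ric_contract[OF x] by (simp add: mult.assoc)
      finally show ?thesis by (simp only: sum_distrib_left[symmetric] sum_delta_mult) simp
    qed
    have "?C (\<lambda>a b. ?C (\<lambda>c d. \<Oplus>e. Riem x a c e b * f x (d # e # K)))
        = ?C (\<lambda>c d. ?C (\<lambda>a b. \<Oplus>e. Riem x a c e b * f x (d # e # K)))"
      by (rule contract_swap)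
    also have "\<dots> = 0" unfolding *
    proof (rule contract_skew[OF x])
      fix b e
      show "- ((real CARD('n) - 1) * kap * f x (e # b # K)) = - (- ((real CARD('n) - 1) * kap * f x (b # e # K)))"
        using alternatingD[OF alt, of "e # b # K" 0 1] K by simp
    qed
    finally show ?thesis .
  qed
  also have "?C (\<lambda>a b. ?C (\<lambda>c d. act (\<lambda>i e. Riem x a c e i) (\<lambda>J. f x (d # b # J)) K)) = 0"
  proof -
    \<comment> \<open>\<open>f\<close> with its first two indices and the one in slot \<open>i\<close> raised; it is invariant under cyclic
      permutations of them.\<close>
    define g where "g i a c p = (\<Oplus>b d e. hi x a b * hi x c d * hi x p e * f x (d # b # K[i := e]))" for i a c p
    have g_cycle: "g i c p a = g i a c p" if i: "i < k" for i a c p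
    proof -
      have *: "f x (e # d # K[i := b]) = f x (d # b # K[i := e])" for b d e
        using alternating_swap[OF alt, of "d # d # K[i := b]" 0 1 e d]
          alternating_swap[OF alt, of "d # e # K[i := b]" 1 "i + 2" b e] i K by simp
      have "g i c p a = (\<Oplus>e b d. hi x c d * hi x p e * hi x a b * f x (e # d # K[i := b]))"
        unfolding g_def by (subst sum3_cycle) (rule refl)
      also have "\<dots> = (\<Oplus>b d e. hi x c d * hi x p e * hi x a b * f x (e # d # K[i := b]))"
        by (subst sum3_cycle) (rule refl)
      finally show ?thesis by (simp add: * g_def mult_ac)
    qed
    have "?C (\<lambda>a b. ?C (\<lambda>c d. \<Oplus>e. Riem x a c e q * f x (d # b # K[i := e])))
        = (\<Oplus>a c p. Rl x a c p q * g i a c p)" for i q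
    proof -
      have "?C (\<lambda>a b. ?C (\<lambda>c d. \<Oplus>e. Riem x a c e q * f x (d # b # K[i := e])))
        = (\<Oplus>a b c d e p. 
            Rl x a c p q * (hi x a b * hi x c d * hi x p e * f x (d # b # K[i := e])))"
        by (simp add: Riem_Rl[OF x] sum_distrib_left sum_distrib_right hi_sym[OF x, of _ p for p] mult_ac)
      also have "\<dots> = (\<Oplus>a c b d e p. 
            Rl x a c p q * (hi x a b * hi x c d * hi x p e * f x (d # b # K[i := e])))"
        by (intro sum.cong refl sum.swap)
      also have "\<dots> = (\<Oplus>a c p b d e. 
            Rl x a c p q * (hi x a b * hi x c d * hi x p e * f x (d # b # K[i := e])))"
      proof (rule sum.cong[OF refl], rule sum.cong[OF refl])
        fix a c
        let ?T = "\<lambda>b d e p. Rl x a c p q * (hi x a b * hi x c d * hi x p e * f x (d # b # K[i := e]))"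
        have "(\<Oplus>b d e p. ?T b d e p) = (\<Oplus>b d p e. ?T b d e p)"
          by (intro sum.cong refl sum.swap)
        also have "\<dots> = (\<Oplus>b p d e. ?T b d e p)"
          by (intro sum.cong refl sum.swap)
        also have "\<dots> = (\<Oplus>p b d e. ?T b d e p)"
          by (rule sum.swap)
        finally show "(\<Oplus>b d e p. ?T b d e p) = (\<Oplus>p b d e. ?T b d e p)" .
      qed
      finally show ?thesis by (simp add: g_def sum_distrib_left)
    qed
    moreover have "(\<Oplus>a c p. Rl x a c p q * g i a c p) = 0" if i: "i < k" for i q
    proof -
      let ?S = "\<Oplus>a c p. Rl x a c p q * g i a c p"
      have 1: "?S = (\<Oplus>a c p. Rl x c p a q * g i a c p)"
        by (subst sum3_cycle) (simp add: g_cycle[OF i])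
      have 2: "?S = (\<Oplus>a c p. Rl x p a c q * g i a c p)"
        unfolding 1 by (subst sum3_cycle) (simp add: g_cycle[OF i])
      have "?S + (\<Oplus>a c p. Rl x c p a q * g i a c p)
          + (\<Oplus>a c p. Rl x p a c q * g i a c p)
        = (\<Oplus>a c p. (Rl x a c p q + Rl x c p a q + Rl x p a c q) * g i a c p)"
        by (simp add: distrib_right sum.distrib)
      then have "?S + ?S + ?S = 0" using 1 2 by (simp add: bianchi1[OF x])
      then show ?thesis by simp
    qed
    moreover have "?C (\<lambda>a b. ?C (\<lambda>c d. \<Sum>i<k. T i a b c d)) = (\<Sum>i<k. ?C (\<lambda>a b. ?C (\<lambda>c d. T i a b c d)))" for T
    proof -
      have C_sum: "?C (\<lambda>a b. \<Sum>i<k. T i a b) = (\<Sum>i<k. ?C (T i))" for T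
        by (rule contract_sum)
      show ?thesis unfolding C_sum ..
    qed
    ultimately show ?thesis by (simp add: act_def K)
  qed
  finally show ?thesis by simp
qed

end

section \<open>Tractor forms in an Einstein scale\<close>

lemma sum_tix:
  fixes f :: "'a::finite tix \<Rightarrow> real"
  shows "(\<Oplus>A. f A) = f TY + f TX + (\<Oplus>c. f (TZ c))"
proof -
  have "(UNIV :: 'a tix set) = {TY, TX} \<union> range TZ"
    by (metis UNIV_eq_I Un_iff insert_iff rangeI tix.exhaust)
  then have "sum f UNIV = sum f ({TY, TX} \<union> range TZ)" by (rule arg_cong[where f = "sum f"])
  also have "\<dots> = sum f {TY, TX} + sum f (range TZ)" by (rule sum.union_disjoint) auto
  also have "sum f (range TZ) = (\<Oplus>c. f (TZ c))" by (subst sum.reindex) (auto intro: injI)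
  finally show ?thesis by simp
qed

lemma sum_off_diagonal_if:
  "(\<Sum>i\<in>{..<m::nat} - {j}. g i) = (\<Sum>i<m. if i = j then 0 else (g i :: real))"
proof (cases "j < m")
  case True
  then show ?thesis by (subst (2) sum.remove[of _ j]) (auto intro: sum.cong)
next
  case False
  then show ?thesis by (auto intro!: sum.cong)
qed

text \<open>
  The negatives of the coefficients with which \<open>theta\<close> sends \<open>Y\<close> and \<open>X\<close> into the \<open>Z\<close> directions.
\<close>

fun xy_weight :: "real \<Rightarrow> 'n tix \<Rightarrow> real" where
  "xy_weight l TY = 1"
| "xy_weight l TX = l"
| "xy_weight l (TZ a) = 0"

text \<open>
  When the \<open>X \<and> Y\<close> component vanishes, so does every value with two entries outside the \<open>Z\<close> directions.
\<close>

lemma alternating_XY: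
  assumes G: "alternating (Suc m) G"
    and XY: "\<And>I. Suc (length I) = m \<Longrightarrow> G (TX # TY # map TZ I) = 0"
    and I: "length I = m" and j: "j < m" and A: "A \<in> {TX, TY}" and B: "B \<in> {TX, TY}"
  shows "G (A # (map TZ I)[j := B]) = 0"
proof (cases "A = B")
  case True
  then show ?thesis
    using alternating_repeat[OF G, of "A # (map TZ I)[j := B]" 0 "Suc j"] I j by simp
next
  case False
  have base: "G (A # B # map TZ J) = 0" if "Suc (length J) = m" for J
    using False A B XY[OF that] alternatingD[OF G, of "TX # TY # map TZ J" 0 1] that by auto
  obtain i K where IK: "I = i # K" using I j by (cases I) auto
  show ?thesis
  proof (cases j)
    case 0
    then show ?thesis using base[of K] I by (simp add: IK)
  next
    case (Suc l)
    have "G (A # B # (map TZ K)[l := TZ i]) = - G (A # TZ i # (map TZ K)[l := B])"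
      using alternating_swap[OF G, of "A # B # map TZ K" 1 "Suc (Suc l)" B "TZ i"] I j Suc by (simp add: IK)
    moreover have "(map TZ K)[l := TZ i] = map TZ (K[l := i])" by (simp add: map_update)
    ultimately show ?thesis using base[of "K[l := i]"] I Suc by (simp add: IK)
  qed
qed

context einstein_patch
begin

definition lam :: real where "lam = kap / 2"

text \<open>
  The tractor connection splits into \<open>om0\<close>, the Levi-Civita connection on the \<open>Z\<close> slots and the trivial
  connection on \<open>X\<close> and \<open>Y\<close>, and the algebraic part \<open>theta\<close>.
\<close>

fun om0 :: "real ^ 'n \<Rightarrow> 'n \<Rightarrow> 'n tix \<Rightarrow> 'n tix \<Rightarrow> real" where
  "om0 x a (TZ b) (TZ c) = - \<Gamma> x c a b"
| "om0 x a _ _ = 0"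

fun theta :: "real ^ 'n \<Rightarrow> 'n \<Rightarrow> 'n tix \<Rightarrow> 'n tix \<Rightarrow> real" where
  "theta x a TY (TZ c) = - (if a = c then 1 else 0)"
| "theta x a (TZ b) TX = h x a b"
| "theta x a (TZ b) TY = lam * h x a b"
| "theta x a TX (TZ c) = - (lam * (if a = c then 1 else 0))"
| "theta x a _ _ = 0"

definition tD :: "(real ^ 'n \<Rightarrow> 'n tix list \<Rightarrow> real) \<Rightarrow> real ^ 'n \<Rightarrow> 'n \<Rightarrow> 'n tix list \<Rightarrow> real" where
  "tD F x a As = pd a (\<lambda>y. F y As) x + act (\<lambda>A B. om0 x a A B + theta x a A B) (F x) As"

definition tLap :: "(real ^ 'n \<Rightarrow> 'n tix list \<Rightarrow> real) \<Rightarrow> real ^ 'n \<Rightarrow> 'n tix list \<Rightarrow> real" where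
  "tLap F x As = (\<Oplus>a b. hi x a b * (pd a (\<lambda>y. tD F y b As) x
     - (\<Oplus>c. \<Gamma> x c a b * tD F x c As) + act (\<lambda>A B. om0 x a A B + theta x a A B) (tD F x b) As))"

definition tD0 :: "(real ^ 'n \<Rightarrow> 'n tix list \<Rightarrow> real) \<Rightarrow> real ^ 'n \<Rightarrow> 'n \<Rightarrow> 'n tix list \<Rightarrow> real" where
  "tD0 F x a As = pd a (\<lambda>y. F y As) x + act (om0 x a) (F x) As"

definition tDD0 :: "(real ^ 'n \<Rightarrow> 'n tix list \<Rightarrow> real) \<Rightarrow> real ^ 'n \<Rightarrow> 'n \<Rightarrow> 'n \<Rightarrow> 'n tix list \<Rightarrow> real" where
  "tDD0 F x a b As = pd a (\<lambda>y. tD0 F y b As) x - (\<Oplus>c. \<Gamma> x c a b * tD0 F x c As) + act (om0 x a) (tD0 F x b) As"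

lemma smooth_om0: "smooth_on U (\<lambda>x. om0 x a A B)"
  by (cases A; cases B) (auto intro: smooth_on_const smooth_minus_\<Gamma>)

lemma smooth_theta: "smooth_on U (\<lambda>x. theta x a A B)"
  by (cases A; cases B) (auto intro: smooth_on_const smooth_h smooth_on_mult open_U)

lemma theta_parallel:
  assumes x: "x \<in> U"
  shows "pd a (\<lambda>y. theta y b A B) x
    + ((\<Oplus>e. om0 x a A e * theta x b e B) - (\<Oplus>e. theta x b A e * om0 x a e B))
    - (\<Oplus>c. \<Gamma> x c a b * theta x c A B) = 0"
proof -
  have hh: "pd a (\<lambda>y. h y b p) x = (\<Oplus>d. \<Gamma> x d a p * h x b d) + (\<Oplus>d. \<Gamma> x d a b * h x d p)" for p
    by (simp add: pd_h[OF x])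
  have "(\<Oplus>c. \<Gamma> x c a b * (lam * h x c p)) = lam * (\<Oplus>c. \<Gamma> x c a b * h x c p)"
    "(\<Oplus>c. \<Gamma> x c a p * (lam * h x b c)) = lam * (\<Oplus>c. \<Gamma> x c a p * h x b c)" for p
    by (simp_all add: sum_distrib_left mult_ac)
  moreover have "(\<Oplus>c. \<Gamma> x c a b * (lam * (if c = p then 1 else 0))) = lam * \<Gamma> x p a b"
    "(\<Oplus>c. (if b = c then 1 else 0) * \<Gamma> x p a c) = \<Gamma> x p a b"
    "(\<Oplus>c. lam * (if b = c then 1 else 0) * \<Gamma> x p a c) = lam * \<Gamma> x p a b" for p
    by (simp_all add: mult.left_commute[of _ lam] mult.assoc flip: sum_distrib_left)
  ultimately show ?thesis
    by (cases A; cases B)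
      (simp_all add: sum_tix pd_cmult smooth_diff[OF smooth_h x] hh sum_negf distrib_left)
qed

text \<open>
  Because \<open>theta\<close> is parallel for \<open>om0\<close>, the mixed second-order terms combine to twice \<open>theta\<close> acting on
  the \<open>om0\<close>-derivative.
\<close>

lemma tLap_split:
  assumes F: "smooth_field k F" and x: "x \<in> U" and As: "length As = k"
  shows "tLap F x As = (\<Oplus>a b. hi x a b * tDD0 F x a b As)
    + 2 * (\<Oplus>a b. hi x a b * act (theta x a) (tD0 F x b) As)
    + (\<Oplus>a b. hi x a b * act (theta x a) (act (theta x b) (F x)) As)"
proof -
  have tD: "tD F y b Bs = tD0 F y b Bs + act (theta y b) (F y) Bs" for y b Bs
    by (simp add: tD_def tD0_def act_mat_add)
  have F': "smooth_field (length As) F" using F As by simp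
  have *: "pd a (\<lambda>y. tD F y b As) x - (\<Oplus>c. \<Gamma> x c a b * tD F x c As)
      + act (\<lambda>A B. om0 x a A B + theta x a A B) (tD F x b) As
    = tDD0 F x a b As + act (theta x b) (tD0 F x a) As + act (theta x a) (tD0 F x b) As
      + act (theta x a) (act (theta x b) (F x)) As" for a b
  proof -
    have "pd a (\<lambda>y. tD F y b As) x = pd a (\<lambda>y. tD0 F y b As) x + pd a (\<lambda>y. act (theta y b) (F y) As) x"
      unfolding tD tD0_def using x smooth_fieldD[OF F As]
      by (intro pd_add smooth_diff[OF _ x] smooth_on_add open_U smooth_on_pd smooth_act smooth_om0 smooth_theta F')
    also have "pd a (\<lambda>y. act (theta y b) (F y) As) x
        = act (\<lambda>A B. pd a (\<lambda>y. theta y b A B) x) (F x) As + act (theta x b) (\<lambda>J. pd a (\<lambda>y. F y J) x) As"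
      by (rule pd_act[OF smooth_theta F' x])
    finally have 1: "pd a (\<lambda>y. tD F y b As) x = pd a (\<lambda>y. tD0 F y b As) x
      + act (\<lambda>A B. pd a (\<lambda>y. theta y b A B) x) (F x) As + act (theta x b) (\<lambda>J. pd a (\<lambda>y. F y J) x) As" by simp
    have 2: "act (om0 x a) (act (theta x b) (F x)) As = act (theta x b) (act (om0 x a) (F x)) As
        + act (\<lambda>A B. (\<Oplus>e. om0 x a A e * theta x b e B) - (\<Oplus>e. theta x b A e * om0 x a e B)) (F x) As"
      using act_commutator[of "om0 x a" "theta x b" "F x" As] by simp
    have 3: "(\<Oplus>c. \<Gamma> x c a b * act (theta x c) (F x) As) = act (\<lambda>A B. \<Oplus>c. \<Gamma> x c a b * theta x c A B) (F x) As"
      by (simp add: act_mat_sum act_mat_cmult)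
    have "act (\<lambda>A B. pd a (\<lambda>y. theta y b A B) x) (F x) As
        + act (\<lambda>A B. (\<Oplus>e. om0 x a A e * theta x b e B) - (\<Oplus>e. theta x b A e * om0 x a e B)) (F x) As
        - act (\<lambda>A B. \<Oplus>c. \<Gamma> x c a b * theta x c A B) (F x) As = 0"
      unfolding act_mat_add[symmetric] act_mat_diff[symmetric] theta_parallel[OF x] by (simp add: act_def)
    moreover have "act (theta x b) (tD0 F x a) As
      = act (theta x b) (\<lambda>J. pd a (\<lambda>y. F y J) x) As + act (theta x b) (act (om0 x a) (F x)) As"
      by (simp add: tD0_def[abs_def] act_add)
    ultimately show ?thesis
      unfolding 1 unfolding act_mat_add tD[abs_def] act_add distrib_left sum.distrib 2 3 tDD0_def by simp
  qed
  have "(\<Oplus>a b. hi x a b * act (theta x b) (tD0 F x a) As)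
      = (\<Oplus>b a. hi x b a * act (theta x b) (tD0 F x a) As)"
    by (subst sum.swap) (intro sum.cong refl, subst hi_sym[OF x], simp)
  then show ?thesis unfolding tLap_def * by (simp add: distrib_left sum.distrib)
qed

text \<open>
  The component of a tractor form whose first slots are \<open>P\<close> and whose other slots are \<open>Z\<close>. Slots \<open>X\<close> and
  \<open>Y\<close> are invisible to \<open>om0\<close>, so that its derivatives are Levi-Civita derivatives of components.
\<close>

definition comp :: "'n tix list \<Rightarrow> (real ^ 'n \<Rightarrow> 'n tix list \<Rightarrow> real) \<Rightarrow> real ^ 'n \<Rightarrow> 'n list \<Rightarrow> real" where
  "comp P F x I = F x (P @ map TZ I)"

lemma smooth_field_comp: "smooth_field k F \<Longrightarrow> k = length P + m \<Longrightarrow> smooth_field m (comp P F)"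
  by (simp add: smooth_field_def comp_def)

lemma act_om0:
  "set P \<subseteq> {TX, TY} \<Longrightarrow> act (om0 x b) G (P @ map TZ I) = act (\<lambda>i c. - \<Gamma> x c b i) (\<lambda>J. G (P @ map TZ J)) I"
proof (induction P arbitrary: G)
  case Nil
  show ?case by (simp add: act_def sum_tix map_update)
next
  case (Cons A P)
  then have "(\<Oplus>B. om0 x b A B * G (B # P @ map TZ I)) = 0" by (auto simp: sum_tix)
  then show ?case using Cons.IH[of "\<lambda>J. G (A # J)"] Cons.prems by (simp add: act_Cons)
qed

lemma tD0_comp:
  "set P \<subseteq> {TX, TY} \<Longrightarrow> tD0 F x b (P @ map TZ I) = D (comp P F) x (b # I)"
  by (simp add: tD0_def D_Cons act_om0) (simp add: comp_def[abs_def])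

lemma tDD0_comp:
  "set P \<subseteq> {TX, TY} \<Longrightarrow> tDD0 F x a b (P @ map TZ I) = D (D (comp P F)) x (a # b # I)"
  by (simp add: tDD0_def D_Cons[of "D (comp P F)"] act_Cons act_om0 tD0_comp sum_negf)

lemma act_theta_cons:
  assumes "A \<in> {TX, TY}"
  shows "act (theta x b) G (A # L) = - (xy_weight lam A * G (TZ b # L)) + act (theta x b) (\<lambda>J. G (A # J)) L"
proof -
  have "(\<Oplus>B. theta x b A B * G (B # L)) = - (xy_weight lam A * G (TZ b # L))"
    using assms by (auto simp: sum_tix sum_negf mult.assoc simp flip: sum_distrib_left)
  then show ?thesis by (simp add: act_Cons)
qed

lemma act_theta_Z:
  "act (theta x b) G (map TZ I) = (\<Sum>j<length I. h x b (I ! j) * (G ((map TZ I)[j := TX]) + lam * G ((map TZ I)[j := TY])))"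
  by (simp add: act_def sum_tix algebra_simps)

lemma act_theta_ZZ:
  assumes G: "alternating (Suc m) G" and K: "length K = m"
  defines "V \<equiv> \<lambda>J. G (TX # map TZ J) + lam * G (TY # map TZ J)"
  shows "act (theta x b) G (map TZ (a # K)) = h x b a * V K - (\<Sum>j<m. h x b (K ! j) * V (K[j := a]))"
proof -
  have "G (TZ a # (map TZ K)[j := B]) = - G (B # map TZ (K[j := a]))" if "j < m" for j B
    using alternating_cons_swap[OF G, of "map TZ K" j "TZ a" B] K that by (simp add: map_update)
  then have "(\<Sum>j<m. h x b (K ! j) * (G (TZ a # (map TZ K)[j := TX]) + lam * G (TZ a # (map TZ K)[j := TY])))
      = - (\<Sum>j<m. h x b (K ! j) * V (K[j := a]))"
    by (simp add: V_def sum_negf algebra_simps sum_subtractf sum.distrib)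
  then show ?thesis
    unfolding act_theta_Z using K by (simp only: list.size add_Suc_right add_0_right sum.lessThan_Suc_shift)
      (simp add: V_def)
qed

lemma act_theta_AZ:
  assumes G: "alternating (Suc m) G"
    and XY: "\<And>I. Suc (length I) = m \<Longrightarrow> G (TX # TY # map TZ I) = 0"
    and I: "length I = m" and A: "A \<in> {TX, TY}"
  shows "act (theta x b) G (A # map TZ I) = - (xy_weight lam A * G (TZ b # map TZ I))"
proof -
  have "act (theta x b) (\<lambda>J. G (A # J)) (map TZ I) = 0"
    unfolding act_theta_Z using alternating_XY[OF G XY I _ A] I by simp
  then show ?thesis by (simp add: act_theta_cons[OF A])
qed

lemma alternating_three:
  assumes G: "alternating k G" and I: "length I = k" and ij: "i < k" "j < k" "l < k" "i \<noteq> j" "i \<noteq> l" "j \<noteq> l"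
    and XY: "I ! i \<in> {TX, TY}" "I ! j \<in> {TX, TY}" "I ! l \<in> {TX, TY}"
  shows "G I = 0"
proof -
  have "I ! i = I ! j \<or> I ! i = I ! l \<or> I ! j = I ! l" using XY by auto
  then show ?thesis using alternating_repeat[OF G I] ij by metis
qed

lemma act_theta_AZB:
  assumes G: "alternating (Suc m) G"
    and I: "length I = m" and j: "j < m" and A: "A \<in> {TX, TY}" and B: "B \<in> {TX, TY}"
  shows "act (theta x b) G (A # (map TZ I)[j := B])
    = xy_weight lam A * G (B # map TZ (I[j := b])) - xy_weight lam B * G (A # map TZ (I[j := b]))"
proof -
  have 1: "G (TZ b # (map TZ I)[j := B]) = - G (B # map TZ (I[j := b]))"
    using alternating_cons_swap[OF G, of "map TZ I" j "TZ b" B] I j by (simp add: map_update)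
  have 2: "G (A # (map TZ I)[j := B, i := C]) = 0" if "i < m" "i \<noteq> j" "C \<in> {TX, TY}" for i C
    using that I j A B
    by (intro alternating_three[OF G, of _ 0 "Suc i" "Suc j"]) auto
  have "(\<Sum>i\<in>{..<m} - {j}. \<Oplus>C. theta x b (map TZ I ! i) C * G (A # (map TZ I)[j := B, i := C])) = 0"
  proof (intro sum.neutral ballI)
    fix i C assume "i \<in> {..<m} - {j}"
    then show "theta x b (map TZ I ! i) C * G (A # (map TZ I)[j := B, i := C]) = 0"
      using I 2[of i C] by (cases C) auto
  qed
  moreover have "(\<Oplus>C. theta x b B C * G (A # (map TZ I)[j := C])) = - (xy_weight lam B * G (A # map TZ (I[j := b])))"
    using B by (auto simp: sum_tix sum_negf mult.assoc map_update simp flip: sum_distrib_left)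
  ultimately have "act (theta x b) (\<lambda>J. G (A # J)) ((map TZ I)[j := B]) = - (xy_weight lam B * G (A # map TZ (I[j := b])))"
    using I j by (subst act_replace) auto
  then show ?thesis by (simp add: act_theta_cons[OF A] 1)
qed

end

fun tix_lift :: "('n \<Rightarrow> 'n \<Rightarrow> 'n \<Rightarrow> 'n \<Rightarrow> real) \<Rightarrow> 'n tix \<Rightarrow> 'n tix \<Rightarrow> 'n tix \<Rightarrow> 'n tix \<Rightarrow> real" where
  "tix_lift W (TZ a) (TZ b) (TZ c) (TZ d) = W a b c d"
| "tix_lift W _ _ _ _ = 0"

context levi_civita
begin

lemma alternating_pd:
  fixes F :: "real ^ 'n \<Rightarrow> 'i list \<Rightarrow> real"
  assumes F: "smooth_field k F" "\<And>y. y \<in> U \<Longrightarrow> alternating k (F y)" and x: "x \<in> U"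
  shows "alternating k (\<lambda>I. pd a (\<lambda>y. F y I) x)"
  unfolding alternating_def
proof (intro allI impI)
  fix I :: "'i list" and i j assume *: "length I = k" "i < k" "j < k" "i \<noteq> j"
  have "pd a (\<lambda>y. F y (I[i := I ! j, j := I ! i])) x = pd a (\<lambda>y. - F y I) x"
    by (rule pd_cong[OF open_U x]) (rule alternatingD[OF F(2) *])
  then show "pd a (\<lambda>y. F y (I[i := I ! j, j := I ! i])) x = - pd a (\<lambda>y. F y I) x"
    using pd_minus[OF smooth_field_differentiable[OF F(1) *(1) x]] by simp
qed

lemma contract_h:
  assumes "x \<in> U"
  shows "(\<Oplus>a b. hi x a b * (h x a c * v b)) = v c"
proof -
  have "(\<Oplus>a b. hi x a b * (h x a c * v b)) = (\<Oplus>b a. hi x a b * (h x a c * v b))"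
    by (rule sum.swap)
  also have "\<dots> = (\<Oplus>b. (\<Oplus>a. hi x b a * h x a c) * v b)"
    using assms by (simp add: sum_distrib_right hi_sym[of x _ b for b] mult.assoc)
  finally show ?thesis by (simp only: hi_h[OF assms] sum_delta_mult)
qed

lemma D_zero:
  assumes "\<And>y J. y \<in> U \<Longrightarrow> length J = length I \<Longrightarrow> f y J = 0" "x \<in> U"
  shows "D f x (a # I) = 0"
proof -
  have "D f x (a # I) = D (\<lambda>y J. 0) x (a # I)" by (rule D_cong) (use assms in auto)
  then show ?thesis by (simp add: D_Cons act_def)
qed

lemma extd_zero:
  assumes "\<And>y J. y \<in> U \<Longrightarrow> Suc (length J) = length I \<Longrightarrow> f y J = 0" "x \<in> U"
  shows "extd f x I = 0"
proof (cases I)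
  case (Cons a K)
  then show ?thesis using assms by (simp add: extd_Cons D_zero)
qed simp

lemma codf_zero:
  assumes "\<And>y J. y \<in> U \<Longrightarrow> length J = Suc (length I) \<Longrightarrow> f y J = 0" "x \<in> U"
  shows "codf f x I = 0"
  using assms by (simp add: codf_def D_zero)

lemma form_lin: "form k f \<Longrightarrow> form k g \<Longrightarrow> form k (\<lambda>y J. r * f y J + s * g y J)"
  unfolding form_def by (auto intro!: smooth_field_add smooth_field_cmult alternating_add alternating_cmult)

lemma D_lin:
  assumes "smooth_field k f" "smooth_field k g" "x \<in> U" "length I = k"
  shows "D (\<lambda>y J. r * f y J + s * g y J) x (a # I) = r * D f x (a # I) + s * D g x (a # I)"
  using assms by (simp add: D_add[OF smooth_field_cmult smooth_field_cmult] D_cmult)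

lemma codf_lin:
  assumes "smooth_field (Suc k) f" "smooth_field (Suc k) g" "x \<in> U" "length I = k"
  shows "codf (\<lambda>y J. r * f y J + s * g y J) x I = r * codf f x I + s * codf g x I"
  unfolding codf_def using assms
  by (simp add: D_lin distrib_left sum.distrib sum_distrib_left mult.left_commute)

lemma extd_lin:
  assumes "smooth_field k f" "smooth_field k g" "x \<in> U" "length I = Suc k"
  shows "extd (\<lambda>y J. r * f y J + s * g y J) x I = r * extd f x I + s * extd g x I"
proof -
  obtain a K where I: "I = a # K" "length K = k" using assms by (cases I) auto
  then show ?thesis
    using assms by (simp add: extd_Cons D_lin
        distrib_left sum.distrib sum_distrib_left right_diff_distrib)
qed

lemma Lap_lin:
  assumes "smooth_field k f" "smooth_field k g" "x \<in> U" "length I = k"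
  shows "Lap (\<lambda>y J. r * f y J + s * g y J) x I = r * Lap f x I + s * Lap g x I"
proof -
  have "D (D (\<lambda>y J. r * f y J + s * g y J)) x (a # b # I) = r * D (D f) x (a # b # I) + s * D (D g) x (a # b # I)" for a b
  proof -
    have "D (D (\<lambda>y J. r * f y J + s * g y J)) x (a # b # I) = D (\<lambda>y J. r * D f y J + s * D g y J) x (a # b # I)"
    proof (rule D_cong[OF _ assms(3)])
      fix y and J :: "'n list" assume y: "y \<in> U" and "length J = length (b # I)"
      then obtain c K where J: "J = c # K" "length K = k" using assms(4) by (cases J) auto
      show "D (\<lambda>y J. r * f y J + s * g y J) y J = r * D f y J + s * D g y J"
        using assms y J by (simp add: D_lin)
    qed
    then show ?thesis
      using assms smooth_field_D[OF assms(1)] smooth_field_D[OF assms(2)]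
      by (simp add: D_lin)
  qed
  then show ?thesis by (simp add: Lap_def distrib_left sum.distrib sum_distrib_left mult.left_commute)
qed

end

context einstein_patch
begin

lemma weyl_action_lin: "weyl_action (\<lambda>y J. r * f y J + s * g y J) x I = r * weyl_action f x I + s * weyl_action g x I"
  by (simp add: weyl_action_def distrib_left sum.distrib sum_distrib_left mult.left_commute add_divide_distrib)

lemma two_lam: "2 * lam = kap"
  by (simp add: lam_def)

definition tractor_form :: "nat \<Rightarrow> (real ^ 'n \<Rightarrow> 'n tix list \<Rightarrow> real) \<Rightarrow> bool" where
  "tractor_form k F \<longleftrightarrow> smooth_field k F \<and> (\<forall>x\<in>U. alternating k (F x))
    \<and> (\<forall>x\<in>U. \<forall>I. Suc (Suc (length I)) = k \<longrightarrow> F x (TX # TY # map TZ I) = 0)"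

lemma tractor_formD:
  assumes "tractor_form k F"
  shows "smooth_field k F" "x \<in> U \<Longrightarrow> alternating k (F x)"
    "x \<in> U \<Longrightarrow> Suc (Suc (length I)) = k \<Longrightarrow> F x (TX # TY # map TZ I) = 0"
  using assms by (auto simp: tractor_form_def)

text \<open>
  In the frame \<open>Z\<close>, \<open>X\<close>, \<open>Y - lam X\<close>, whose last member is parallel, this is the coefficient of \<open>X\<close>. The
  factor 1 gives it the shape of the linear combinations in \<open>D_lin\<close>, \<open>codf_lin\<close> and \<open>extd_lin\<close>.
\<close>

abbreviation b_comp :: "(real ^ 'n \<Rightarrow> 'n tix list \<Rightarrow> real) \<Rightarrow> real ^ 'n \<Rightarrow> 'n list \<Rightarrow> real" where
  "b_comp F \<equiv> (\<lambda>x I. 1 * comp [TX] F x I + lam * comp [TY] F x I)"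

lemma form_comp_Z:
  assumes F: "tractor_form k F"
  shows "form k (comp [] F)"
  unfolding form_def
proof (intro conjI ballI)
  show "smooth_field k (comp [] F)" by (rule smooth_field_comp[OF tractor_formD(1)[OF F]]) simp
  fix x assume "x \<in> U"
  from alternating_map[OF tractor_formD(2)[OF F this]] show "alternating k (comp [] F x)"
    unfolding comp_def[abs_def] by simp
qed

lemma form_comp_A:
  assumes F: "tractor_form (Suc m) F"
  shows "form m (comp [A] F)"
  unfolding form_def
proof (intro conjI ballI)
  show "smooth_field m (comp [A] F)" by (rule smooth_field_comp[OF tractor_formD(1)[OF F]]) simp
  fix x assume "x \<in> U"
  from alternating_map[OF alternating_tail[OF tractor_formD(2)[OF F this]]] show "alternating m (comp [A] F x)"
    unfolding comp_def[abs_def] by simp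
qed

lemma form_b_comp: "tractor_form (Suc m) F \<Longrightarrow> form m (b_comp F)"
  by (intro form_lin form_comp_A)

lemma tD0_alternating:
  assumes "tractor_form k F" "x \<in> U"
  shows "alternating k (tD0 F x b)"
  unfolding tD0_def[abs_def] using tractor_formD[OF assms(1)] assms(2)
  by (intro alternating_add act_alternating alternating_pd) auto

lemma tD0_XY:
  assumes "tractor_form k F" "x \<in> U" "Suc (Suc (length I)) = k"
  shows "tD0 F x b (TX # TY # map TZ I) = 0"
proof -
  have "tD0 F x b ([TX, TY] @ map TZ I) = D (comp [TX, TY] F) x (b # I)" by (rule tD0_comp) auto
  also have "\<dots> = 0"
    by (rule D_zero) (use tractor_formD(3)[OF assms(1)] assms in \<open>auto simp: comp_def\<close>)
  finally show ?thesis by simp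
qed

lemma contract_theta_Z:
  assumes x: "x \<in> U" and G: "\<And>b. alternating (Suc m) (G b)" and I: "length I = Suc m"
    and V: "\<And>b J. length J = m \<Longrightarrow> G b (TX # map TZ J) + lam * G b (TY # map TZ J) = V b J"
  shows "(\<Oplus>a b. hi x a b * act (theta x a) (G b) (map TZ I))
    = V (hd I) (tl I) - (\<Sum>j<m. V (tl I ! j) ((tl I)[j := hd I]))"
proof -
  obtain c K where IK: "I = c # K" "length K = m" using I by (cases I) auto
  have "(\<Oplus>a b. hi x a b * act (theta x a) (G b) (map TZ I))
    = (\<Oplus>a b. hi x a b * (h x a c * V b K))
      - (\<Oplus>a b. hi x a b * (\<Sum>j<m. h x a (K ! j) * V b (K[j := c])))"
    unfolding IK(1) act_theta_ZZ[OF G IK(2)] using IK(2)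
    by (simp add: V right_diff_distrib sum_subtractf)
  also have "\<dots> = V c K - (\<Sum>j<m. V (K ! j) (K[j := c]))"
    unfolding contract_sum contract_h[OF x] ..
  finally show ?thesis by (simp add: IK)
qed

text \<open>
  The first-order term is \<open>theta\<close> feeding the \<open>X\<close> and \<open>Y\<close> components into one \<open>Z\<close> slot, that is, an
  exterior derivative; the algebraic term returns each of the \<open>m + 1\<close> slots to itself.
\<close>

lemma tLap_Z:
  assumes F: "tractor_form (Suc m) F" and x: "x \<in> U" and I: "length I = Suc m"
  shows "tLap F x (map TZ I) = Lap (comp [] F) x I + 2 * extd (b_comp F) x I - kap * (real m + 1) * comp [] F x I"
proof -
  note F' = tractor_formD[OF F]
  obtain c K where IK: "I = c # K" "length K = m" using I by (cases I) auto
  have c2: "xy_weight lam TX + lam * xy_weight lam TY = kap" by (simp add: lam_def)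
  have E: "(\<Oplus>a b. hi x a b * tDD0 F x a b (map TZ I)) = Lap (comp [] F) x I"
    using tDD0_comp[of "[]" F x _ _ I] by (simp add: Lap_def)
  have DV: "tD0 F x b (TX # map TZ J) + lam * tD0 F x b (TY # map TZ J) = D (b_comp F) x (b # J)" if J: "length J = m" for b J
    using tD0_comp[of "[TX]" F x b J] tD0_comp[of "[TY]" F x b J]
      D_lin[OF formD(1)[OF form_comp_A[OF F]] formD(1)[OF form_comp_A[OF F]] x J, where r = 1 and s = lam and a = b]
    by simp
  have 1: "(\<Oplus>a b. hi x a b * act (theta x a) (tD0 F x b) (map TZ I)) = extd (b_comp F) x I"
    using contract_theta_Z[OF x tD0_alternating[OF F x] I DV] by (simp add: IK extd_Cons)
  have tV: "act (theta x b) (F x) (TX # map TZ J) + lam * act (theta x b) (F x) (TY # map TZ J) = - kap * F x (TZ b # map TZ J)"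
    if J: "length J = m" for b J
    using act_theta_AZ[OF F'(2)[OF x] F'(3)[OF x] J, where A = TX and x = x and b = b] act_theta_AZ[OF F'(2)[OF x] F'(3)[OF x] J, where A = TY and x = x and b = b] c2
    by (simp add: lam_def)
  have "F x (TZ (K ! j) # map TZ (K[j := c])) = - F x (map TZ I)" if "j < m" for j
    using alternating_cons_swap[OF F'(2)[OF x], of "map TZ K" j "TZ (K ! j)" "TZ c"] that IK by (simp flip: map_update)
  then have 2: "(\<Oplus>a b. hi x a b * act (theta x a) (act (theta x b) (F x)) (map TZ I)) = - kap * (real m + 1) * F x (map TZ I)"
    using contract_theta_Z[where G = "\<lambda>b. act (theta x b) (F x)" and V = "\<lambda>b J. - kap * F x (TZ b # map TZ J)",
        OF x act_alternating[OF F'(2)[OF x]] I tV] by (simp add: IK algebra_simps)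
  have "length (map TZ I) = Suc m" using I by simp
  from tLap_split[OF F'(1) x this] show ?thesis unfolding E 1 2 by (simp add: comp_def algebra_simps)
qed

text \<open>
  Here \<open>theta\<close> turns the slot \<open>A\<close> into a \<open>Z\<close> slot, which is contracted with the derivative. In the
  algebraic term the slot \<open>A\<close> alone gives \<open>n\<close>, and its exchanges with the \<open>m\<close> other slots, which occur in
  both orders, give \<open>- 2 m\<close>.
\<close>

lemma tLap_A:
  assumes F: "tractor_form (Suc m) F" and x: "x \<in> U" and I: "length I = m" and A: "A \<in> {TX, TY}"
  shows "tLap F x (A # map TZ I) = Lap (comp [A] F) x I + 2 * xy_weight lam A * codf (comp [] F) x I
    - xy_weight lam A * (real CARD('n) - 2 * real m) * b_comp F x I - kap * real m * comp [A] F x I"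
proof -
  note F' = tractor_formD[OF F]
  let ?c = "xy_weight lam A" and ?C = "\<lambda>T. \<Oplus>a b. hi x a b * T a b :: real"
  define V where "V J = F x (TX # map TZ J) + lam * F x (TY # map TZ J)" for J
  have c2: "xy_weight lam TX + lam * xy_weight lam TY = kap" by (simp add: lam_def)
  have E: "?C (\<lambda>a b. tDD0 F x a b (A # map TZ I)) = Lap (comp [A] F) x I"
    using tDD0_comp[of "[A]" F x _ _ I] A by (simp add: Lap_def)
  have 1: "?C (\<lambda>a b. act (theta x a) (tD0 F x b) (A # map TZ I)) = ?c * codf (comp [] F) x I"
  proof -
    have "act (theta x a) (tD0 F x b) (A # map TZ I) = - (?c * D (comp [] F) x (b # a # I))" for a b
      using act_theta_AZ[OF tD0_alternating[OF F x] tD0_XY[OF F x] I A, where x = x] tD0_comp[of "[]" F x b "a # I"] by simp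
    then have "?C (\<lambda>a b. act (theta x a) (tD0 F x b) (A # map TZ I)) = - ?c * ?C (\<lambda>a b. D (comp [] F) x (b # a # I))"
      by (simp add: sum_distrib_left sum_negf mult.left_commute)
    also have "?C (\<lambda>a b. D (comp [] F) x (b # a # I)) = ?C (\<lambda>b a. D (comp [] F) x (b # a # I))"
      by (subst sum.swap) (intro sum.cong refl, subst hi_sym[OF x], simp)
    finally show ?thesis by (simp add: codf_def)
  qed
  have 2: "?C (\<lambda>a b. act (theta x a) (act (theta x b) (F x)) (A # map TZ I))
      = - ?c * (real CARD('n) - 2 * real m) * V I - kap * real m * F x (A # map TZ I)"
  proof -
    have a1: "act (theta x b) (F x) (TZ a # map TZ I) = h x a b * V I - (\<Sum>j<m. h x (I ! j) b * V (I[j := a]))" for a b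
      using act_theta_ZZ[OF F'(2)[OF x] I, where x = x and b = b and a = a] unfolding V_def[symmetric] by (simp add: h_sym[OF x, of b])
    have a2: "act (theta x b) (F x) (A # (map TZ I)[j := TX]) + lam * act (theta x b) (F x) (A # (map TZ I)[j := TY])
        = ?c * V (I[j := b]) - kap * F x (A # map TZ (I[j := b]))" if "j < m" for j b
    proof -
      have e: "act (theta x b) (F x) (A # (map TZ I)[j := B])
          = ?c * F x (B # map TZ (I[j := b])) - xy_weight lam B * F x (A # map TZ (I[j := b]))" if "B \<in> {TX, TY}" for B
        using act_theta_AZB[OF F'(2)[OF x] I \<open>j < m\<close> A that] .
      show ?thesis
        unfolding e[OF insertI1] e[OF insertI2[OF singletonI]] V_def by (simp add: distrib_left right_diff_distrib two_lam)
    qed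
    have "act (theta x a) (act (theta x b) (F x)) (A # map TZ I)
        = - (?c * (h x a b * V I - (\<Sum>j<m. h x (I ! j) b * V (I[j := a]))))
          + (\<Sum>j<m. h x a (I ! j) * (?c * V (I[j := b]) - kap * F x (A # map TZ (I[j := b]))))" for a b
      unfolding act_theta_cons[OF A, where G = "act (theta x b) (F x)" and L = "map TZ I"] act_theta_Z a1
      using I by (simp add: a2)
    then have "?C (\<lambda>a b. act (theta x a) (act (theta x b) (F x)) (A # map TZ I))
      = - ?c * (?C (\<lambda>a b. h x a b * V I) - ?C (\<lambda>a b. \<Sum>j<m. h x (I ! j) b * V (I[j := a])))
        + ?C (\<lambda>a b. \<Sum>j<m. h x a (I ! j) * (?c * V (I[j := b]) - kap * F x (A # map TZ (I[j := b]))))"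
      by (simp add: distrib_left right_diff_distrib sum.distrib sum_subtractf sum_negf sum_distrib_left mult.left_commute)
    also have "?C (\<lambda>a b. h x a b * V I) = real CARD('n) * V I"
    proof -
      have "?C (\<lambda>a b. h x a b * V I) = (\<Oplus>a. (\<Oplus>b. hi x a b * h x b a) * V I)"
        by (simp add: sum_distrib_right mult.assoc h_sym[OF x])
      then show ?thesis by (simp add: hi_h[OF x])
    qed
    also have "?C (\<lambda>a b. \<Sum>j<m. h x (I ! j) b * V (I[j := a])) = real m * V I"
    proof -
      have "?C (\<lambda>a b. h x (I ! j) b * V (I[j := a])) = V I" if "j < m" for j
      proof -
        have "?C (\<lambda>a b. h x (I ! j) b * V (I[j := a])) = (\<Oplus>a. (\<Oplus>b. hi x a b * h x b (I ! j)) * V (I[j := a]))"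
          by (simp add: sum_distrib_right mult.assoc h_sym[OF x, of "I ! j"])
        then show ?thesis by (simp only: hi_h[OF x] sum_delta_mult list_update_id)
      qed
      then show ?thesis by (simp add: contract_sum)
    qed
    also have "?C (\<lambda>a b. \<Sum>j<m. h x a (I ! j) * (?c * V (I[j := b]) - kap * F x (A # map TZ (I[j := b]))))
        = real m * (?c * V I - kap * F x (A # map TZ I))"
      unfolding contract_sum contract_h[OF x] by simp
    finally show ?thesis by (simp add: algebra_simps)
  qed
  have "length (A # map TZ I) = Suc m" using I by simp
  from tLap_split[OF F'(1) x this] show ?thesis unfolding E 1 2 by (simp add: comp_def V_def algebra_simps)
qed

text \<open>
  The only possible source of an \<open>X \<and> Y\<close> component is the divergence of the \<open>X\<close> and \<open>Y\<close> components.
\<close>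

lemma tLap_XY:
  assumes F: "tractor_form (Suc (Suc r)) F" and x: "x \<in> U" and I: "length I = r"
    and cA: "\<And>A y J. A \<in> {TX, TY} \<Longrightarrow> y \<in> U \<Longrightarrow> length J = r \<Longrightarrow> codf (comp [A] F) y J = 0"
  shows "tLap F x (TX # TY # map TZ I) = 0"
proof -
  note F' = tractor_formD[OF F]
  let ?C = "\<lambda>T. \<Oplus>a b. hi x a b * T a b :: real"
  have act2: "act (theta x a) G (TX # TY # map TZ I) = lam * G (TY # map TZ (a # I)) - G (TX # map TZ (a # I))"
    if G: "alternating (Suc (Suc r)) G" for G a
  proof -
    have "act (theta x a) (\<lambda>J. G (TX # TY # J)) (map TZ I) = 0"
    proof -
      have "G (TX # TY # (map TZ I)[j := B]) = 0" if "j < r" "B \<in> {TX, TY}" for j B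
        using that I by (intro alternating_three[OF G, of _ 0 1 "Suc (Suc j)"]) auto
      then show ?thesis unfolding act_theta_Z using I by simp
    qed
    moreover have "G (TZ a # TY # map TZ I) = - G (TY # TZ a # map TZ I)"
      using alternatingD[OF G, of "TY # TZ a # map TZ I" 0 1] I by simp
    moreover have "act (theta x a) (\<lambda>J. G (TX # J)) (TY # map TZ I)
        = - (xy_weight lam (TY :: 'n tix) * G (TX # TZ a # map TZ I)) + act (theta x a) (\<lambda>J. G (TX # TY # J)) (map TZ I)"
      by (rule act_theta_cons[where G = "\<lambda>J. G (TX # J)"]) simp
    moreover have "act (theta x a) G (TX # TY # map TZ I)
        = - (xy_weight lam (TX :: 'n tix) * G (TZ a # TY # map TZ I)) + act (theta x a) (\<lambda>J. G (TX # J)) (TY # map TZ I)"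
      by (rule act_theta_cons) simp
    ultimately show ?thesis by simp
  qed
  have E: "?C (\<lambda>a b. tDD0 F x a b (TX # TY # map TZ I)) = 0"
  proof -
    have "D (D (comp [TX, TY] F)) x (a # b # I) = 0" for a b
    proof (rule D_zero[OF _ x])
      fix y and J :: "'n list" assume y: "y \<in> U" and "length J = length (b # I)"
      then obtain d K where J: "J = d # K" "length K = r" using I by (cases J) auto
      show "D (comp [TX, TY] F) y J = 0"
        unfolding J using J F'(3) by (intro D_zero y) (auto simp: comp_def)
    qed
    then show ?thesis using tDD0_comp[of "[TX, TY]" F x _ _ I] by simp
  qed
  have 1: "?C (\<lambda>a b. act (theta x a) (tD0 F x b) (TX # TY # map TZ I)) = 0"
  proof -
    have "act (theta x a) (tD0 F x b) (TX # TY # map TZ I)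
        = lam * D (comp [TY] F) x (b # a # I) - D (comp [TX] F) x (b # a # I)" for a b
      using act2[OF tD0_alternating[OF F x], of a b] tD0_comp[of "[TY]" F x b "a # I"] tD0_comp[of "[TX]" F x b "a # I"] by simp
    then have "?C (\<lambda>a b. act (theta x a) (tD0 F x b) (TX # TY # map TZ I))
        = lam * ?C (\<lambda>a b. D (comp [TY] F) x (b # a # I)) - ?C (\<lambda>a b. D (comp [TX] F) x (b # a # I))"
      by (simp add: right_diff_distrib sum_subtractf sum_distrib_left mult.left_commute)
    moreover have "?C (\<lambda>a b. D (comp [A] F) x (b # a # I)) = - codf (comp [A] F) x I" for A
      unfolding codf_def by (subst sum.swap) (simp, intro sum.cong refl, subst hi_sym[OF x], simp)
    ultimately show ?thesis using cA x I by simp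
  qed
  have 2: "act (theta x a) (act (theta x b) (F x)) (TX # TY # map TZ I) = 0" for a b
  proof -
    have l: "length (a # I) = Suc r" using I by simp
    show ?thesis
      unfolding act2[OF act_alternating[OF F'(2)[OF x]]]
      using act_theta_AZ[OF F'(2)[OF x] F'(3)[OF x] l, where A = TX and x = x and b = b] act_theta_AZ[OF F'(2)[OF x] F'(3)[OF x] l, where A = TY and x = x and b = b]
      by simp
  qed
  have "length (TX # TY # map TZ I) = Suc (Suc r)" using I by simp
  from tLap_split[OF F'(1) x this] show ?thesis unfolding E 1 2 by simp
qed

lemma smooth_field_tD: "smooth_field k F \<Longrightarrow> smooth_field k (\<lambda>x. tD F x b)"
  unfolding smooth_field_def[of k "\<lambda>x. tD F x b"] tD_def
  by (intro allI impI smooth_on_add open_U smooth_on_pd smooth_act smooth_om0 smooth_theta) (auto simp: smooth_field_def)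

lemma alternating_tD:
  assumes "smooth_field k F" "\<And>y. y \<in> U \<Longrightarrow> alternating k (F y)" "x \<in> U"
  shows "alternating k (tD F x b)"
  unfolding tD_def[abs_def] using assms by (intro alternating_add act_alternating alternating_pd) auto

lemma smooth_field_tLap: "smooth_field k F \<Longrightarrow> smooth_field k (tLap F)"
  unfolding smooth_field_def[of k "tLap F"] tLap_def
  by (intro allI impI smooth_on_sum smooth_on_mult smooth_on_add smooth_on_diff open_U smooth_hi smooth_\<Gamma>
      smooth_on_pd smooth_act smooth_om0 smooth_theta smooth_fieldD[OF smooth_field_tD])
    (auto intro: smooth_field_tD)

lemma alternating_tLap:
  assumes F: "smooth_field k F" "\<And>y. y \<in> U \<Longrightarrow> alternating k (F y)" and x: "x \<in> U"
  shows "alternating k (tLap F x)"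
proof -
  have m: "t - s + u = t + (-1) * s + u" for t s u :: real by simp
  show ?thesis
    unfolding tLap_def[abs_def] m
    by (intro alternating_sum alternating_cmult alternating_add act_alternating alternating_pd
      smooth_field_tD alternating_tD F x)
qed

definition weyl_action_tractor :: "(real ^ 'n \<Rightarrow> 'n tix list \<Rightarrow> real) \<Rightarrow> real ^ 'n \<Rightarrow> 'n tix list \<Rightarrow> real" where
  "weyl_action_tractor F x As = (\<Sum>j<length As. \<Sum>i\<in>{..<length As} - {j}. \<Oplus>B C. 
     tix_lift (weyl_up x) (As ! j) (As ! i) B C * F x (As[j := B, i := C])) / 2"

lemma weyl_action_tractor_Cons:
  assumes A: "A \<in> {TX, TY}"
  shows "weyl_action_tractor F x (A # L) = weyl_action_tractor (\<lambda>y J. F y (A # J)) x L"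
proof -
  let ?g = "\<lambda>As G j i. if i = j then 0 else \<Oplus>B C. tix_lift (weyl_up x) (As ! j) (As ! i) B C * G x (As[j := B, i := C]) :: real"
  have weyl_action_tractor_if: "weyl_action_tractor G x As = (\<Sum>j<length As. \<Sum>i<length As. ?g As G j i) / 2" for G As
    unfolding weyl_action_tractor_def sum_off_diagonal_if by simp
  have z1: "tix_lift W A B C E = 0" for W B C E using A by auto
  have z2: "tix_lift W B A C E = 0" for W B C E using A by (cases B) auto
  have "(\<Sum>j<Suc (length L). \<Sum>i<Suc (length L). ?g (A # L) F j i)
      = (\<Sum>j<length L. \<Sum>i<length L. ?g L (\<lambda>y J. F y (A # J)) j i)"
    unfolding sum.lessThan_Suc_shift by (simp add: z1 z2 cong: if_cong)
  then show ?thesis unfolding weyl_action_tractor_if list.size add_Suc_right add_0_right by simp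
qed

lemma weyl_action_tractor_comp: "set P \<subseteq> {TX, TY} \<Longrightarrow> weyl_action_tractor F x (P @ map TZ I) = weyl_action (comp P F) x I"
proof (induction P arbitrary: F)
  case Nil
  show ?case
    unfolding weyl_action_tractor_def weyl_action_def by (simp add: sum_tix comp_def map_update)
next
  case (Cons A P)
  then show ?case by (simp add: comp_def[abs_def] weyl_action_tractor_Cons)
qed

lemma smooth_weyl_up: "smooth_on U (\<lambda>x. weyl_up x a b c d)"
  unfolding weyl_up_def weyl_low_def
  by (intro smooth_on_sum smooth_on_mult smooth_on_diff smooth_on_const open_U smooth_hi smooth_Rl smooth_h)

lemma smooth_field_weyl_action_tractor:
  assumes "smooth_field k F"
  shows "smooth_field k (weyl_action_tractor F)"
proof -
  have "smooth_on U (\<lambda>x. tix_lift (weyl_up x) A B C E)" for A B C E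
    by (cases A; cases B; cases C; cases E) (auto intro: smooth_on_const smooth_weyl_up)
  then show ?thesis
    unfolding smooth_field_def weyl_action_tractor_def divide_inverse
    by (intro allI impI smooth_on_mult smooth_on_sum smooth_on_const open_U) (auto intro: smooth_fieldD[OF assms])
qed

end

section \<open>The algebra of the factorisation\<close>

type_synonym ('a, 'b) state = "('a \<Rightarrow> 'b \<Rightarrow> real) \<times> ('a \<Rightarrow> 'b \<Rightarrow> real) \<times> ('a \<Rightarrow> 'b \<Rightarrow> real)"

text \<open>
  The algebraic core. \<open>Vk\<close> stands for the \<open>k\<close>-forms and \<open>Vc\<close> for the coclosed \<open>(k-1)\<close>-forms, with
  \<open>d : Vc \<rightarrow> Vk\<close>, \<open>del = \<delta> : Vk \<rightarrow> Vc\<close> and \<open>B = \<delta> d\<close> on \<open>Vk\<close>; \<open>h0\<close> stands for \<open>n - 2k + 1\<close>. Vectors are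
  real-valued functions, so that equations are checked pointwise as polynomial identities.
\<close>

locale hodge_pair =
  fixes Vk Vc :: "('p \<Rightarrow> 'q \<Rightarrow> real) set"
    and d del B :: "('p \<Rightarrow> 'q \<Rightarrow> real) \<Rightarrow> 'p \<Rightarrow> 'q \<Rightarrow> real"
    and kap h0 s :: real
  assumes Vk_add: "u \<in> Vk \<Longrightarrow> v \<in> Vk \<Longrightarrow> (\<lambda>x i. u x i + v x i) \<in> Vk"
    and Vk_scale: "u \<in> Vk \<Longrightarrow> (\<lambda>x i. r * u x i) \<in> Vk"
    and Vc_add: "u \<in> Vc \<Longrightarrow> v \<in> Vc \<Longrightarrow> (\<lambda>x i. u x i + v x i) \<in> Vc"
    and Vc_scale: "u \<in> Vc \<Longrightarrow> (\<lambda>x i. r * u x i) \<in> Vc"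
    and d_Vk: "u \<in> Vc \<Longrightarrow> d u \<in> Vk"
    and del_Vc: "u \<in> Vk \<Longrightarrow> del u \<in> Vc"
    and B_Vk: "u \<in> Vk \<Longrightarrow> B u \<in> Vk"
    and d_add: "u \<in> Vc \<Longrightarrow> v \<in> Vc \<Longrightarrow> d (\<lambda>x i. u x i + v x i) = (\<lambda>x i. d u x i + d v x i)"
    and d_scale: "u \<in> Vc \<Longrightarrow> d (\<lambda>x i. r * u x i) = (\<lambda>x i. r * d u x i)"
    and del_add: "u \<in> Vk \<Longrightarrow> v \<in> Vk \<Longrightarrow> del (\<lambda>x i. u x i + v x i) = (\<lambda>x i. del u x i + del v x i)"
    and del_scale: "u \<in> Vk \<Longrightarrow> del (\<lambda>x i. r * u x i) = (\<lambda>x i. r * del u x i)"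
    and B_add: "u \<in> Vk \<Longrightarrow> v \<in> Vk \<Longrightarrow> B (\<lambda>x i. u x i + v x i) = (\<lambda>x i. B u x i + B v x i)"
    and B_scale: "u \<in> Vk \<Longrightarrow> B (\<lambda>x i. r * u x i) = (\<lambda>x i. r * B u x i)"
    and del_B: "u \<in> Vk \<Longrightarrow> del (B u) = (\<lambda>x i. 0)"
    and B_d: "u \<in> Vc \<Longrightarrow> B (d u) = (\<lambda>x i. 0)"
begin

lemmas mem = Vk_add Vk_scale Vc_add Vc_scale d_Vk del_Vc B_Vk
lemmas lin = d_add d_scale del_add del_scale B_add B_scale del_B B_d

definition cc :: "real \<Rightarrow> real" where "cc m = (m - 1/2)\<^sup>2 - (h0 / 2 - 1)\<^sup>2"
definition tt :: "real \<Rightarrow> real" where "tt m = (h0 - 1) / 2 + m"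
definition yy :: "real \<Rightarrow> real" where "yy m = m - (h0 - 1) / 2"
definition ev :: "real \<Rightarrow> real" where "ev m = kap * (h0\<^sup>2 / 4 - (m - 1/2)\<^sup>2)"
definition gv :: "real \<Rightarrow> real" where "gv m = kap * ((h0 / 2 - m)\<^sup>2 - 1/4)"

text \<open>
  \<open>Box\<close> in weight \<open>m - n/2\<close> on the state \<open>(\<phi>, b, c)\<close> of a tractor form; \<open>s\<close> is the value of the scale.
\<close>

fun step :: "real \<Rightarrow> ('p, 'q) state \<Rightarrow> ('p, 'q) state" where
  "step m (\<phi>, b, c) =
    ((\<lambda>x i. s * (d (del \<phi>) x i + B \<phi> x i + (- kap * cc m) * \<phi> x i + (-2) * d b x i)),
     (\<lambda>x i. s * (del (d b) x i + (- kap * (cc m - 2 * h0)) * b x i + (-2 * kap) * del \<phi> x i)),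
     (\<lambda>x i. s * (del (d c) x i + ev m * c x i + (-2) * del \<phi> x i + (h0 + 1) * b x i)))"

fun run :: "nat \<Rightarrow> real \<Rightarrow> ('p, 'q) state \<Rightarrow> ('p, 'q) state" where
  "run 0 m S = S"
| "run (Suc p) m S = run p (m - 1) (step m S)"

definition init :: "real \<Rightarrow> real \<Rightarrow> ('p \<Rightarrow> 'q \<Rightarrow> real) \<Rightarrow> ('p, 'q) state" where
  "init r m f = ((\<lambda>x i. r * tt m * f x i), (\<lambda>x i. r * del f x i), (\<lambda>x i. 0))"

text \<open>
  The relation \<open>2 m (\<delta> \<phi> - tt(m) b) = (\<delta> d + ev(m)) c\<close>, solved for \<open>\<delta> d c\<close>.
\<close>

fun inv_rel :: "real \<Rightarrow> ('p, 'q) state \<Rightarrow> bool" where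
  "inv_rel m (\<phi>, b, c) \<longleftrightarrow> \<phi> \<in> Vk \<and> b \<in> Vc \<and> c \<in> Vc
    \<and> del (d c) = (\<lambda>x i. 2 * m * del \<phi> x i + (- 2 * m * tt m) * b x i + (- ev m) * c x i)"

lemma Vc_zero: "f \<in> Vk \<Longrightarrow> (\<lambda>x i. 0) \<in> Vc"
  using Vc_scale[OF del_Vc, of f 0] by simp

lemma d_zero: "f \<in> Vk \<Longrightarrow> d (\<lambda>x i. 0) = (\<lambda>x i. 0)"
  using d_scale[OF del_Vc, of f 0] by simp

lemma del_zero: "f \<in> Vk \<Longrightarrow> del (\<lambda>x i. 0) = (\<lambda>x i. 0)"
  using del_scale[of f 0] by simp

lemma inv_init: "f \<in> Vk \<Longrightarrow> inv_rel m (init r m f)"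
  using Vc_zero d_zero del_zero by (simp add: init_def mem lin algebra_simps)

text \<open>
  At the image of a state, the relation at level \<open>m - 1\<close> is \<open>s (\<delta> d + ev(m - 1))\<close> applied to the relation at
  level \<open>m\<close> of the state itself.
\<close>

lemma inv_step:
  assumes "inv_rel m S"
  shows "inv_rel (m - 1) (step m S)"
proof (cases S)
  case (fields \<phi> b c)
  let ?u = "del \<phi>" and ?A = "\<lambda>v. del (d v)"
  from assms have mm: "\<phi> \<in> Vk" "b \<in> Vc" "c \<in> Vc"
    and R: "?A c = (\<lambda>x i. 2 * m * ?u x i + (- 2 * m * tt m) * b x i + (- ev m) * c x i)"
    by (simp_all add: fields)
  have AA: "?A (?A c) = (\<lambda>x i. 2 * m * ?A ?u x i + (- 2 * m * tt m) * ?A b x i + (- ev m) * ?A c x i)"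
    by (subst R) (simp only: mem mm lin)
  have del': "del (\<lambda>x i. s * (d (del \<phi>) x i + B \<phi> x i + (- kap * cc m) * \<phi> x i + (-2) * d b x i))
      = (\<lambda>x i. s * (?A ?u x i + 0 + (- kap * cc m) * ?u x i + (-2) * ?A b x i))"
    by (simp only: mem mm lin)
  have A': "?A (\<lambda>x i. s * (?A c x i + ev m * c x i + (-2) * ?u x i + (h0 + 1) * b x i))
      = (\<lambda>x i. s * (?A (?A c) x i + ev m * ?A c x i + (-2) * ?A ?u x i + (h0 + 1) * ?A b x i))"
    by (simp only: mem mm lin)
  show ?thesis
    unfolding fields step.simps inv_rel.simps del' A' AA
  proof (intro conjI ext)
    fix x i
    have c: "?A c x i = 2 * m * ?u x i + (- 2 * m * tt m) * b x i + (- ev m) * c x i"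
      using R by (simp add: fun_eq_iff)
    show "s * (2 * m * ?A ?u x i + (- 2 * m * tt m) * ?A b x i + (- ev m) * ?A c x i
        + ev m * ?A c x i + (-2) * ?A ?u x i + (h0 + 1) * ?A b x i)
      = 2 * (m - 1) * (s * (?A ?u x i + 0 + (- kap * cc m) * ?u x i + (-2) * ?A b x i))
        + (- 2 * (m - 1) * tt (m - 1)) * (s * (?A b x i + (- kap * (cc m - 2 * h0)) * b x i + (-2 * kap) * ?u x i))
        + (- ev (m - 1)) * (s * (?A c x i + ev m * c x i + (-2) * ?u x i + (h0 + 1) * b x i))"
      unfolding c cc_def tt_def ev_def by (simp add: field_simps power2_eq_square)
  qed (intro mem mm)+
qed

lemma inv_run: "inv_rel m S \<Longrightarrow> inv_rel (m - real p) (run p m S)"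
proof (induction p arbitrary: m S)
  case (Suc p)
  from Suc.IH[OF inv_step[OF Suc.prems]] show ?case by (simp add: algebra_simps)
qed simp

lemma step_Vc:
  assumes "\<phi> \<in> Vk" "b \<in> Vc" "c \<in> Vc" "step m (\<phi>, b, c) = (\<phi>', b', c')"
  shows "\<phi>' \<in> Vk" "b' \<in> Vc" "c' \<in> Vc"
proof -
  have e: "(\<lambda>x i. s * (d (del \<phi>) x i + B \<phi> x i + (- kap * cc m) * \<phi> x i + (-2) * d b x i)) = \<phi>'"
    "(\<lambda>x i. s * (del (d b) x i + (- kap * (cc m - 2 * h0)) * b x i + (-2 * kap) * del \<phi> x i)) = b'"
    "(\<lambda>x i. s * (del (d c) x i + ev m * c x i + (-2) * del \<phi> x i + (h0 + 1) * b x i)) = c'"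
    using assms(4) by (simp_all only: step.simps prod.inject)
  show "\<phi>' \<in> Vk" unfolding e(1)[symmetric] by (intro mem assms)
  show "b' \<in> Vc" unfolding e(2)[symmetric] by (intro mem assms)
  show "c' \<in> Vc" unfolding e(3)[symmetric] by (intro mem assms)
qed

text \<open>
  Two states whose difference is a multiple of \<open>(2m d e, (del d + gv m) e)\<close>, after rescaling one of them,
  stay in this relation, and after the last step the difference has no first component.
\<close>

lemma run_proportional:
  assumes "\<phi> \<in> Vk" "b \<in> Vc" "c \<in> Vc" "c2 \<in> Vc" "e \<in> Vc"
    and "\<phi>2 = (\<lambda>x i. K * \<phi> x i + r * 2 * real m * d e x i)"
    and "b2 = (\<lambda>x i. K * b x i + (r * del (d e) x i + r * gv (real m) * e x i))"
  shows "fst (run m (real m) (\<phi>2, b2, c2)) = (\<lambda>x i. K * fst (run m (real m) (\<phi>, b, c)) x i)"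
  using assms
proof (induction m arbitrary: \<phi> b c \<phi>2 b2 c2 e)
  case 0
  then show ?case by simp
next
  case (Suc m)
  let ?m = "real (Suc m)" and ?A = "\<lambda>v. del (d v)"
  note mm = Suc.prems(1-5)
  obtain \<phi>' b' c' where S1: "step ?m (\<phi>, b, c) = (\<phi>', b', c')" by (metis prod_cases3)
  obtain \<phi>2' b2' c2' where S2: "step ?m (\<phi>2, b2, c2) = (\<phi>2', b2', c2')" by (metis prod_cases3)
  have mm2: "\<phi>2 \<in> Vk" "b2 \<in> Vc" unfolding Suc.prems(6,7) using mm by (intro mem; simp)+
  \<comment> \<open>The step maps the pair of \<open>e\<close> at level \<open>m + 1\<close> to the pair of \<open>s (\<delta> d + ev(m + 2)) e\<close> at level \<open>m\<close>.\<close>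
  define e' where "e' = (\<lambda>x i. s * (?A e x i + ev (?m + 1) * e x i))"
  have e': "e' \<in> Vc" unfolding e'_def by (intro mem mm)
  have de': "d e' = (\<lambda>x i. s * (d (?A e) x i + ev (?m + 1) * d e x i))"
    unfolding e'_def by (simp only: mem mm lin)
  have Ae': "?A e' = (\<lambda>x i. s * (?A (?A e) x i + ev (?m + 1) * ?A e x i))"
    unfolding de' by (simp only: mem mm lin)
  have del2: "del \<phi>2 = (\<lambda>x i. K * del \<phi> x i + r * 2 * ?m * ?A e x i)"
    unfolding Suc.prems(6) by (simp only: mem mm lin)
  have ddel2: "d (del \<phi>2) = (\<lambda>x i. K * d (del \<phi>) x i + r * 2 * ?m * d (?A e) x i)"
    unfolding del2 by (simp only: mem mm lin)
  have B2: "B \<phi>2 = (\<lambda>x i. K * B \<phi> x i + r * 2 * ?m * 0)"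
    unfolding Suc.prems(6) by (simp only: mem mm lin)
  have db2: "d b2 = (\<lambda>x i. K * d b x i + (r * d (?A e) x i + r * gv ?m * d e x i))"
    unfolding Suc.prems(7) by (simp only: mem mm lin)
  have Ab2: "?A b2 = (\<lambda>x i. K * ?A b x i + (r * ?A (?A e) x i + r * gv ?m * ?A e x i))"
    unfolding db2 by (simp only: mem mm lin)
  have m1: "?m - 1 = real m" by simp
  have "run m (real m) (\<phi>2', b2', c2') = run (Suc m) ?m (\<phi>2, b2, c2)"
    "run m (real m) (\<phi>', b', c') = run (Suc m) ?m (\<phi>, b, c)"
    by (simp_all only: run.simps S1 S2 m1)
  moreover have "fst (run m (real m) (\<phi>2', b2', c2')) = (\<lambda>x i. K * fst (run m (real m) (\<phi>', b', c')) x i)"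
  proof (rule Suc.IH[OF step_Vc[OF mm(1-3) S1] step_Vc(3)[OF mm2 mm(4) S2] e'])
    show "\<phi>2' = (\<lambda>x i. K * \<phi>' x i + r * 2 * real m * d e' x i)"
    proof (intro ext)
      fix x i
      have m: "real m = ?m - 1" by simp
      have e: "\<phi>2' x i = s * (d (del \<phi>2) x i + B \<phi>2 x i + (- kap * cc ?m) * \<phi>2 x i + (-2) * d b2 x i)"
        "\<phi>' x i = s * (d (del \<phi>) x i + B \<phi> x i + (- kap * cc ?m) * \<phi> x i + (-2) * d b x i)"
        using S1 S2 by auto
      show "\<phi>2' x i = K * \<phi>' x i + r * 2 * real m * d e' x i"
        unfolding e ddel2 B2 db2 de' unfolding Suc.prems(6) m cc_def ev_def gv_def
        by (simp add: field_simps power2_eq_square)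
    qed
    show "b2' = (\<lambda>x i. K * b' x i + (r * ?A e' x i + r * gv (real m) * e' x i))"
    proof (intro ext)
      fix x i
      have m: "real m = ?m - 1" by simp
      have e: "b2' x i = s * (?A b2 x i + (- kap * (cc ?m - 2 * h0)) * b2 x i + (-2 * kap) * del \<phi>2 x i)"
        "b' x i = s * (?A b x i + (- kap * (cc ?m - 2 * h0)) * b x i + (-2 * kap) * del \<phi> x i)"
        using S1 S2 by auto
      show "b2' x i = K * b' x i + (r * ?A e' x i + r * gv (real m) * e' x i)"
        unfolding e Ab2 del2 Ae' unfolding Suc.prems(7) m cc_def ev_def gv_def e'_def
        by (simp add: field_simps power2_eq_square)
    qed
  qed
  ultimately show ?case by simp
qed

text \<open>
  The state \<open>(\<phi>, b, c)\<close> times \<open>- r yy tt\<close>, and the starting state of \<open>- yy \<phi> + d c\<close>, differ by the pair of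
  \<open>c\<close> times \<open>r tt / (2 m)\<close>; this uses \<open>2 m \<delta> d - yy(m) (\<delta> d + ev(m)) = tt(m) (\<delta> d + gv(m))\<close>, which holds
  because \<open>tt(m) + yy(m) = 2 m\<close>.
\<close>

theorem factorisation:
  assumes f: "f \<in> Vk" and m: "m \<ge> 1" and S: "run p (real (m + p)) (init r (real (m + p)) f) = (\<phi>, b, c)"
  shows "fst (run m (real m) (init r (real m) (\<lambda>x i. (- yy (real m)) * \<phi> x i + d c x i)))
    = (\<lambda>x i. (- r * yy (real m) * tt (real m)) * fst (run m (real m) (\<phi>, b, c)) x i)"
proof -
  let ?m = "real m" and ?A = "\<lambda>v. del (d v)"
  let ?D = "\<lambda>x i. (- yy ?m) * \<phi> x i + d c x i"
  have "inv_rel ?m (\<phi>, b, c)"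
    using inv_run[OF inv_init[OF f], of "real (m + p)" p r] by (simp add: S[simplified] algebra_simps)
  then have mm: "\<phi> \<in> Vk" "b \<in> Vc" "c \<in> Vc"
    and R: "?A c = (\<lambda>x i. 2 * ?m * del \<phi> x i + (- 2 * ?m * tt ?m) * b x i + (- ev ?m) * c x i)"
    by simp_all
  show ?thesis
    unfolding init_def
  proof (rule run_proportional[OF mm Vc_zero[OF f] mm(3), where r = "r * tt ?m / (2 * ?m)"])
    show "(\<lambda>x i. r * tt ?m * ?D x i) = (\<lambda>x i. (- r * yy ?m * tt ?m) * \<phi> x i + r * tt ?m / (2 * ?m) * 2 * ?m * d c x i)"
      using m by (simp add: fun_eq_iff field_simps)
    have D: "del ?D = (\<lambda>x i. (- yy ?m) * del \<phi> x i + ?A c x i)"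
      by (simp only: mem mm lin)
    show "(\<lambda>x i. r * del ?D x i) = (\<lambda>x i. (- r * yy ?m * tt ?m) * b x i
        + (r * tt ?m / (2 * ?m) * ?A c x i + r * tt ?m / (2 * ?m) * gv ?m * c x i))"
    proof (intro ext)
      fix x i
      have c: "del \<phi> x i = (?A c x i + 2 * ?m * tt ?m * b x i + ev ?m * c x i) / (2 * ?m)"
        using R m by (simp add: fun_eq_iff field_simps)
      show "r * del ?D x i = (- r * yy ?m * tt ?m) * b x i
        + (r * tt ?m / (2 * ?m) * ?A c x i + r * tt ?m / (2 * ?m) * gv ?m * c x i)"
        unfolding D c using m unfolding yy_def tt_def ev_def gv_def
        by (simp add: field_simps power2_eq_square)
    qed
  qed
qed

end

section \<open>The operator Box on components\<close>

lemma permute_list_cons_pair: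
  assumes \<pi>: "\<pi> permutes {..<length As}" and k: "length As \<ge> 2"
  shows "C # E # drop 2 (permute_list \<pi> As) = permute_list \<pi> (As[\<pi> 0 := C, \<pi> 1 := E])"
proof (rule nth_equalityI)
  show "length (C # E # drop 2 (permute_list \<pi> As)) = length (permute_list \<pi> (As[\<pi> 0 := C, \<pi> 1 := E]))"
    using k by simp
  fix i assume "i < length (C # E # drop 2 (permute_list \<pi> As))"
  then have i: "i < length As" using k by simp
  have \<pi>i: "\<pi> j < length As" if "j < length As" for j
    using permutes_in_image[OF \<pi>, of j] that by simp
  have inj: "\<pi> a = \<pi> b \<longleftrightarrow> a = b" for a b
    using permutes_inj[OF \<pi>] by (auto dest: injD)
  have "permute_list \<pi> (As[\<pi> 0 := C, \<pi> 1 := E]) ! i = As[\<pi> 0 := C, \<pi> 1 := E] ! \<pi> i"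
    using \<pi> i by (intro permute_list_nth) auto
  moreover have "(C # E # drop 2 (permute_list \<pi> As)) ! i
      = (if i = 0 then C else if i = 1 then E else As ! \<pi> i)"
    using i permute_list_nth[OF \<pi> i] k by (cases i; cases "i - 1") (auto simp: nth_Cons')
  ultimately show "(C # E # drop 2 (permute_list \<pi> As)) ! i = permute_list \<pi> (As[\<pi> 0 := C, \<pi> 1 := E]) ! i"
    using \<pi>i i k inj by (auto simp: nth_list_update)
qed

text \<open>
  The double action of a curvature-like tensor, written with the skew part over all slots, is half the
  sum over ordered pairs of distinct slots: in an alternating form the sign of each permutation cancels.
\<close>

lemma double_action_eq_alt:
  fixes F :: "'i::finite list \<Rightarrow> real"
  assumes F: "alternating k F" and As: "length As = k"
  shows "real k * (real k - 1) / 2 * alt (\<lambda>Bs. \<Oplus>C E. W (Bs ! 0) (Bs ! 1) C E * F (C # E # drop 2 Bs)) As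
    = (\<Sum>j<k. \<Sum>i\<in>{..<k} - {j}. \<Oplus>C E. W (As ! j) (As ! i) C E * F (As[j := C, i := E])) / 2"
proof (cases "k \<ge> 2")
  case False
  then have "k = 0 \<or> k = Suc 0" by auto
  then show ?thesis by (auto simp: lessThan_Suc)
next
  case True
  define g where "g j i = (\<Oplus>C E. W (As ! j) (As ! i) C E * F (As[j := C, i := E]))" for j i
  let ?T = "\<lambda>Bs. \<Oplus>C E. W (Bs ! 0) (Bs ! 1) C E * F (C # E # drop 2 Bs)"
  have "of_int (sign \<pi>) * ?T (permute_list \<pi> As) = g (\<pi> 0) (\<pi> 1)" if \<pi>: "\<pi> permutes {..<k}" for \<pi>
  proof -
    have \<pi>': "\<pi> permutes {..<length As}" using \<pi> As by simp
    have a: "F (C # E # drop 2 (permute_list \<pi> As)) = of_int (sign \<pi>) * F (As[\<pi> 0 := C, \<pi> 1 := E])" for C E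
      unfolding permute_list_cons_pair[OF \<pi>' True[folded As]] using As by (intro alternating_permute[OF F \<pi>]) simp
    have b: "permute_list \<pi> As ! 0 = As ! \<pi> 0" "permute_list \<pi> As ! 1 = As ! \<pi> 1"
      using True As by (auto intro!: permute_list_nth \<pi>')
    have c: "real_of_int (sign \<pi>) * (w * (real_of_int (sign \<pi>) * v)) = w * v" for w v
    proof -
      have "real_of_int (sign \<pi>) * (w * (real_of_int (sign \<pi>) * v)) = real_of_int (sign \<pi> * sign \<pi>) * (w * v)"
        by (simp del: sign_idempotent)
      then show ?thesis by simp
    qed
    show ?thesis by (simp only: g_def sum_distrib_left a b c)
  qed
  then have "alt ?T As = (\<Sum>\<pi> | \<pi> permutes {..<k}. g (\<pi> 0) (\<pi> 1)) / fact k"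
    by (simp add: alt_def As)
  then have "real k * (real k - 1) / 2 * alt ?T As
      = (real k * (real k - 1) * (\<Sum>\<pi> | \<pi> permutes {..<k}. g (\<pi> 0) (\<pi> 1))) / fact k / 2"
    by simp
  also have "\<dots> = (\<Sum>j<k. \<Sum>i\<in>{..<k} - {j}. g j i) / 2"
    unfolding sum_permutes_two[OF True] by simp
  finally show ?thesis by (simp add: g_def)
qed

context levi_civita
begin

text \<open>
  Fields are extended by zero off the patch and off the lists of the right length, so that equality of
  forms is equality of functions.
\<close>

definition trunc :: "nat \<Rightarrow> (real ^ 'n \<Rightarrow> 'n list \<Rightarrow> real) \<Rightarrow> real ^ 'n \<Rightarrow> 'n list \<Rightarrow> real" where
  "trunc k f = (\<lambda>x I. if x \<in> U \<and> length I = k then f x I else 0)"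

lemma trunc_apply: "x \<in> U \<Longrightarrow> length I = k \<Longrightarrow> trunc k f x I = f x I"
  by (simp add: trunc_def)

lemma form_cong:
  assumes "\<And>x I. x \<in> U \<Longrightarrow> length I = k \<Longrightarrow> f x I = g x I" "form k f"
  shows "form k g"
  unfolding form_def smooth_field_def
proof (intro conjI ballI allI impI)
  fix I :: "'n list" assume I: "length I = k"
  show "smooth_on U (\<lambda>x. g x I)"
    by (rule smooth_on_cong[OF open_U _ smooth_fieldD[OF formD(1)[OF assms(2)] I]]) (use assms(1) I in auto)
next
  fix x assume x: "x \<in> U"
  show "alternating k (g x)"
    using formD(2)[OF assms(2) x] assms(1)[OF x] alternating_cong[of k "f x" "g x"] by simp
qed

lemma form_trunc: "form k f \<Longrightarrow> form k (trunc k f)"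
  by (rule form_cong[of k f]) (simp_all add: trunc_apply)

lemma codf_cong:
  assumes "\<And>y J. y \<in> U \<Longrightarrow> length J = Suc (length I) \<Longrightarrow> f y J = g y J" "x \<in> U"
  shows "codf f x I = codf g x I"
proof -
  have "D f x (a # b # I) = D g x (a # b # I)" for a b
    by (rule D_cong) (use assms in auto)
  then show ?thesis by (simp add: codf_def)
qed

lemma extd_cong:
  assumes "\<And>y J. y \<in> U \<Longrightarrow> Suc (length J) = length I \<Longrightarrow> f y J = g y J" "x \<in> U"
  shows "extd f x I = extd g x I"
proof (cases I)
  case (Cons a K)
  have "D f x (b # L) = D g x (b # L)" if "length L = length K" for b L
    by (rule D_cong) (use assms that Cons in auto)
  then show ?thesis by (simp add: Cons extd_Cons)
qed simp

definition kforms :: "nat \<Rightarrow> (real ^ 'n \<Rightarrow> 'n list \<Rightarrow> real) set" where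
  "kforms k = {f. form k f \<and> trunc k f = f}"

definition coclosed :: "nat \<Rightarrow> (real ^ 'n \<Rightarrow> 'n list \<Rightarrow> real) set" where
  "coclosed m = {f \<in> kforms m. \<forall>x\<in>U. \<forall>J. Suc (length J) = m \<longrightarrow> codf f x J = 0}"

definition dT :: "nat \<Rightarrow> (real ^ 'n \<Rightarrow> 'n list \<Rightarrow> real) \<Rightarrow> real ^ 'n \<Rightarrow> 'n list \<Rightarrow> real" where
  "dT m f = trunc (Suc m) (extd f)"

definition delT :: "nat \<Rightarrow> (real ^ 'n \<Rightarrow> 'n list \<Rightarrow> real) \<Rightarrow> real ^ 'n \<Rightarrow> 'n list \<Rightarrow> real" where
  "delT m f = trunc m (codf f)"

definition BT :: "nat \<Rightarrow> (real ^ 'n \<Rightarrow> 'n list \<Rightarrow> real) \<Rightarrow> real ^ 'n \<Rightarrow> 'n list \<Rightarrow> real" where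
  "BT m f = trunc (Suc m) (codf (extd f))"

lemma trunc_in_kforms: "form k f \<Longrightarrow> trunc k f \<in> kforms k"
  by (simp add: kforms_def form_trunc) (simp add: trunc_def fun_eq_iff)

lemma kforms_lin:
  assumes "u \<in> kforms k" "v \<in> kforms k"
  shows "(\<lambda>x i. r * u x i + s * v x i) \<in> kforms k"
proof -
  have z: "u x I = 0 \<and> v x I = 0" if "\<not> (x \<in> U \<and> length I = k)" for x I
  proof -
    have "u x I = trunc k u x I" "v x I = trunc k v x I" using assms by (simp_all add: kforms_def)
    then show ?thesis using that by (auto simp: trunc_def)
  qed
  then show ?thesis
    using assms by (auto simp: kforms_def form_lin trunc_def fun_eq_iff)
qed

end

context einstein_patch
begin

lemma coclosed_lin:
  assumes "u \<in> coclosed m" "v \<in> coclosed m"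
  shows "(\<lambda>x i. r * u x i + s * v x i) \<in> coclosed m"
proof -
  have k: "u \<in> kforms m" "v \<in> kforms m" using assms by (auto simp: coclosed_def)
  have "codf (\<lambda>x i. r * u x i + s * v x i) x J = 0" if "x \<in> U" "Suc (length J) = m" for x J
    using assms k codf_lin[of "length J" u v x J r s] that by (auto simp: coclosed_def kforms_def form_def)
  then show ?thesis using kforms_lin[OF k] by (simp add: coclosed_def)
qed

lemma dT_lin:
  assumes "u \<in> kforms m" "v \<in> kforms m"
  shows "dT m (\<lambda>x i. r * u x i + s * v x i) = (\<lambda>x i. r * dT m u x i + s * dT m v x i)"
  using assms by (auto simp: dT_def trunc_def fun_eq_iff kforms_def form_def extd_lin)

lemma delT_lin:
  assumes "u \<in> kforms (Suc m)" "v \<in> kforms (Suc m)"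
  shows "delT m (\<lambda>x i. r * u x i + s * v x i) = (\<lambda>x i. r * delT m u x i + s * delT m v x i)"
  using assms by (auto simp: delT_def trunc_def fun_eq_iff kforms_def form_def codf_lin)

lemma BT_lin:
  assumes "u \<in> kforms (Suc m)" "v \<in> kforms (Suc m)"
  shows "BT m (\<lambda>x i. r * u x i + s * v x i) = (\<lambda>x i. r * BT m u x i + s * BT m v x i)"
proof (intro ext)
  fix x and I :: "'n list"
  have f: "form (Suc m) u" "form (Suc m) v" using assms by (auto simp: kforms_def)
  show "BT m (\<lambda>x i. r * u x i + s * v x i) x I = r * BT m u x I + s * BT m v x I"
  proof (cases "x \<in> U \<and> length I = Suc m")
    case True
    have "codf (extd (\<lambda>x i. r * u x i + s * v x i)) x I = codf (\<lambda>y J. r * extd u y J + s * extd v y J) x I"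
      by (rule codf_cong) (use True f in \<open>auto simp: extd_lin[OF formD(1)[OF f(1)] formD(1)[OF f(2)]]\<close>)
    also have "\<dots> = r * codf (extd u) x I + s * codf (extd v) x I"
      using True f by (intro codf_lin[of "Suc m"] formD(1) form_extd) auto
    finally show ?thesis using True by (simp add: BT_def trunc_def)
  qed (auto simp: BT_def trunc_def)
qed

lemma delT_coclosed:
  assumes "u \<in> kforms (Suc m)"
  shows "delT m u \<in> coclosed m"
proof -
  have u: "form (Suc m) u" using assms by (auto simp: kforms_def)
  have "codf (trunc m (codf u)) x J = 0" if "x \<in> U" "Suc (length J) = m" for x J
  proof -
    have "codf (trunc m (codf u)) x J = codf (codf u) x J"
      by (rule codf_cong) (use that in \<open>auto simp: trunc_apply\<close>)
    also have "\<dots> = 0" by (rule codf_codf[of "length J"]) (use u that in auto)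
    finally show ?thesis .
  qed
  then show ?thesis
    unfolding coclosed_def delT_def using trunc_in_kforms[OF form_codf[OF u]] by simp
qed

lemma delT_BT:
  assumes "u \<in> kforms (Suc m)"
  shows "delT m (BT m u) = (\<lambda>x i. 0)"
proof (intro ext)
  fix x and I :: "'n list"
  have u: "form (Suc m) u" using assms by (auto simp: kforms_def)
  show "delT m (BT m u) x I = 0"
  proof (cases "x \<in> U \<and> length I = m")
    case True
    have "codf (trunc (Suc m) (codf (extd u))) x I = codf (codf (extd u)) x I"
      by (rule codf_cong) (use True in \<open>auto simp: trunc_apply\<close>)
    also have "\<dots> = 0" by (rule codf_codf[of m]) (use u True form_extd in auto)
    finally show ?thesis using True by (simp add: delT_def BT_def trunc_def)
  qed (auto simp: delT_def trunc_def)
qed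

lemma BT_dT:
  assumes "u \<in> kforms m"
  shows "BT m (dT m u) = (\<lambda>x i. 0)"
proof (intro ext)
  fix x and I :: "'n list"
  have u: "form m u" using assms by (auto simp: kforms_def)
  show "BT m (dT m u) x I = 0"
  proof (cases "x \<in> U \<and> length I = Suc m")
    case True
    have "codf (extd (dT m u)) x I = 0"
    proof (rule codf_zero)
      fix y and J :: "'n list" assume *: "y \<in> U" "length J = Suc (length I)"
      have "extd (dT m u) y J = extd (extd u) y J"
        by (rule extd_cong) (use * True in \<open>auto simp: dT_def trunc_apply\<close>)
      then show "extd (dT m u) y J = 0" using extd_extd[OF u] * True by simp
    qed (use True in simp)
    then show ?thesis using True by (simp add: BT_def trunc_def)
  qed (auto simp: BT_def trunc_def)
qed

sublocale hp: hodge_pair "kforms (Suc m)" "coclosed m" "dT m" "delT m" "BT m" kap "real CARD('n) - 2 * real m - 1" s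
  for m s
proof
  fix u v :: "real ^ 'n \<Rightarrow> 'n list \<Rightarrow> real" and r :: real
  have k: "w \<in> coclosed m \<Longrightarrow> w \<in> kforms m" for w by (simp add: coclosed_def)
  show "u \<in> kforms (Suc m) \<Longrightarrow> v \<in> kforms (Suc m) \<Longrightarrow> (\<lambda>x i. u x i + v x i) \<in> kforms (Suc m)"
    using kforms_lin[of u _ v 1 1] by simp
  show "u \<in> kforms (Suc m) \<Longrightarrow> (\<lambda>x i. r * u x i) \<in> kforms (Suc m)"
    using kforms_lin[of u _ u r 0] by simp
  show "u \<in> coclosed m \<Longrightarrow> v \<in> coclosed m \<Longrightarrow> (\<lambda>x i. u x i + v x i) \<in> coclosed m"
    using coclosed_lin[of u _ v 1 1] by simp
  show "u \<in> coclosed m \<Longrightarrow> (\<lambda>x i. r * u x i) \<in> coclosed m"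
    using coclosed_lin[of u _ u r 0] by simp
  show "u \<in> coclosed m \<Longrightarrow> dT m u \<in> kforms (Suc m)"
    unfolding dT_def by (intro trunc_in_kforms form_extd) (simp add: coclosed_def kforms_def)
  show "u \<in> kforms (Suc m) \<Longrightarrow> delT m u \<in> coclosed m" by (rule delT_coclosed)
  show "u \<in> kforms (Suc m) \<Longrightarrow> BT m u \<in> kforms (Suc m)"
    unfolding BT_def by (intro trunc_in_kforms form_codf form_extd) (simp add: kforms_def)
  show "u \<in> coclosed m \<Longrightarrow> v \<in> coclosed m \<Longrightarrow> dT m (\<lambda>x i. u x i + v x i) = (\<lambda>x i. dT m u x i + dT m v x i)"
    using dT_lin[of u m v 1 1] k by simp
  show "u \<in> coclosed m \<Longrightarrow> dT m (\<lambda>x i. r * u x i) = (\<lambda>x i. r * dT m u x i)"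
    using dT_lin[of u m u r 0] k by simp
  show "u \<in> kforms (Suc m) \<Longrightarrow> v \<in> kforms (Suc m) \<Longrightarrow> delT m (\<lambda>x i. u x i + v x i) = (\<lambda>x i. delT m u x i + delT m v x i)"
    using delT_lin[of u m v 1 1] by simp
  show "u \<in> kforms (Suc m) \<Longrightarrow> delT m (\<lambda>x i. r * u x i) = (\<lambda>x i. r * delT m u x i)"
    using delT_lin[of u m u r 0] by simp
  show "u \<in> kforms (Suc m) \<Longrightarrow> v \<in> kforms (Suc m) \<Longrightarrow> BT m (\<lambda>x i. u x i + v x i) = (\<lambda>x i. BT m u x i + BT m v x i)"
    using BT_lin[of u m v 1 1] by simp
  show "u \<in> kforms (Suc m) \<Longrightarrow> BT m (\<lambda>x i. r * u x i) = (\<lambda>x i. r * BT m u x i)"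
    using BT_lin[of u m u r 0] by simp
  show "u \<in> kforms (Suc m) \<Longrightarrow> delT m (BT m u) = (\<lambda>x i. 0)" by (rule delT_BT)
  show "u \<in> coclosed m \<Longrightarrow> BT m (dT m u) = (\<lambda>x i. 0)" using BT_dT k by simp
qed

definition box :: "real \<Rightarrow> real \<Rightarrow> (real ^ 'n \<Rightarrow> 'n tix list \<Rightarrow> real) \<Rightarrow> real ^ 'n \<Rightarrow> 'n tix list \<Rightarrow> real" where
  "box s w F x As = s * (- tLap F x As - weyl_action_tractor F x As - kap * w * (real CARD('n) + w - 1) * F x As)"

text \<open>
  For \<open>k = m + 1\<close>: the state of a tractor \<open>k\<close>-form, whose two \<open>m\<close>-forms have to be coclosed.
\<close>

fun represents :: "nat \<Rightarrow> (real ^ 'n \<Rightarrow> 'n tix list \<Rightarrow> real) \<Rightarrow> (real ^ 'n, 'n list) state \<Rightarrow> bool" where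
  "represents m F (\<phi>, b, c) \<longleftrightarrow> tractor_form (Suc m) F \<and> \<phi> = trunc (Suc m) (comp [] F)
    \<and> b = trunc m (b_comp F) \<and> c = trunc m (comp [TY] F) \<and> b \<in> coclosed m \<and> c \<in> coclosed m"

lemma alternating_weyl_action_tractor:
  assumes "alternating k (F x)"
  shows "alternating k (weyl_action_tractor F x)"
proof -
  let ?A = "alt (\<lambda>Bs. \<Oplus>C E. tix_lift (weyl_up x) (Bs ! 0) (Bs ! 1) C E * F x (C # E # drop 2 Bs))"
  have "alternating k (\<lambda>As. real k * (real k - 1) / 2 * ?A As)"
    by (intro alternating_cmult alternating_alt)
  moreover have "real k * (real k - 1) / 2 * ?A As = weyl_action_tractor F x As" if "length As = k" for As
    using double_action_eq_alt[OF assms that, of "tix_lift (weyl_up x)"] that by (simp add: weyl_action_tractor_def)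
  ultimately show ?thesis using alternating_cong by (metis (no_types, lifting))
qed

lemma represents_codf_zero:
  assumes "represents m F (\<phi>, b, c)" "x \<in> U" "Suc (length J) = m"
  shows "codf (b_comp F) x J = 0" "A \<in> {TX, TY} \<Longrightarrow> codf (comp [A] F) x J = 0"
proof -
  from assms have F: "tractor_form (Suc m) F" and bc: "trunc m (b_comp F) \<in> coclosed m" "trunc m (comp [TY] F) \<in> coclosed m" by auto
  have "codf (b_comp F) x J = codf (trunc m (b_comp F)) x J"
    by (rule codf_cong) (use assms in \<open>auto simp: trunc_apply\<close>)
  with bc assms show V: "codf (b_comp F) x J = 0" by (simp add: coclosed_def)
  have "codf (comp [TY] F) x J = codf (trunc m (comp [TY] F)) x J"
    by (rule codf_cong) (use assms in \<open>auto simp: trunc_apply\<close>)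
  with bc assms have Y: "codf (comp [TY] F) x J = 0" by (simp add: coclosed_def)
  have "codf (b_comp F) x J = 1 * codf (comp [TX] F) x J + lam * codf (comp [TY] F) x J"
    by (rule codf_lin[of "length J"]) (use assms formD(1)[OF form_comp_A[OF F]] in auto)
  with V Y show "A \<in> {TX, TY} \<Longrightarrow> codf (comp [A] F) x J = 0" by auto
qed

text \<open>
  The components of the Laplacian, with the Weitzenboeck formula for each of the three forms; for \<open>b\<close> and
  \<open>c\<close> the term \<open>d \<delta>\<close> vanishes. The constants match because
  \<open>k (n - k - 1) + w (n + w - 1) = cc(w + n/2)\<close>, and similarly for \<open>b\<close> and \<open>c\<close>.
\<close>

lemma represents_box:
  assumes R: "represents m F (\<phi>, b, c)"
  shows "represents m (box s w F) (hp.step m s (w + real CARD('n) / 2) (\<phi>, b, c))"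
proof -
  let ?n = "real CARD('n)" and ?m = "w + real CARD('n) / 2"
  from R have F: "tractor_form (Suc m) F" and eqs: "\<phi> = trunc (Suc m) (comp [] F)" "b = trunc m (b_comp F)" "c = trunc m (comp [TY] F)"
    and bc: "b \<in> coclosed m" "c \<in> coclosed m" by auto
  note F' = tractor_formD[OF F]
  have fZ: "form (Suc m) (comp [] F)" and fA: "form m (comp [A] F)" and fV: "form m (b_comp F)" for A
    using form_comp_Z[OF F] form_comp_A[OF F] form_b_comp[OF F] by auto
  have W: "- Lap f x K - weyl_action f x K = codf (extd f) x K + extd (codf f) x K - kap * real k * (?n - real k) * f x K"
    if "form k f" "x \<in> U" "length K = k" for f k x K
    using weitzenboeck[OF that] by simp
  note cz = represents_codf_zero[OF R]
  have tf: "tractor_form (Suc m) (box s w F)"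
    unfolding tractor_form_def
  proof (intro conjI ballI allI impI)
    have m: "s * (- t - u - r * v) = s * ((-1) * t + (-1) * u + (- r) * v)" for t u r v :: real
      by (simp add: algebra_simps)
    show "smooth_field (Suc m) (box s w F)"
      unfolding box_def[abs_def] m
      by (intro smooth_field_cmult smooth_field_add smooth_field_tLap smooth_field_weyl_action_tractor F')
    fix x assume x: "x \<in> U"
    show "alternating (Suc m) (box s w F x)"
      unfolding box_def[abs_def] m
      by (intro alternating_cmult alternating_add alternating_tLap alternating_weyl_action_tractor F' x)
    fix I :: "'n list" assume I: "Suc (Suc (length I)) = Suc m"
    then obtain r where r: "m = Suc r" "length I = r" by auto
    have "tLap F x (TX # TY # map TZ I) = 0"
      by (rule tLap_XY[OF F[unfolded r(1)] x r(2)]) (use cz(2) r in auto)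
    moreover have "weyl_action_tractor F x ([TX, TY] @ map TZ I) = weyl_action (comp [TX, TY] F) x I" by (rule weyl_action_tractor_comp) simp
    moreover have "weyl_action (comp [TX, TY] F) x I = 0"
      using F'(3)[OF x] I by (simp add: weyl_action_def comp_def)
    ultimately show "box s w F x (TX # TY # map TZ I) = 0"
      using F'(3)[OF x I] by (simp add: box_def)
  qed
  have ex: "extd (codf f) x I = 0" if "x \<in> U" "length I = m" "\<And>y J. y \<in> U \<Longrightarrow> Suc (length J) = m \<Longrightarrow> codf f y J = 0" for f x I
    by (rule extd_zero) (use that in auto)
  have 1: "fst (hp.step m s ?m (\<phi>, b, c)) = trunc (Suc m) (comp [] (box s w F))"
  proof (intro ext)
    fix x and I :: "'n list"
    show "fst (hp.step m s ?m (\<phi>, b, c)) x I = trunc (Suc m) (comp [] (box s w F)) x I"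
    proof (cases "x \<in> U \<and> length I = Suc m")
      case True
      have "extd (delT m \<phi>) x I = extd (codf (comp [] F)) x I"
      proof (rule extd_cong)
        fix y and J :: "'n list" assume *: "y \<in> U" "Suc (length J) = length I"
        have "codf \<phi> y J = codf (comp [] F) y J"
          by (rule codf_cong) (use * True in \<open>auto simp: eqs trunc_apply\<close>)
        then show "delT m \<phi> y J = codf (comp [] F) y J" using * True by (simp add: delT_def trunc_apply)
      qed (use True in simp)
      moreover have "codf (extd \<phi>) x I = codf (extd (comp [] F)) x I"
        by (rule codf_cong) (use True in \<open>auto simp: eqs trunc_apply intro!: extd_cong\<close>)
      moreover have "extd b x I = extd (b_comp F) x I"
        by (rule extd_cong) (use True in \<open>auto simp: eqs trunc_apply\<close>)
      ultimately have "fst (hp.step m s ?m (\<phi>, b, c)) x I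
        = s * (extd (codf (comp [] F)) x I + codf (extd (comp [] F)) x I - kap * hp.cc m ?m * comp [] F x I - 2 * extd (b_comp F) x I)"
        using True by (simp add: dT_def BT_def trunc_apply eqs)
      also have "\<dots> = box s w F x (map TZ I)"
      proof -
        have e: "F x (map TZ I) = comp [] F x I" by (simp add: comp_def)
        have w: "weyl_action_tractor F x (map TZ I) = weyl_action (comp [] F) x I" using weyl_action_tractor_comp[of "[]" F x I] by simp
        have L: "Lap (comp [] F) x I = - weyl_action (comp [] F) x I - codf (extd (comp [] F)) x I - extd (codf (comp [] F)) x I
            + kap * real (Suc m) * (?n - real (Suc m)) * comp [] F x I"
          using W[OF fZ, of x I] True by simp
        have t: "tLap F x (map TZ I) = Lap (comp [] F) x I + 2 * extd (b_comp F) x I - kap * (real m + 1) * comp [] F x I"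
          using tLap_Z[OF F] True by simp
        show ?thesis
          unfolding box_def t w e L hp.cc_def by (simp add: field_simps power2_eq_square)
      qed
      finally show ?thesis using True by (simp add: trunc_apply comp_def)
    qed (auto simp: trunc_def eqs dT_def BT_def)
  qed
  have sY: "tLap F x (TY # map TZ I) = Lap (comp [TY] F) x I + 2 * codf (comp [] F) x I
      - (?n - 2 * real m) * b_comp F x I - kap * real m * comp [TY] F x I" if "x \<in> U" "length I = m" for x I
    using tLap_A[OF F that, of TY] by simp
  have sX: "tLap F x (TX # map TZ I) = Lap (comp [TX] F) x I + 2 * lam * codf (comp [] F) x I
      - lam * (?n - 2 * real m) * b_comp F x I - kap * real m * comp [TX] F x I" if "x \<in> U" "length I = m" for x I
    using tLap_A[OF F that, of TX] by simp
  have del: "codf \<phi> x I = codf (comp [] F) x I" if "x \<in> U" "length I = m" for x I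
    by (rule codf_cong) (use that in \<open>auto simp: eqs trunc_apply\<close>)
  have A: "codf (dT m (trunc m f)) x I = codf (extd f) x I" if "x \<in> U" "length I = m" for f x I
    by (rule codf_cong) (use that in \<open>auto simp: dT_def trunc_apply intro!: extd_cong\<close>)
  have 2: "fst (snd (hp.step m s ?m (\<phi>, b, c))) = trunc m (b_comp (box s w F))"
  proof (intro ext)
    fix x and I :: "'n list"
    show "fst (snd (hp.step m s ?m (\<phi>, b, c))) x I = trunc m (b_comp (box s w F)) x I"
    proof (cases "x \<in> U \<and> length I = m")
      case True
      have LV: "Lap (b_comp F) x I = 1 * Lap (comp [TX] F) x I + lam * Lap (comp [TY] F) x I"
        by (rule Lap_lin[of m]) (use True formD(1)[OF fA] in auto)
      have WV: "weyl_action (b_comp F) x I = 1 * weyl_action (comp [TX] F) x I + lam * weyl_action (comp [TY] F) x I"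
        by (rule weyl_action_lin)
      have eV: "- Lap (b_comp F) x I - weyl_action (b_comp F) x I = codf (extd (b_comp F)) x I - kap * real m * (?n - real m) * b_comp F x I"
        using W[OF fV, of x I] ex[of x I "b_comp F"] cz(1) True by simp
      have "b_comp (box s w F) x I = s * (- Lap (b_comp F) x I - weyl_action (b_comp F) x I - 4 * lam * codf (comp [] F) x I
          + 2 * lam * (?n - 2 * real m) * b_comp F x I + kap * real m * b_comp F x I - kap * w * (?n + w - 1) * b_comp F x I)"
        using weyl_action_tractor_comp[of "[TX]" F x I] weyl_action_tractor_comp[of "[TY]" F x I] True
        unfolding comp_def[of _ "box s w F"] LV WV
        by (simp add: box_def sX sY) (simp add: comp_def algebra_simps)
      also have "\<dots> = s * (codf (extd (b_comp F)) x I - kap * (hp.cc m ?m - 2 * (?n - 2 * real m - 1)) * b_comp F x I - 2 * kap * codf (comp [] F) x I)"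
        unfolding eV unfolding hp.cc_def lam_def by (simp add: field_simps power2_eq_square)
      also have "\<dots> = fst (snd (hp.step m s ?m (\<phi>, b, c))) x I"
        using True by (simp add: delT_def trunc_apply eqs(2) A del)
      finally show ?thesis using True by (simp add: trunc_apply)
    qed (auto simp: trunc_def eqs delT_def)
  qed
  have 3: "snd (snd (hp.step m s ?m (\<phi>, b, c))) = trunc m (comp [TY] (box s w F))"
  proof (intro ext)
    fix x and I :: "'n list"
    show "snd (snd (hp.step m s ?m (\<phi>, b, c))) x I = trunc m (comp [TY] (box s w F)) x I"
    proof (cases "x \<in> U \<and> length I = m")
      case True
      have eY: "- Lap (comp [TY] F) x I - weyl_action (comp [TY] F) x I = codf (extd (comp [TY] F)) x I - kap * real m * (?n - real m) * comp [TY] F x I"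
        using W[OF fA, of x I TY] ex[of x I "comp [TY] F"] cz(2) True by simp
      have "comp [TY] (box s w F) x I = s * (- Lap (comp [TY] F) x I - weyl_action (comp [TY] F) x I - 2 * codf (comp [] F) x I
          + (?n - 2 * real m) * b_comp F x I + kap * real m * comp [TY] F x I - kap * w * (?n + w - 1) * comp [TY] F x I)"
        using weyl_action_tractor_comp[of "[TY]" F x I] True
        unfolding comp_def[of _ "box s w F"]
        by (simp add: box_def sY) (simp add: comp_def algebra_simps)
      also have "\<dots> = s * (codf (extd (comp [TY] F)) x I + hp.ev m ?m * comp [TY] F x I - 2 * codf (comp [] F) x I
          + (?n - 2 * real m) * b_comp F x I)"
        unfolding eY hp.ev_def by (simp add: field_simps power2_eq_square)
      also have "\<dots> = snd (snd (hp.step m s ?m (\<phi>, b, c))) x I"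
        using True by (simp add: delT_def trunc_apply eqs(2,3) A del)
      finally show ?thesis using True by (simp add: trunc_apply)
    qed (auto simp: trunc_def eqs delT_def)
  qed
  obtain \<phi>' b' c' where S: "hp.step m s ?m (\<phi>, b, c) = (\<phi>', b', c')" by (metis prod_cases3)
  have "\<phi> \<in> kforms (Suc m)" unfolding eqs(1) by (rule trunc_in_kforms[OF fZ])
  note mem = hp.step_Vc[OF this bc S]
  have "\<phi>' = trunc (Suc m) (comp [] (box s w F))" "b' = trunc m (b_comp (box s w F))"
    "c' = trunc m (comp [TY] (box s w F))"
    using 1 2 3 unfolding S by simp_all
  with mem tf show ?thesis unfolding S by simp
qed

lemma represents_run_box:
  assumes "represents m F S"
  shows "represents m (box s w F) (hp.step m s (w + real CARD('n) / 2) S)"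
  using assms represents_box by (cases S) blast

end

section \<open>The Levi-Civita calculus of a scaled metric\<close>

lemma matrix_inv_inverse:
  fixes A :: "real ^ 'n::finite ^ 'n"
  assumes "invertible A"
  shows "A ** matrix_inv A = mat 1" "matrix_inv A ** A = mat 1"
  using assms someI_ex[of "\<lambda>B. A ** B = mat 1 \<and> B ** A = mat 1"]
  by (auto simp: invertible_def matrix_inv_def)

lemma sum_matrix_inv:
  fixes A :: "real ^ 'n::finite ^ 'n"
  assumes "invertible A"
  shows "(\<Oplus>b. A $ a $ b * matrix_inv A $ b $ c) = (if a = c then 1 else 0)"
    "(\<Oplus>b. matrix_inv A $ a $ b * A $ b $ c) = (if a = c then 1 else 0)"
  using matrix_inv_inverse[OF assms] by (simp_all add: matrix_matrix_mult_def mat_def vec_eq_iff)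

lemma matrix_inv_unique:
  fixes A B :: "real ^ 'n::finite ^ 'n"
  assumes "A ** B = mat 1" "B ** A = mat 1"
  shows "matrix_inv A = B"
proof -
  have "invertible A" using assms invertible_def by blast
  then have "matrix_inv A = matrix_inv A ** (A ** B)" using assms by simp
  also have "\<dots> = B" using matrix_inv_inverse[OF \<open>invertible A\<close>] by (simp add: matrix_mul_assoc)
  finally show ?thesis .
qed

lemma transpose_self_iff: "transpose A = A \<longleftrightarrow> (\<forall>i j. A $ i $ j = A $ j $ i)"
  unfolding transpose_def vec_eq_iff by auto

lemma matrix_inv_symmetric:
  fixes A :: "real ^ 'n::finite ^ 'n"
  assumes A: "invertible A" and sym: "transpose A = A"
  shows "matrix_inv A $ a $ b = matrix_inv A $ b $ a"
proof -
  have "transpose (matrix_inv A) = matrix_inv A"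
  proof (rule matrix_inv_unique[symmetric])
    show "A ** transpose (matrix_inv A) = mat 1" "transpose (matrix_inv A) ** A = mat 1"
      using matrix_inv_inverse[OF A] sym by (metis matrix_transpose_mul transpose_mat)+
  qed
  then show ?thesis by (simp add: transpose_self_iff)
qed

text \<open>By Cramer's rule, the entries of the inverse matrix are rational functions of the entries.\<close>

lemma smooth_on_matrix_inv:
  fixes G :: "real ^ 'm::finite \<Rightarrow> real ^ 'n::finite ^ 'n"
  assumes S: "open S" and G: "\<And>i j. smooth_on S (\<lambda>x. G x $ i $ j)"
    and inv: "\<And>x. x \<in> S \<Longrightarrow> invertible (G x)"
  shows "smooth_on S (\<lambda>x. matrix_inv (G x) $ a $ b)"
proof -
  have det: "smooth_on S (\<lambda>x. det (H x))" if "\<And>i j. smooth_on S (\<lambda>x. H x $ i $ j)" for H :: "real ^ 'm \<Rightarrow> real ^ 'n ^ 'n"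
    unfolding det_def by (intro smooth_on_sum smooth_on_mult smooth_on_prod smooth_on_const S that)
  let ?N = "\<lambda>x. det (\<chi> i j. if j = a then (axis b 1 :: real ^ 'n) $ i else G x $ i $ j)"
  have "smooth_on S (\<lambda>x. (\<chi> i j. if j = a then (axis b 1 :: real ^ 'n) $ i else G x $ i $ j) $ i $ j)" for i j
    using G by (cases "j = a") (auto intro: smooth_on_const)
  then have N: "smooth_on S ?N" by (rule det)
  have "det (G x) \<noteq> 0" if "x \<in> S" for x
    using inv[OF that] by (simp add: invertible_det_nz)
  from smooth_on_mult[OF S N smooth_on_inverse[OF S det[OF G] this]]
  have "smooth_on S (\<lambda>x. ?N x * inverse (det (G x)))" by simp
  moreover have "?N x * inverse (det (G x)) = matrix_inv (G x) $ a $ b" if x: "x \<in> S" for x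
  proof -
    have "G x *v (\<chi> k. matrix_inv (G x) $ k $ b) = axis b 1"
      using sum_matrix_inv(1)[OF inv[OF x], of _ b]
      by (simp add: matrix_vector_mult_def vec_eq_iff axis_def)
    then have "(\<chi> k. matrix_inv (G x) $ k $ b) = (\<chi> k. det (\<chi> i j. if j = k then axis b 1 $ i else G x $ i $ j) / det (G x))"
      using cramer[of "G x"] inv[OF x] by (simp add: invertible_det_nz)
    then have "(\<chi> k. matrix_inv (G x) $ k $ b) $ a = ?N x / det (G x)" by (simp only: vec_lambda_beta)
    then show ?thesis by (simp add: divide_inverse)
  qed
  ultimately show ?thesis by (rule smooth_on_cong[OF S, rotated -1]) auto
qed

definition regular_metric :: "(real ^ 'n) set \<Rightarrow> (real ^ 'n::finite \<Rightarrow> real ^ 'n ^ 'n) \<Rightarrow> bool" where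
  "regular_metric V g \<longleftrightarrow> open V \<and> (\<forall>i j. smooth_on V (\<lambda>x. g x $ i $ j))
     \<and> (\<forall>x\<in>V. transpose (g x) = g x \<and> invertible (g x))"

text \<open>
  The conformal metric along the section \<open>y \<mapsto> s\<^sup>2 g y\<close>; being a constant multiple of \<open>g\<close>, it has the
  Christoffel symbols of \<open>g\<close>.
\<close>

definition scaled :: "(real ^ 'n::finite \<Rightarrow> real ^ 'n ^ 'n) \<Rightarrow> real \<Rightarrow> real ^ 'n \<Rightarrow> 'n \<Rightarrow> 'n \<Rightarrow> real" where
  "scaled g s y a b = (s\<^sup>2 *\<^sub>R g y) $ a $ b"

definition scaled_inv :: "(real ^ 'n::finite \<Rightarrow> real ^ 'n ^ 'n) \<Rightarrow> real \<Rightarrow> real ^ 'n \<Rightarrow> 'n \<Rightarrow> 'n \<Rightarrow> real" where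
  "scaled_inv g s y a b = matrix_inv (s\<^sup>2 *\<^sub>R g y) $ a $ b"

lemma levi_civita_christoffel:
  assumes g: "regular_metric V g" and s: "s > 0"
  shows "levi_civita V (scaled g s) (scaled_inv g s) (christoffel g)"
  unfolding scaled_def[abs_def] scaled_inv_def[abs_def]
proof
  have V: "open V" and sm: "smooth_on V (\<lambda>x. g x $ i $ j)" for i j
    using g by (auto simp: regular_metric_def)
  have inv: "invertible (g x)" and sym: "g x $ i $ j = g x $ j $ i" if "x \<in> V" for x i j
    using g that by (auto simp: regular_metric_def transpose_self_iff)
  have sminv: "smooth_on V (\<lambda>x. matrix_inv (g x) $ a $ b)" for a b
    by (rule smooth_on_matrix_inv[OF V sm inv])
  have invs: "invertible (s\<^sup>2 *\<^sub>R g x)" if "x \<in> V" for x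
    using inv[OF that] s by (simp add: scalar_invertible)
  show "open V" by (rule V)
  show "smooth_on V (\<lambda>x. (s\<^sup>2 *\<^sub>R g x) $ a $ b)" for a b
    using smooth_on_mult[OF V smooth_on_const sm] by simp
  show "smooth_on V (\<lambda>x. matrix_inv (s\<^sup>2 *\<^sub>R g x) $ a $ b)" for a b
    by (rule smooth_on_matrix_inv[OF V _ invs]) (use smooth_on_mult[OF V smooth_on_const sm] in simp)
  show "smooth_on V (\<lambda>x. christoffel g x c a b)" for c a b
    unfolding christoffel_def divide_inverse
    by (intro smooth_on_sum smooth_on_mult smooth_on_diff smooth_on_add smooth_on_const smooth_on_pd V sm sminv)
  fix x assume x: "x \<in> V"
  show "(s\<^sup>2 *\<^sub>R g x) $ a $ b = (s\<^sup>2 *\<^sub>R g x) $ b $ a" for a b using sym[OF x] by simp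
  show "matrix_inv (s\<^sup>2 *\<^sub>R g x) $ a $ b = matrix_inv (s\<^sup>2 *\<^sub>R g x) $ b $ a" for a b
  proof (rule matrix_inv_symmetric[OF invs[OF x]])
    show "transpose (s\<^sup>2 *\<^sub>R g x) = s\<^sup>2 *\<^sub>R g x" using sym[OF x] by (simp add: transpose_self_iff)
  qed
  show "(\<Oplus>b. (s\<^sup>2 *\<^sub>R g x) $ a $ b * matrix_inv (s\<^sup>2 *\<^sub>R g x) $ b $ c) = (if a = c then 1 else 0)" for a c
    by (rule sum_matrix_inv(1)[OF invs[OF x]])
  have pdsym: "pd e (\<lambda>y. g y $ a $ b) x = pd e (\<lambda>y. g y $ b $ a) x" for e a b
    by (rule pd_cong[OF V x]) (rule sym)
  show "christoffel g x c a b = christoffel g x c b a" for c a b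
    unfolding christoffel_def by (simp add: add.commute pdsym[of _ a b])
  have lower: "(\<Oplus>d. christoffel g x d e a * g x $ d $ b)
      = (pd e (\<lambda>y. g y $ b $ a) x + pd a (\<lambda>y. g y $ b $ e) x - pd b (\<lambda>y. g y $ e $ a) x) / 2" for e a b
  proof -
    let ?v = "\<lambda>f. pd e (\<lambda>y. g y $ f $ a) x + pd a (\<lambda>y. g y $ f $ e) x - pd f (\<lambda>y. g y $ e $ a) x"
    have "(\<Oplus>d. christoffel g x d e a * g x $ d $ b)
        = (\<Oplus>d f. (g x $ b $ d * matrix_inv (g x) $ d $ f) * (?v f / 2))"
      unfolding christoffel_def sum_distrib_right by (intro sum.cong refl) (simp add: sym[OF x, of b])
    also have "\<dots> = (\<Oplus>f. (\<Oplus>d. g x $ b $ d * matrix_inv (g x) $ d $ f) * (?v f / 2))"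
      unfolding sum_distrib_right by (rule sum.swap)
    finally show ?thesis by (simp only: sum_matrix_inv(1)[OF inv[OF x]] sum_delta_mult)
  qed
  show "pd e (\<lambda>y. (s\<^sup>2 *\<^sub>R g y) $ a $ b) x = (\<Oplus>d. christoffel g x d e a * (s\<^sup>2 *\<^sub>R g x) $ d $ b)
      + (\<Oplus>d. christoffel g x d e b * (s\<^sup>2 *\<^sub>R g x) $ a $ d)" for e a b
  proof -
    have "pd e (\<lambda>y. (s\<^sup>2 *\<^sub>R g y) $ a $ b) x = s\<^sup>2 * pd e (\<lambda>y. g y $ a $ b) x"
      using pd_cmult[OF smooth_on_differentiable[OF sm x]] by simp
    also have "pd e (\<lambda>y. g y $ a $ b) x = (\<Oplus>d. christoffel g x d e a * g x $ d $ b) + (\<Oplus>d. christoffel g x d e b * g x $ d $ a)"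
      unfolding lower using pdsym[of e a b] pdsym[of a b e] pdsym[of b e a] by (simp add: field_simps)
    finally show ?thesis
      by (simp add: distrib_left sum_distrib_left mult.left_commute sym[OF x, of _ a])
  qed
qed

section \<open>Sections of weighted bundles along a parallel section of the ray bundle\<close>

text \<open>
  The operators with the arguments \<open>g\<close> and \<open>\<sigma>\<close>, on weighted fields restricted to the section
  \<open>y \<mapsto> s\<^sup>2 g y\<close> over a patch. They involve the fields on this section only, because \<open>\<sigma>\<close> equals \<open>s\<close> on all
  of it.
\<close>

locale einstein_slice =
  einstein_patch V "scaled g s" "scaled_inv g s" "christoffel g" kap
  for V :: "(real ^ 'n::finite) set" and g :: "real ^ 'n \<Rightarrow> real ^ 'n ^ 'n" and s kap :: real +
  fixes \<sigma> :: "'n density"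
  assumes s_pos: "s > 0"
    and \<sigma>_slice: "y \<in> V \<Longrightarrow> \<sigma> y (s\<^sup>2 *\<^sub>R g y) = s"
    and schouten_slice: "y \<in> V \<Longrightarrow> schouten g y a b = lam * scaled g s y a b"
    and invertible_slice: "y \<in> V \<Longrightarrow> invertible (s\<^sup>2 *\<^sub>R g y)"
begin

declare vector_scaleR_component [simp del] scaled_def [symmetric, simp] scaled_inv_def [symmetric, simp]

definition slice :: "(real ^ 'n \<Rightarrow> real ^ 'n ^ 'n \<Rightarrow> 'j list \<Rightarrow> real) \<Rightarrow> real ^ 'n \<Rightarrow> 'j list \<Rightarrow> real" where
  "slice F = (\<lambda>y. F y (s\<^sup>2 *\<^sub>R g y))"

lemma nabla_form_slice:
  assumes x: "x \<in> V"
  shows "nabla_form g \<sigma> f x (s\<^sup>2 *\<^sub>R g x) J = D (slice f) x J"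
proof (cases J)
  case (Cons a I)
  then show ?thesis
    by (simp add: nabla_form_def \<sigma>_slice[OF x] D_Cons act_def slice_def sum_negf)
qed (simp add: nabla_form_def)

lemma codiff_slice: "x \<in> V \<Longrightarrow> codiff g \<sigma> f x (s\<^sup>2 *\<^sub>R g x) I = codf (slice f) x I"
  by (simp add: codiff_def codf_def nabla_form_slice)

lemma ext_d_slice:
  assumes "form m (slice f)" "x \<in> V" "length J = Suc m"
  shows "ext_d g \<sigma> f x (s\<^sup>2 *\<^sub>R g x) J = extd (slice f) x J"
proof -
  have "nabla_form g \<sigma> f x (s\<^sup>2 *\<^sub>R g x) = D (slice f) x"
    using nabla_form_slice[OF assms(2)] by (simp add: fun_eq_iff)
  then show ?thesis using extd_eq_alt[OF assms] assms(3) by (simp add: ext_d_def)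
qed

lemma tractor_conn_slice:
  assumes x: "x \<in> V"
  shows "tractor_conn g x (s\<^sup>2 *\<^sub>R g x) a v A = (\<Oplus>B. (om0 x a A B + theta x a A B) * v B)"
proof (cases A)
  case TY
  then show ?thesis by (simp add: sum_tix sum_negf)
next
  case (TZ b)
  then show ?thesis by (simp add: sum_tix sum_negf schouten_slice[OF x] algebra_simps)
next
  case TX
  have "(\<Oplus>b c. schouten g x a b * scaled_inv g s x b c * v (TZ c))
      = lam * (\<Oplus>b. scaled g s x a b * (\<Oplus>c. scaled_inv g s x b c * v (TZ c)))"
    unfolding schouten_slice[OF x] sum_distrib_left by (simp add: mult_ac)
  also have "\<dots> = lam * v (TZ a)" unfolding lower_raise[OF x] ..
  finally show ?thesis
    unfolding TX by (simp add: sum_tix sum_negf mult.assoc flip: sum_distrib_left)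
qed

lemma nabla_tractor_slice:
  assumes x: "x \<in> V"
  shows "nabla g \<sigma> (\<lambda>y H I. F y H) x (s\<^sup>2 *\<^sub>R g x) [a] As = tD (slice F) x a As"
  by (simp add: \<sigma>_slice[OF x] tractor_conn_slice[OF x] tD_def act_def slice_def)

lemma tractor_laplacian_slice:
  assumes x: "x \<in> V"
  shows "tractor_laplacian g \<sigma> F x (s\<^sup>2 *\<^sub>R g x) As = tLap (slice F) x As"
proof -
  let ?N = "nabla g \<sigma> (\<lambda>y H I. F y H)"
  have "nabla g \<sigma> ?N x (s\<^sup>2 *\<^sub>R g x) [a, b] As = pd a (\<lambda>y. ?N y (s\<^sup>2 *\<^sub>R g y) [b] As) x
      - (\<Oplus>c. christoffel g x c a b * ?N x (s\<^sup>2 *\<^sub>R g x) [c] As)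
      + act (\<lambda>A B. om0 x a A B + theta x a A B) (?N x (s\<^sup>2 *\<^sub>R g x) [b]) As" for a b
    by (subst nabla.simps) (simp add: \<sigma>_slice[OF x] tractor_conn_slice[OF x] act_def del: nabla.simps)
  moreover have "pd a (\<lambda>y. ?N y (s\<^sup>2 *\<^sub>R g y) [b] As) x = pd a (\<lambda>y. tD (slice F) y b As) x" for a b
    by (rule pd_cong[OF open_U x]) (rule nabla_tractor_slice)
  moreover have "?N x (s\<^sup>2 *\<^sub>R g x) [b] = tD (slice F) x b" for b
    using nabla_tractor_slice[OF x] by (simp add: fun_eq_iff del: nabla.simps)
  ultimately show ?thesis by (simp add: tractor_laplacian_def tLap_def del: nabla.simps)
qed

lemma J_trace_slice:
  assumes x: "x \<in> V"
  shows "J_trace g x (s\<^sup>2 *\<^sub>R g x) = real CARD('n) * lam"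
proof -
  have "J_trace g x (s\<^sup>2 *\<^sub>R g x) = (\<Oplus>a. lam * (\<Oplus>b. scaled_inv g s x a b * scaled g s x b a))"
    unfolding J_trace_def schouten_slice[OF x] sum_distrib_left scaled_inv_def[symmetric]
    by (intro sum.cong refl) (subst h_sym[OF x], simp)
  then show ?thesis unfolding hi_h[OF x] by simp
qed

lemma Riem_riemann: "Riem x a b c d = riemann g x a b c d"
  by (simp add: Riem_def riemann_def)

lemma weyl_slice:
  assumes x: "x \<in> V"
  shows "weyl g x (s\<^sup>2 *\<^sub>R g x) a b c d = weyl_low x a b c d"
  unfolding weyl_def weyl_low_def Rl_def Riem_riemann schouten_slice[OF x] scaled_def[symmetric]
  using h_sym[OF x, of a c] h_sym[OF x, of b c] h_sym[OF x, of a d] h_sym[OF x, of b d]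
  by (simp add: lam_def algebra_simps)

lemma Z_low_simps [simp]: "Z_low TY a = 0" "Z_low TX a = 0" "Z_low (TZ b) a = (if b = a then 1 else 0)"
  by (simp_all add: Z_low_def)

lemma W_tilde_lift: "W_tilde g x G A B C E = tix_lift (weyl g x G) A B C E"
proof (cases "\<exists>a b c d. A = TZ a \<and> B = TZ b \<and> C = TZ c \<and> E = TZ d")
  case True
  then obtain a b c d where *: "A = TZ a" "B = TZ b" "C = TZ c" "E = TZ d" by blast
  show ?thesis unfolding * W_tilde_def by (simp add: mult.assoc flip: sum_distrib_left)
next
  case False
  then show ?thesis by (cases A; cases B; cases C; cases E) (auto simp: W_tilde_def)
qed

lemma W_tilde_up_slice:
  assumes x: "x \<in> V"
  shows "W_tilde_up g x (s\<^sup>2 *\<^sub>R g x) A B C E = tix_lift (weyl_up x) A B C E"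
proof (cases "\<exists>a b. A = TZ a \<and> B = TZ b")
  case True
  then obtain a b where *: "A = TZ a" "B = TZ b" by blast
  show ?thesis
    unfolding * W_tilde_up_def W_tilde_lift
    by (cases C; cases E) (simp_all add: sum_tix weyl_slice[OF x] weyl_up_def)
next
  case False
  then have "tix_lift W A B C E = 0" for W C E by (cases A; cases B; auto)
  then show ?thesis by (simp add: W_tilde_up_def W_tilde_lift)
qed

lemma W_double_sharp_slice:
  assumes x: "x \<in> V" and F: "alternating k (slice F x)" and As: "length As = k"
  shows "W_double_sharp g F x (s\<^sup>2 *\<^sub>R g x) As = weyl_action_tractor (slice F) x As"
  using double_action_eq_alt[OF F As, of "tix_lift (weyl_up x)"] As
  by (simp add: W_double_sharp_def weyl_action_tractor_def W_tilde_up_slice[OF x] slice_def)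

lemma Box_slice:
  assumes x: "x \<in> V" and F: "alternating k (slice F x)" and As: "length As = k"
  shows "slice (Box g \<sigma> w F) x As = box s w (slice F) x As"
  unfolding slice_def[of "Box g \<sigma> w F"] Box_def box_def tractor_laplacian_slice[OF x]
    W_double_sharp_slice[OF x F As] J_trace_slice[OF x] \<sigma>_slice[OF x]
  by (simp add: slice_def lam_def field_simps)

lemma represents_cong:
  assumes "\<And>x As. x \<in> V \<Longrightarrow> length As = Suc m \<Longrightarrow> F x As = F' x As" "represents m F S"
  shows "represents m F' S"
proof (cases S)
  case (fields \<phi> b c)
  have F: "tractor_form (Suc m) F" using assms(2) fields by simp
  have "tractor_form (Suc m) F'"
    unfolding tractor_form_def
  proof (intro conjI ballI allI impI)
    show "smooth_field (Suc m) F'"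
      unfolding smooth_field_def
    proof (intro allI impI)
      fix As :: "'n tix list" assume "length As = Suc m"
      then show "smooth_on V (\<lambda>x. F' x As)"
        using assms(1) by (intro smooth_on_cong[OF open_U _ smooth_fieldD[OF tractor_formD(1)[OF F]]]) auto
    qed
    fix x assume x: "x \<in> V"
    show "alternating (Suc m) (F' x)"
      using tractor_formD(2)[OF F x] assms(1)[OF x] alternating_cong[of "Suc m" "F x" "F' x"] by simp
    fix I :: "'n list" assume "Suc (Suc (length I)) = Suc m"
    then show "F' x (TX # TY # map TZ I) = 0"
      using tractor_formD(3)[OF F x] assms(1)[OF x, of "TX # TY # map TZ I"] by simp
  qed
  moreover have eqs: "trunc (Suc m) (comp [] F') = trunc (Suc m) (comp [] F)"
    "trunc m (b_comp F') = trunc m (b_comp F)" "trunc m (comp [TY] F') = trunc m (comp [TY] F)"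
    using assms(1) by (auto simp: trunc_def comp_def fun_eq_iff)
  ultimately show ?thesis using assms(2) unfolding fields represents.simps eqs by blast
qed

lemma represents_tractor_form: "represents m F S \<Longrightarrow> tractor_form (Suc m) F"
  by (cases S) simp

lemma represents_Box_pow:
  assumes "represents m (slice F) S"
  shows "represents m (slice (Box_pow g \<sigma> p w F)) (hp.run m s p (w + real CARD('n) / 2) S)"
  using assms
proof (induction p arbitrary: w F S)
  case (Suc p)
  have "represents m (slice (Box g \<sigma> w F)) (hp.step m s (w + real CARD('n) / 2) S)"
  proof (rule represents_cong[OF _ represents_run_box[OF Suc.prems]])
    fix x and As :: "'n tix list" assume "x \<in> V" "length As = Suc m"
    then show "box s w (slice F) x As = slice (Box g \<sigma> w F) x As"
      using Box_slice tractor_formD(2)[OF represents_tractor_form[OF Suc.prems]] by metis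
  qed
  moreover have "w - 1 + real CARD('n) / 2 = w + real CARD('n) / 2 - 1" by simp
  ultimately show ?case
    using Suc.IH[of "Box g \<sigma> w F" _ "w - 1"] by (simp only: hp.run.simps Box_pow.simps)
qed simp

end

section \<open>The operators between forms and tractor forms\<close>

text \<open>
  A product of Kronecker deltas over all slots selects one list.
\<close>

lemma sum_lists_delta:
  fixes F :: "'i::finite list \<Rightarrow> real"
  assumes K: "length K = n"
  shows "(\<Sum>L | length L = n. (\<Prod>i<n. if L ! i = K ! i then 1 else 0) * F L) = F K"
proof -
  have fin: "finite {L :: 'i list. length L = n}"
    using finite_lists_length_eq[of "UNIV :: 'i set" n] by simp
  have "(\<Prod>i<n. if L ! i = K ! i then 1 else 0 :: real) = (if L = K then 1 else 0)" if "length L = n" for L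
  proof (cases "L = K")
    case False
    then have "\<exists>i<n. L ! i \<noteq> K ! i"
      using that K by (auto simp: list_eq_iff_nth_eq)
    then obtain i where "i < n" "L ! i \<noteq> K ! i" by blast
    then have "(\<Prod>i<n. if L ! i = K ! i then 1 else 0 :: real) = 0" by (intro prod_zero) auto
    then show ?thesis using False by simp
  qed simp
  then have "(\<Sum>L | length L = n. (\<Prod>i<n. if L ! i = K ! i then 1 else 0) * F L)
      = (\<Sum>L | length L = n. if L = K then F L else 0)"
    by (intro sum.cong) auto
  also have "\<dots> = F K" using fin K by simp
  finally show ?thesis .
qed

lemma Z_insert_map: "Z_insert f (map TZ I) = f I"
proof -
  have "Z_insert f (map TZ I) = (\<Sum>L | length L = length I. (\<Prod>i<length I. if L ! i = I ! i then 1 else 0) * f L)"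
    unfolding Z_insert_def by (intro sum.cong) (auto simp: Z_low_def intro!: prod.cong)
  then show ?thesis by (simp add: sum_lists_delta)
qed

lemma Z_insert_XY:
  assumes "A \<in> set As" "A \<in> {TX, TY}"
  shows "Z_insert f As = 0"
proof -
  obtain i where "i < length As" "As ! i = A" using assms(1) by (auto simp: in_set_conv_nth)
  then have z: "(\<Prod>i<length As. Z_low (As ! i) (I ! i)) = 0" for I
    using assms(2) by (intro prod_zero bexI[of _ i]) (auto simp: Z_low_def)
  show ?thesis by (simp only: Z_insert_def z mult_zero_left sum.neutral_const)
qed

lemma tix_list_cases:
  fixes As :: "'n tix list"
  obtains I where "As = map TZ I" | A where "A \<in> set As" "A \<in> {TX, TY}"
proof (cases "set As \<subseteq> range TZ")
  case True
  then have "\<exists>I. As = map TZ I"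
  proof (induction As)
    case (Cons A As)
    then obtain a I where "A = TZ a" "As = map TZ I" by auto
    then show ?case by (intro exI[of _ "a # I"]) simp
  qed simp
  then show ?thesis using that(1) by blast
next
  case False
  then obtain A where A: "A \<in> set As" "A \<notin> range TZ" by blast
  have "A \<in> {TX, TY}"
  proof (cases A)
  qed (use A(2) in auto)
  with A(1) show ?thesis by (rule that(2))
qed

lemma alternating_Z_insert:
  assumes "alternating k f"
  shows "alternating k (Z_insert f)"
  unfolding alternating_def
proof (intro allI impI)
  fix As :: "'a tix list" and i j assume *: "length As = k" "i < k" "j < k" "i \<noteq> j"
  show "Z_insert f (As[i := As ! j, j := As ! i]) = - Z_insert f As"
  proof (cases As rule: tix_list_cases)
    case (1 I)
    then have "As[i := As ! j, j := As ! i] = map TZ (I[i := I ! j, j := I ! i])"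
      using * by (simp add: map_update)
    then show ?thesis
      using alternatingD[OF assms, of I i j] * unfolding 1 by (simp add: Z_insert_map del: map_update)
  next
    case (2 A)
    moreover have "set (As[i := As ! j, j := As ! i]) = set As"
      using * by (intro set_swap) auto
    ultimately show ?thesis using Z_insert_XY[of A] by simp
  qed
qed

context einstein_slice
begin

lemma Z_up_slice:
  assumes x: "x \<in> V"
  shows "Z_up (s\<^sup>2 *\<^sub>R g x) A a = (if A = TZ a then 1 else 0)"
  using hi_h[OF x, of _ a]
  by (cases A) (simp_all add: Z_up_def sum_tix mult.assoc flip: sum_distrib_left)

lemma q_op_slice:
  assumes x: "x \<in> V"
  shows "q_op F x (s\<^sup>2 *\<^sub>R g x) I = slice F x (map TZ I)"
proof -
  have "q_op F x (s\<^sup>2 *\<^sub>R g x) I = (\<Sum>As | length As = length I.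
      (\<Prod>i<length I. if As ! i = map TZ I ! i then 1 else 0) * F x (s\<^sup>2 *\<^sub>R g x) As)"
    unfolding q_op_def Z_contract_def Z_up_slice[OF x] by (intro sum.cong) (auto intro!: prod.cong)
  also have "\<dots> = F x (s\<^sup>2 *\<^sub>R g x) (map TZ I)" by (rule sum_lists_delta) simp
  finally show ?thesis by (simp add: slice_def)
qed

lemma X_contract_slice:
  assumes x: "x \<in> V"
  shows "slice (X_contract F) x I = comp [TY] (slice F) x I"
proof -
  have "Z_contract (s\<^sup>2 *\<^sub>R g x) (\<lambda>As. F x (s\<^sup>2 *\<^sub>R g x) (A # As)) I = F x (s\<^sup>2 *\<^sub>R g x) (A # map TZ I)" for A
    using q_op_slice[OF x, of "\<lambda>y H As. F y H (A # As)" I] by (simp add: q_op_def slice_def)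
  then show ?thesis
    by (simp add: slice_def X_contract_def X_up_def X_low_def sum_tix comp_def)
qed

text \<open>
  The \<open>Y\<close> component of \<open>M f\<close> vanishes, so that its \<open>X\<close> component \<open>\<delta> f / k\<close> is also the coefficient \<open>b\<close>.
\<close>

lemma M_op_slice:
  assumes f: "form (Suc m) (slice f)"
  shows "represents m (slice (M_op g \<sigma> (Suc m) w f))
    (hp.init m (1 / real (Suc m)) (w - real (Suc m) + real CARD('n) / 2) (trunc (Suc m) (slice f)))"
proof -
  let ?F = "slice (M_op g \<sigma> (Suc m) w f)" and ?n = "real CARD('n)" and ?k = "real (Suc m)"
  let ?T = "\<lambda>x Bs. X_low (hd Bs) * Z_insert (codf (slice f) x) (tl Bs)"
  have cf: "form m (codf (slice f))" by (rule form_codf[OF f])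
  have F: "?F x As = (?n + w - 2 * ?k) / ?k * Z_insert (slice f x) As + alt (?T x) As" if "x \<in> V" for x As
  proof -
    have "codiff g \<sigma> f x (s\<^sup>2 *\<^sub>R g x) = codf (slice f) x"
      using codiff_slice[OF that] by (simp add: fun_eq_iff)
    then show ?thesis by (simp add: slice_def M_op_def)
  qed
  have alt_T: "?k * alt (?T x) (A # L) = ?T x (A # L) - (\<Sum>j<m. ?T x (L ! j # L[j := A]))"
    if "x \<in> V" "length L = m" for x A L
  proof (rule alt_tail_alternating[OF _ that(2)])
    show "alternating m (\<lambda>K. ?T x (a # K))" for a
      using alternating_cmult[OF alternating_Z_insert[OF formD(2)[OF cf that(1)]]] by simp
  qed
  have FZ: "?F x (map TZ I) = (?n + w - 2 * ?k) / ?k * slice f x I" if xI: "x \<in> V" "length I = Suc m" for x I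
  proof -
    obtain i K where I: "I = i # K" "length K = m" using xI(2) by (cases I) auto
    have "?k * alt (?T x) (TZ i # map TZ K) = 0"
      using I xI by (subst alt_T) (auto simp: X_low_def)
    then show ?thesis unfolding F[OF xI(1)] using Z_insert_map[of "slice f x" I] I by simp
  qed
  have FX: "?F x (TX # map TZ I) = 1 / ?k * codf (slice f) x I" if "x \<in> V" "length I = m" for x I
  proof -
    have "?k * alt (?T x) (TX # map TZ I) = codf (slice f) x I"
      using that by (subst alt_T) (auto simp: X_low_def Z_insert_map)
    then show ?thesis unfolding F[OF that(1)] using Z_insert_XY[of TX "TX # map TZ I" "slice f x"] by (simp add: field_simps)
  qed
  have FY: "?F x (TY # map TZ I) = 0" if "x \<in> V" "length I = m" for x I
  proof -
    have "?k * alt (?T x) (TY # map TZ I) = 0"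
      using that by (subst alt_T) (auto simp: X_low_def)
    then show ?thesis unfolding F[OF that(1)] using Z_insert_XY[of TY "TY # map TZ I" "slice f x"] by simp
  qed
  have FXY: "?F x (TX # TY # map TZ I) = 0" if "x \<in> V" "Suc (Suc (length I)) = Suc m" for x I
  proof -
    have z: "Z_insert h (TY # L) = 0" for h and L :: "'n tix list" using Z_insert_XY[of TY "TY # L" h] by simp
    have j0: "?T x ((TY # map TZ I) ! j # (TY # map TZ I)[j := TX]) = 0" if "j < m" for j
      using that \<open>Suc (Suc (length I)) = Suc m\<close> by (cases j) (auto simp: X_low_def)
    have "?k * alt (?T x) (TX # TY # map TZ I) = ?T x (TX # TY # map TZ I) - (\<Sum>j<m. ?T x ((TY # map TZ I) ! j # (TY # map TZ I)[j := TX]))"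
      using that by (intro alt_T) auto
    also have "(\<Sum>j<m. ?T x ((TY # map TZ I) ! j # (TY # map TZ I)[j := TX])) = 0"
      by (intro sum.neutral ballI j0) simp
    also have "?T x (TX # TY # map TZ I) - 0 = 0" using z by simp
    finally show ?thesis unfolding F[OF that(1)] using Z_insert_XY[of TX "TX # TY # map TZ I" "slice f x"] by simp
  qed
  have smooth_Z: "smooth_on V (\<lambda>x. Z_insert (h x) As)" if "form k h" "length As = k" for h k and As :: "'n tix list"
    unfolding Z_insert_def using that
    by (intro smooth_on_sum smooth_on_mult smooth_on_const open_U smooth_fieldD[OF formD(1)[OF that(1)]]) auto
  have tf: "tractor_form (Suc m) ?F"
    unfolding tractor_form_def
  proof (intro conjI ballI allI impI)
    show "smooth_field (Suc m) ?F"
      unfolding smooth_field_def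
    proof (intro allI impI)
      fix As :: "'n tix list" assume As: "length As = Suc m"
      have "smooth_on V (\<lambda>x. alt (?T x) As)"
        unfolding alt_def divide_inverse using As
        by (intro smooth_on_mult smooth_on_sum smooth_on_const open_U smooth_Z[OF cf]) simp
      then have "smooth_on V (\<lambda>x. (?n + w - 2 * ?k) / ?k * Z_insert (slice f x) As + alt (?T x) As)"
        by (intro smooth_on_add smooth_on_mult smooth_on_const open_U smooth_Z[OF f As])
      then show "smooth_on V (\<lambda>x. ?F x As)"
        by (rule smooth_on_cong[OF open_U, rotated -1]) (simp only: F)
    qed
    fix x assume x: "x \<in> V"
    show "alternating (Suc m) (?F x)"
      unfolding F[OF x, abs_def]
      by (intro alternating_add alternating_cmult alternating_Z_insert alternating_alt formD(2)[OF f x])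
  qed (rule FXY)
  let ?h = "trunc (Suc m) (slice f)"
  have hk: "?h \<in> kforms (Suc m)" by (rule trunc_in_kforms[OF f])
  have del: "delT m ?h x I = codf (slice f) x I" if "x \<in> V" "length I = m" for x I
  proof -
    have "codf ?h x I = codf (slice f) x I" by (rule codf_cong) (use that in \<open>auto simp: trunc_apply\<close>)
    then show ?thesis using that by (simp add: delT_def trunc_apply)
  qed
  have tt: "1 / ?k * hp.tt m (w - ?k + ?n / 2) = (?n + w - 2 * ?k) / ?k"
    unfolding hp.tt_def by (simp add: field_simps)
  have "(\<lambda>x I. 1 / ?k * hp.tt m (w - ?k + ?n / 2) * ?h x I) = trunc (Suc m) (comp [] ?F)"
  proof (intro ext)
    fix x and I :: "'n list"
    show "1 / ?k * hp.tt m (w - ?k + ?n / 2) * ?h x I = trunc (Suc m) (comp [] ?F) x I"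
      unfolding tt using FZ by (simp add: trunc_def comp_def)
  qed
  moreover have "(\<lambda>x I. 1 / ?k * delT m ?h x I) = trunc m (b_comp ?F)"
  proof (intro ext)
    fix x and I :: "'n list"
    show "1 / ?k * delT m ?h x I = trunc m (b_comp ?F) x I"
      using FX[of x I] FY[of x I] del[of x I] by (auto simp: trunc_def comp_def delT_def)
  qed
  moreover have "(\<lambda>x I. 0) = trunc m (comp [TY] ?F)"
    using FY by (auto simp: trunc_def comp_def fun_eq_iff)
  ultimately show ?thesis
    unfolding hp.init_def represents.simps
    using tf hp.Vc_scale[OF hp.del_Vc[OF hk], of "1 / ?k"] hp.Vc_zero[OF hk] by simp
qed

lemma M_op_Box_pow_slice:
  assumes "form (Suc m) (slice f)"
  shows "represents m (slice (Box_pow g \<sigma> p (w - real (Suc m)) (M_op g \<sigma> (Suc m) w f)))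
    (hp.run m s p (w - real (Suc m) + real CARD('n) / 2)
      (hp.init m (1 / real (Suc m)) (w - real (Suc m) + real CARD('n) / 2) (trunc (Suc m) (slice f))))"
  by (rule represents_Box_pow[OF M_op_slice[OF assms]])

lemma L_op_slice:
  assumes f: "form (Suc m) (slice f)" and x: "x \<in> V" and I: "length I = Suc m"
  shows "L_op g \<sigma> (Suc m) l f x (s\<^sup>2 *\<^sub>R g x) I
    = s powi (- int l) * fst (hp.run m s l (real l) (hp.init m (1 / real (Suc m)) (real l) (trunc (Suc m) (slice f)))) x I"
proof -
  define w where "w = L_weight TYPE('n) (Suc m) l"
  have w: "w - real (Suc m) + real CARD('n) / 2 = real l" by (simp add: w_def L_weight_def)
  obtain \<phi> b c where S: "hp.run m s l (real l) (hp.init m (1 / real (Suc m)) (real l) (trunc (Suc m) (slice f))) = (\<phi>, b, c)"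
    by (metis prod_cases3)
  have "\<phi> = trunc (Suc m) (comp [] (slice (Box_pow g \<sigma> l (w - real (Suc m)) (M_op g \<sigma> (Suc m) w f))))"
    using M_op_Box_pow_slice[OF f, of l w] unfolding w S by simp
  then have "q_op (Box_pow g \<sigma> l (w - real (Suc m)) (M_op g \<sigma> (Suc m) w f)) x (s\<^sup>2 *\<^sub>R g x) I = \<phi> x I"
    using x I by (simp add: q_op_slice trunc_apply comp_def)
  then show ?thesis unfolding S by (simp add: L_op_def Let_def w_def \<sigma>_slice[OF x])
qed

text \<open>
  The contraction with \<open>X\<close> in \<open>M\<^sup>*\<close> picks the \<open>Y\<close> component, which is \<open>c\<close>.
\<close>

lemma Box_tilde_slice:
  assumes f: "form (Suc m) (slice f)"
    and S: "hp.run m s p (w - real (Suc m) + real CARD('n) / 2)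
      (hp.init m (1 / real (Suc m)) (w - real (Suc m) + real CARD('n) / 2) (trunc (Suc m) (slice f))) = (\<phi>, b, c)"
  shows "form (Suc m) (slice (Box_tilde g \<sigma> (Suc m) p w f))"
    and "trunc (Suc m) (slice (Box_tilde g \<sigma> (Suc m) p w f)) = (\<lambda>x I. (- (w - real p)) * \<phi> x I + dT m c x I)"
proof -
  let ?F = "Box_pow g \<sigma> p (w - real (Suc m)) (M_op g \<sigma> (Suc m) w f)" and ?B = "Box_tilde g \<sigma> (Suc m) p w f"
  have R: "represents m (slice ?F) (\<phi>, b, c)" using M_op_Box_pow_slice[OF f, of p w] unfolding S .
  then have F: "tractor_form (Suc m) (slice ?F)" and eqs: "\<phi> = trunc (Suc m) (comp [] (slice ?F))" "c = trunc m (comp [TY] (slice ?F))"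
    by auto
  have fY: "form m (comp [TY] (slice ?F))" and fZ: "form (Suc m) (comp [] (slice ?F))"
    using form_comp_A[OF F] form_comp_Z[OF F] by auto
  have fX: "form m (slice (X_contract ?F))"
    by (rule form_cong[OF _ fY]) (simp add: X_contract_slice)
  have B: "slice ?B x I = (- (w - real p)) * comp [] (slice ?F) x I + 1 * extd (comp [TY] (slice ?F)) x I"
    if x: "x \<in> V" and I: "length I = Suc m" for x I
  proof -
    have "slice ?B x I = M_star g \<sigma> (Suc m) (w - real (Suc m) - real p) ?F x (s\<^sup>2 *\<^sub>R g x) I"
      by (simp add: slice_def Box_tilde_def)
    also have "\<dots> = - (w - real p) * comp [] (slice ?F) x I + extd (slice (X_contract ?F)) x I"
      unfolding M_star_def ext_d_slice[OF fX x I] q_op_slice[OF x] by (simp add: comp_def)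
    also have "extd (slice (X_contract ?F)) x I = extd (comp [TY] (slice ?F)) x I"
      by (rule extd_cong) (use x in \<open>auto simp: X_contract_slice\<close>)
    finally show ?thesis by simp
  qed
  show "form (Suc m) (slice ?B)"
    by (rule form_cong[OF _ form_lin[OF fZ form_extd[OF fY]]]) (simp only: B)
  show "trunc (Suc m) (slice ?B) = (\<lambda>x I. (- (w - real p)) * \<phi> x I + dT m c x I)"
  proof (intro ext)
    fix x and I :: "'n list"
    have "extd c x I = extd (comp [TY] (slice ?F)) x I" if "x \<in> V" "length I = Suc m"
      by (rule extd_cong) (use that in \<open>auto simp: eqs trunc_apply\<close>)
    then show "trunc (Suc m) (slice ?B) x I = (- (w - real p)) * \<phi> x I + dT m c x I"
      using B by (auto simp: trunc_def eqs(1) dT_def)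
  qed
qed

theorem factorisation_slice:
  assumes f: "form (Suc m) (slice f)" and x: "x \<in> V" and I: "length I = Suc m" and pl: "p < l"
  defines "k \<equiv> real (Suc m)" and "n \<equiv> real CARD('n)"
  shows "1 / k * (k + (real l - real p) - n / 2) * (k - (real l - real p) - n / 2)
      * L_op g \<sigma> (Suc m) l f x (s\<^sup>2 *\<^sub>R g x) I
    = s powi (- int p) * L_op g \<sigma> (Suc m) (l - p)
        (Box_tilde g \<sigma> (Suc m) p (k + real l - n / 2) f) x (s\<^sup>2 *\<^sub>R g x) I"
proof -
  define q where "q = l - p"
  have q: "q \<ge> 1" "l = q + p" using pl by (auto simp: q_def)
  define w where "w = k + real l - n / 2"
  have w: "w - real (Suc m) + real CARD('n) / 2 = real (q + p)" by (simp add: w_def k_def n_def q)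
  let ?h = "trunc (Suc m) (slice f)" and ?B = "Box_tilde g \<sigma> (Suc m) p w f"
  have h: "?h \<in> kforms (Suc m)" by (rule trunc_in_kforms[OF f])
  obtain \<phi> b c where S: "hp.run m s p (real (q + p)) (hp.init m (1 / k) (real (q + p)) ?h) = (\<phi>, b, c)"
    by (metis prod_cases3)
  note B = Box_tilde_slice[OF f, of p w \<phi> b c, unfolded w, folded k_def, OF S]
  have yy: "hp.yy m (real q) = w - real p" unfolding hp.yy_def by (simp add: w_def k_def n_def q field_simps)
  have run: "hp.run m s l (real l) (hp.init m (1 / k) (real l) ?h) = hp.run m s q (real q) (\<phi>, b, c)"
  proof -
    have "hp.run m s (a + q) r S' = hp.run m s q (r - real a) (hp.run m s a r S')" for a r S'
    proof (induction a arbitrary: r S')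
      case (Suc a)
      have "r - 1 - real a = r - real (Suc a)" by simp
      then show ?case using Suc[of "r - 1"] by (simp only: hp.run.simps add_Suc)
    qed simp
    from this[of p "real (q + p)"] show ?thesis by (simp only: q(2) add.commute[of q p] S[unfolded add.commute[of q p]]) simp
  qed
  have "L_op g \<sigma> (Suc m) q ?B x (s\<^sup>2 *\<^sub>R g x) I
      = s powi (- int q) * fst (hp.run m s q (real q) (hp.init m (1 / k) (real q)
          (\<lambda>x i. (- hp.yy m (real q)) * \<phi> x i + dT m c x i))) x I"
    unfolding L_op_slice[OF B(1) x I] B(2) yy k_def ..
  also have "\<dots> = s powi (- int q) * ((- (1 / k) * hp.yy m (real q) * hp.tt m (real q))
      * fst (hp.run m s q (real q) (\<phi>, b, c)) x I)"
    unfolding hp.factorisation[OF h q(1) S] ..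
  finally have "s powi (- int p) * L_op g \<sigma> (Suc m) q ?B x (s\<^sup>2 *\<^sub>R g x) I
      = (s powi (- int p) * s powi (- int q)) * ((- (1 / k) * hp.yy m (real q) * hp.tt m (real q))
      * fst (hp.run m s q (real q) (\<phi>, b, c)) x I)" by simp
  also have "s powi (- int p) * s powi (- int q) = s powi (- int l)"
    using s_pos by (simp add: q(2) power_int_add[symmetric] algebra_simps)
  also have "- (1 / k) * hp.yy m (real q) * hp.tt m (real q)
      = 1 / k * (k + (real l - real p) - n / 2) * (k - (real l - real p) - n / 2)"
    unfolding hp.yy_def hp.tt_def by (simp add: k_def n_def q field_simps)
  finally show ?thesis
    unfolding L_op_slice[OF f x I] k_def[symmetric] run w_def[symmetric] q_def[symmetric] by simp
qed

end

section \<open>Einstein scales give Einstein slices\<close>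

lemma has_derivative_zero_pd:
  fixes f :: "real ^ 'n::finite \<Rightarrow> real"
  assumes "f differentiable (at x)" "\<And>e. pd e f x = 0"
  shows "(f has_derivative (\<lambda>v. 0)) (at x)"
proof -
  obtain L where L: "(f has_derivative L) (at x)" using assms(1) differentiable_def by blast
  have lin: "linear L" using L has_derivative_linear by blast
  have "L (axis e 1) = 0" for e using pd_eqI[OF L, of e] assms(2) by simp
  then have "L v = 0" for v
  proof -
    assume z: "\<And>e. L (axis e 1) = 0"
    have "L v = L (\<Oplus>i. (v $ i) *\<^sub>R axis i 1)"
      using basis_expansion[of v] by (simp add: scalar_mult_eq_scaleR)
    also have "\<dots> = (\<Oplus>i. (v $ i) *\<^sub>R L (axis i 1))"
      by (simp add: linear_sum[OF lin] linear_cmul[OF lin])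
    finally show ?thesis by (simp add: z)
  qed
  then have "L = (\<lambda>v. 0)" by auto
  with L show ?thesis by simp
qed

text \<open>
  The Einstein factor has vanishing derivative by \<open>schur\<close>. It need not be the same on all of \<open>W\<close>, which may
  be disconnected, but it is constant on a ball.
\<close>

lemma einstein_slice_exists:
  fixes g :: "real ^ 'n::finite \<Rightarrow> real ^ 'n ^ 'n"
  assumes n: "CARD('n) \<ge> 3" and g: "regular_metric W g" and s: "s > 0" and x: "x \<in> W"
    and ein: "\<And>y. y \<in> W \<Longrightarrow> \<exists>c0. \<forall>a b. ricci g y a b = c0 * g y $ a $ b"
    and \<sigma>: "\<And>y. y \<in> W \<Longrightarrow> \<sigma> y (s\<^sup>2 *\<^sub>R g y) = s"
  obtains V kap where "x \<in> V" "V \<subseteq> W" "einstein_slice V g s kap \<sigma>"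
proof -
  interpret W: levi_civita W "scaled g s" "scaled_inv g s" "christoffel g"
    by (rule levi_civita_christoffel[OF g s])
  have W: "open W" and sm: "\<And>i j. smooth_on W (\<lambda>x. g x $ i $ j)"
    and inv: "\<And>y. y \<in> W \<Longrightarrow> invertible (g y)" using g by (auto simp: regular_metric_def)
  have sym: "g y $ a $ b = g y $ b $ a" if "y \<in> W" for y a b
    using g that by (auto simp: regular_metric_def transpose_self_iff)
  have Riem: "(\<Oplus>a. W.Riem y a b a d) = ricci g y b d" for y b d
    by (simp add: W.Riem_def ricci_def riemann_def)
  define \<rho> where "\<rho> y = (\<Oplus>a b. scaled_inv g s y a b * ricci g y a b) * inverse (real CARD('n))" for y
  have smooth_\<rho>: "smooth_on W \<rho>"
    unfolding \<rho>_def[abs_def] Riem[symmetric]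
    by (intro smooth_on_mult smooth_on_sum smooth_on_const W W.smooth_hi W.smooth_Riem)
  have ric: "ricci g y a b = \<rho> y * scaled g s y a b" if y: "y \<in> W" for y a b
  proof -
    obtain c0 where c0: "\<And>a b. ricci g y a b = c0 * g y $ a $ b" using ein[OF y] by blast
    have c1: "ricci g y a b = c0 / s\<^sup>2 * scaled g s y a b" for a b
      using s by (simp add: c0 scaled_def)
    have "(\<Oplus>a b. scaled_inv g s y a b * ricci g y a b)
        = (\<Oplus>a. c0 / s\<^sup>2 * (\<Oplus>b. scaled_inv g s y a b * scaled g s y b a))"
    proof -
      have "scaled_inv g s y a b * ricci g y a b = c0 / s\<^sup>2 * (scaled_inv g s y a b * scaled g s y b a)" for a b
        unfolding c1 W.h_sym[OF y, of a b] by (rule mult.left_commute)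
      then show ?thesis by (simp only: sum_distrib_left)
    qed
    also have "\<dots> = c0 / s\<^sup>2 * real CARD('n)" unfolding W.hi_h[OF y] by simp
    finally have "\<rho> y = c0 / s\<^sup>2" unfolding \<rho>_def by simp
    then show ?thesis by (simp add: c1)
  qed
  have pd\<rho>: "pd e \<rho> y = 0" if y: "y \<in> W" for e y
    by (rule W.schur[OF n smooth_\<rho> _ y]) (simp add: Riem ric)
  obtain r where r: "r > 0" "ball x r \<subseteq> W" using W x openE by blast
  have "\<exists>\<rho>0. \<forall>y\<in>ball x r. \<rho> y = \<rho>0"
  proof (rule has_derivative_zero_constant[OF convex_ball])
    fix y assume "y \<in> ball x r"
    then have y: "y \<in> W" using r by auto
    show "(\<rho> has_derivative (\<lambda>h. 0)) (at y within ball x r)"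
      by (rule has_derivative_at_withinI[OF has_derivative_zero_pd[OF smooth_on_differentiable[OF smooth_\<rho> y] pd\<rho>[OF y]]])
  qed
  then obtain \<rho>0 where \<rho>0: "\<And>y. y \<in> ball x r \<Longrightarrow> \<rho> y = \<rho>0" by blast
  define kap where "kap = \<rho>0 / (real CARD('n) - 1)"
  have kap: "(real CARD('n) - 1) * kap = \<rho>0" using n by (simp add: kap_def)
  have V: "regular_metric (ball x r) g"
    using g r smooth_on_subset[OF sm r(2)] by (auto simp: regular_metric_def)
  interpret V: levi_civita "ball x r" "scaled g s" "scaled_inv g s" "christoffel g"
    by (rule levi_civita_christoffel[OF V s])
  interpret P: einstein_patch "ball x r" "scaled g s" "scaled_inv g s" "christoffel g" kap
  proof
    fix y b d assume y: "y \<in> ball x r"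
    show "(\<Oplus>a. V.Riem y a b a d) = (real CARD('n) - 1) * kap * scaled g s y b d"
      using y r by (auto simp: Riem ric \<rho>0 kap)
  qed
  have "einstein_slice (ball x r) g s kap \<sigma>"
  proof (intro einstein_slice.intro einstein_slice_axioms.intro P.einstein_patch_axioms)
    fix y assume "y \<in> ball x r"
    then have y: "y \<in> W" and \<rho>y: "\<rho> y = \<rho>0" using r \<rho>0 by auto
    show "\<sigma> y (s\<^sup>2 *\<^sub>R g y) = s" by (rule \<sigma>[OF y])
    show "invertible (s\<^sup>2 *\<^sub>R g y)" using inv[OF y] s by (simp add: scalar_invertible)
    have R: "ricci g y a b = \<rho>0 * s\<^sup>2 * g y $ a $ b" for a b
      using ric[OF y] \<rho>y by (simp add: scaled_def)
    have "scalar_curv g y = (\<Oplus>a. \<rho>0 * s\<^sup>2 * (\<Oplus>b. matrix_inv (g y) $ a $ b * g y $ b $ a))"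
      unfolding scalar_curv_def R sum_distrib_left by (intro sum.cong refl) (subst sym[OF y], simp)
    then have "scalar_curv g y = \<rho>0 * s\<^sup>2 * real CARD('n)"
      by (simp add: sum_matrix_inv(2)[OF inv[OF y]])
    then have sch: "schouten g y a b = 1 / (real CARD('n) - 2) * (1 - real CARD('n) / (2 * (real CARD('n) - 1))) * (\<rho>0 * s\<^sup>2 * g y $ a $ b)" for a b
      by (simp add: schouten_def R algebra_simps)
    have N: "real CARD('n) \<ge> 3" using n by simp
    then have "1 - real CARD('n) / (2 * (real CARD('n) - 1)) = (real CARD('n) - 2) / (2 * (real CARD('n) - 1))"
      by (simp add: field_simps)
    then have const: "1 / (real CARD('n) - 2) * (1 - real CARD('n) / (2 * (real CARD('n) - 1))) = 1 / (2 * (real CARD('n) - 1))"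
      using N by simp
    show "schouten g y a b = P.lam * scaled g s y a b" for a b
      unfolding sch const P.lam_def unfolding kap_def scaled_def by (simp add: mult.commute)
  qed fact
  with r show ?thesis by (intro that[of "ball x r"]) auto
qed

lemma has_signature_invertible:
  assumes "has_signature r s G"
  shows "invertible G"
proof -
  obtain B e where e: "\<And>i. e i = 1 \<or> e i = -1" and B: "pullback_form B G = (\<chi> i j. if i = j then e i else 0)"
    using assms unfolding has_signature_def by blast
  have "det (pullback_form B G) = prod e UNIV"
    unfolding B by (subst det_diagonal) auto
  moreover have "e i \<noteq> 0" for i using e[of i] by auto
  ultimately have "det (pullback_form B G) \<noteq> 0" by simp
  then show ?thesis by (simp add: pullback_form_def det_mul invertible_det_nz)
qed

section \<open>The factorisation on a conformally Einstein manifold\<close>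

theorem theorem5p2:
  fixes A :: "('m::{t2_space, second_countable_topology}, 'n::finite) chart set"
    and g :: "('m, 'n) chart \<Rightarrow> real ^ 'n \<Rightarrow> real ^ 'n ^ 'n"
    and \<sigma> :: "('m, 'n) chart \<Rightarrow> 'n density"
    and f :: "('m, 'n) chart \<Rightarrow> 'n form"
    and r s k l p :: nat
  assumes "CARD('n) \<ge> 3"
    and "smooth_atlas A"
    and "pseudo_riemannian_metric A r s g"
    and "einstein_scale A g \<sigma>"
    and "1 \<le> k" and "real k \<le> real CARD('n) / 2"
    and "1 \<le> p" and "p \<le> l - 1"
    and "f \<in> weighted_forms A g k (real k + real l - real CARD('n) / 2)"
  shows "\<forall>c\<in>A. \<forall>x\<in>chart_image c. \<forall>G\<in>conf_fibre (g c) x. \<forall>I. length I = k \<longrightarrow>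
    (let gE = scale_metric (g c) (\<sigma> c); n = real CARD('n) in
      1 / real k * (real k + (real l - real p) - n / 2) * (real k - (real l - real p) - n / 2)
        * L_op gE (\<sigma> c) k l (f c) x G I
      = \<sigma> c x G powi (- int p)
        * L_op gE (\<sigma> c) k (l - p)
            (Box_tilde gE (\<sigma> c) k p (real k + real l - n / 2) (f c)) x G I)"
proof (intro ballI allI impI)
  fix c x G and I :: "'n list"
  assume c: "c \<in> A" and x: "x \<in> chart_image c" and G: "G \<in> conf_fibre (g c) x" and I: "length I = k"
  define W where "W = chart_image c"
  define u where "u y = \<sigma> c y (g c y)" for y
  define gE where "gE = scale_metric (g c) (\<sigma> c)"
  define S where "S = \<sigma> c x G"
  define w where "w = real k + real l - real CARD('n) / 2"
  have W: "open W" using assms(2) c by (auto simp: smooth_atlas_def is_chart_def W_def)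
  have fib: "t\<^sup>2 *\<^sub>R g c y \<in> conf_fibre (g c) y" if "t > 0" for t y
    using that by (auto simp: conf_fibre_def)
  have fib1: "g c y \<in> conf_fibre (g c) y" for y using fib[of 1 y] by simp
  have gsm: "smooth_on W (\<lambda>y. g c y $ i $ j)" for i j
    using assms(3) c by (auto simp: pseudo_riemannian_metric_def W_def)
  have gsym: "transpose (g c y) = g c y" and sig: "has_signature r s (g c y)" if "y \<in> W" for y
    using assms(3) c that by (auto simp: pseudo_riemannian_metric_def W_def)
  note ginv = has_signature_invertible[OF sig]
  have \<sigma>wf: "(\<lambda>c x G I. \<sigma> c x G) \<in> weighted_forms A g 0 1" using assms(4) by (simp add: einstein_scale_def)
  have usm: "smooth_on W u"
    using \<sigma>wf c unfolding weighted_forms_def u_def[abs_def] W_def by auto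
  have upos: "u y > 0" if "y \<in> W" for y
    using assms(4) c that fib1 unfolding einstein_scale_def u_def W_def by blast
  have \<sigma>hom: "\<sigma> c y (t\<^sup>2 *\<^sub>R H) = t * \<sigma> c y H" if "y \<in> W" "H \<in> conf_fibre (g c) y" "t > 0" for y H t
    using \<sigma>wf c that unfolding weighted_forms_def W_def by (auto dest!: bspec)
  have fhom: "f c y (t\<^sup>2 *\<^sub>R H) J = t powr w * f c y H J"
    if "y \<in> W" "H \<in> conf_fibre (g c) y" "t > 0" "length J = k" for y H t J
    using assms(9) c that unfolding weighted_forms_def W_def w_def by auto
  have fsm: "smooth_on W (\<lambda>y. f c y (g c y) J)" if "length J = k" for J
    using assms(9) c that unfolding weighted_forms_def W_def by auto
  have falt: "alternating k (f c y H)" if "y \<in> W" "H \<in> conf_fibre (g c) y" for y H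
    using assms(9) c that unfolding weighted_forms_def W_def by (intro alternatingI_permute) auto
  have gE: "gE y = (inverse (u y))\<^sup>2 *\<^sub>R g c y" if "y \<in> W" for y
    using upos[OF that] unfolding gE_def scale_metric_def u_def[symmetric]
    by (simp add: power_int_minus power_inverse)
  have Spos: "S > 0"
    using assms(4) c x G unfolding einstein_scale_def S_def by blast
  have slice: "S\<^sup>2 *\<^sub>R gE y = (S * inverse (u y))\<^sup>2 *\<^sub>R g c y" if "y \<in> W" for y
    using gE[OF that] by (simp add: power_mult_distrib)
  have pos: "S * inverse (u y) > 0" if "y \<in> W" for y using Spos upos[OF that] by simp
  have xW: "x \<in> W" using x by (simp add: W_def)
  have SG: "S\<^sup>2 *\<^sub>R gE x = G"
  proof -
    obtain t where t: "t > 0" "G = t\<^sup>2 *\<^sub>R g c x" using G by (auto simp: conf_fibre_def)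
    have "S = t * u x" unfolding S_def t(2) u_def by (rule \<sigma>hom[OF xW fib1 t(1)])
    then have "S * inverse (u x) = t" using upos[OF xW] by simp
    then show ?thesis using slice[OF xW] t(2) by simp
  qed
  have \<sigma>S: "\<sigma> c y (S\<^sup>2 *\<^sub>R gE y) = S" if "y \<in> W" for y
    unfolding slice[OF that] \<sigma>hom[OF that fib1 pos[OF that]] u_def[symmetric] using upos[OF that] by simp
  have uinv: "smooth_on W (\<lambda>y. inverse (u y))"
    using upos by (intro smooth_on_inverse W usm) (auto simp: less_imp_neq[symmetric])
  have reg: "regular_metric W gE"
    unfolding regular_metric_def
  proof (intro conjI allI ballI W)
    show "smooth_on W (\<lambda>y. gE y $ i $ j)" for i j
    proof (rule smooth_on_cong[OF W])
      show "smooth_on W (\<lambda>y. (inverse (u y) * inverse (u y)) * g c y $ i $ j)"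
        by (intro smooth_on_mult W uinv gsm)
    qed (simp add: gE power2_eq_square)
    fix y assume y: "y \<in> W"
    show "transpose (gE y) = gE y" using gsym[OF y] by (simp add: gE[OF y] transpose_self_iff)
    show "invertible (gE y)" using ginv[OF y] upos[OF y] by (simp add: gE[OF y] scalar_invertible)
  qed
  have ein: "\<exists>c0. \<forall>a b. ricci gE y a b = c0 * gE y $ a $ b" if "y \<in> W" for y
    using assms(4) c that unfolding einstein_scale_def gE_def W_def by blast
  obtain V kap where V: "x \<in> V" "V \<subseteq> W" and es: "einstein_slice V gE S kap (\<sigma> c)"
    using einstein_slice_exists[where \<sigma> = "\<sigma> c", OF assms(1) reg Spos xW ein \<sigma>S] by blast
  interpret E: einstein_slice V gE S kap "\<sigma> c" by (rule es)
  obtain m where m: "k = Suc m" using assms(5) by (cases k) auto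
  have "E.form k (E.slice (f c))"
    unfolding E.form_def E.smooth_field_def
  proof (intro conjI allI impI ballI)
    fix J :: "'n list" assume J: "length J = k"
    have "smooth_on W (\<lambda>y. (S * inverse (u y)) powr w * f c y (g c y) J)"
      using pos by (intro smooth_on_mult smooth_on_powr smooth_on_const W uinv fsm J) auto
    then have "smooth_on V (\<lambda>y. (S * inverse (u y)) powr w * f c y (g c y) J)"
      using V(2) by (rule smooth_on_subset)
    moreover have "(S * inverse (u y)) powr w * f c y (g c y) J = E.slice (f c) y J" if "y \<in> V" for y
    proof -
      have y: "y \<in> W" using that V by auto
      show ?thesis unfolding E.slice_def slice[OF y] fhom[OF y fib1 pos[OF y] J] ..
    qed
    ultimately show "smooth_on V (\<lambda>y. E.slice (f c) y J)"
      by (rule smooth_on_cong[OF E.open_U, rotated -1])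
  next
    fix y assume "y \<in> V"
    then have y: "y \<in> W" using V by auto
    show "alternating k (E.slice (f c) y)"
      unfolding E.slice_def slice[OF y] by (intro falt y fib pos)
  qed
  moreover have "p < l" using assms(7,8) by simp
  ultimately show "let gE = scale_metric (g c) (\<sigma> c); n = real CARD('n) in
      1 / real k * (real k + (real l - real p) - n / 2) * (real k - (real l - real p) - n / 2)
        * L_op gE (\<sigma> c) k l (f c) x G I
      = \<sigma> c x G powi (- int p)
        * L_op gE (\<sigma> c) k (l - p)
            (Box_tilde gE (\<sigma> c) k p (real k + real l - n / 2) (f c)) x G I"
    using E.factorisation_slice[of m "f c" x I p l] V(1) I
    unfolding Let_def gE_def[symmetric] S_def[symmetric] m[symmetric] SG by blast
qed

end
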